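(* Suppose $(X,f)$ is topologically expanding and topologically transitive (resp. $f$ is a homeomorphism of $X$ and $(X,f)$ is topologically hyperbolic and topologically transitive). Let $\varphi:X\to\mathbb{R}$ be continuous with $\operatorname{Int}(L_\varphi)\neq\emptyset$. Then for every $k=2,3,4,\dots$ the set $AP(f)\cap I_\varphi(f)\cap\mathbb{E}_k$ is nonempty.
   Context: $(X,f)$: a continuous map $f$ on a compact metric space $(X,d)$. $f$ is positively expansive if there is $c>0$ such that for all $x\ne y$ in $X$, $d(f^ix,f^iy)>c$ for some $i\ge0$; a homeomorphism $f$ is expansive if there is $c>0$ such that for all $x\neq y$, $d(f^ix,f^iy)>c$ for some $i\in\mathbb{Z}$. $(X,f)$ has the shadowing property if for every $\varepsilon>0$ there is $\delta>0$ such that every sequence $(x_n)_{n\ge0}$ with $d(f(x_n),x_{n+1})<\delta$ for all $n\geq 0$ admits $y\in X$ with $d(f^n(y),x_n)<\varepsilon$ for all $n\ge0$. $(X,f)$ is topologically expanding if $X$ is infinite, $f$ is positively expansive and has the shadowing property. A homeomorphism $(X,f)$ is topologically hyperbolic if $X$ is infinite, $f$ is expansive and has the shadowing property. Transitive: for all non-empty open $U,V$ there is an integer $n$ with $f^n(U)\cap V\neq\emptyset$. $AP(f)$ is the set of almost periodic points: $x$ such that for every open neighborhood $U$ of $x$ there is $N\in\mathbb{N}$ such that for every $n\in\mathbb{N}$, $f^k(x)\in U$ for some $k\in[n,n+N]$. $I_\varphi(f)$ is the set of $x\in X$ for which $\lim_{n\to\infty}\frac1n\sum_{i=0}^{n-1}\varphi(f^ix)$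 does not exist. $M(f,X)$ is the set of $f$-invariant Borel probability measures; $M_{erg}(f,\Lambda)$ is the set of ergodic ones supported on $\Lambda$; $\omega_f(x)$ is the $\omega$-limit set of $x$; $\mathbb{E}_k=\{x\in X:\#M_{erg}(f,\omega_f(x))=k\}$. $\operatorname{Int}(L_\varphi)=\bigl(\inf_{\mu\in M(f,X)}\int\varphi\,d\mu,\ \sup_{\mu\in M(f,X)}\int\varphi\,d\mu\bigr)$.
   Formalization: Transitivity is taken with a non-negative integer n: if negative n are allowed the claim is false, e.g. for the two-sided subshift of {0,1}^Z forbidding the word 10 with φ(x)=x_0, whose only almost periodic points are two fixed points. *)

theory Defs
  imports "HOL-Probability.Probability"
begin

text \<open>
  A system \<open>(X, f)\<close> is given by a compact carrier set \<open>X\<close> of a metric-space type and a map \<open>f\<close>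
  of which only the values on \<open>X\<close> matter. Open sets are taken relative to \<open>X\<close>.
\<close>

definition dynamical_system :: "'a::metric_space set \<Rightarrow> ('a \<Rightarrow> 'a) \<Rightarrow> bool" where
  "dynamical_system X f \<longleftrightarrow> compact X \<and> continuous_on X f \<and> f ` X \<subseteq> X"

definition homeo_on :: "'a::metric_space set \<Rightarrow> ('a \<Rightarrow> 'a) \<Rightarrow> bool" where
  "homeo_on X f \<longleftrightarrow> (\<exists>g. homeomorphism X X f g)"

text \<open>Iterates with integer exponent, meaningful on \<open>X\<close> when \<open>f\<close> is a bijection of \<open>X\<close>.\<close>

definition int_iter :: "'a set \<Rightarrow> ('a \<Rightarrow> 'a) \<Rightarrow> int \<Rightarrow> 'a \<Rightarrow> 'a" where
  "int_iter X f i = (if i \<ge> 0 then f ^^ nat i else inv_into X f ^^ nat (- i))"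

definition positively_expansive :: "'a::metric_space set \<Rightarrow> ('a \<Rightarrow> 'a) \<Rightarrow> bool" where
  "positively_expansive X f \<longleftrightarrow>
    (\<exists>c>0. \<forall>x\<in>X. \<forall>y\<in>X. x \<noteq> y \<longrightarrow> (\<exists>i::nat. dist ((f ^^ i) x) ((f ^^ i) y) > c))"

definition expansive :: "'a::metric_space set \<Rightarrow> ('a \<Rightarrow> 'a) \<Rightarrow> bool" where
  "expansive X f \<longleftrightarrow>
    (\<exists>c>0. \<forall>x\<in>X. \<forall>y\<in>X. x \<noteq> y \<longrightarrow> (\<exists>i::int. dist (int_iter X f i x) (int_iter X f i y) > c))"

definition shadowing :: "'a::metric_space set \<Rightarrow> ('a \<Rightarrow> 'a) \<Rightarrow> bool" where
  "shadowing X f \<longleftrightarrow>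
    (\<forall>\<epsilon>>0. \<exists>\<delta>>0. \<forall>x :: nat \<Rightarrow> 'a.
      (\<forall>n. x n \<in> X) \<and> (\<forall>n. dist (f (x n)) (x (Suc n)) < \<delta>) \<longrightarrow>
      (\<exists>y\<in>X. \<forall>n. dist ((f ^^ n) y) (x n) < \<epsilon>))"

definition topologically_expanding :: "'a::metric_space set \<Rightarrow> ('a \<Rightarrow> 'a) \<Rightarrow> bool" where
  "topologically_expanding X f \<longleftrightarrow> infinite X \<and> positively_expansive X f \<and> shadowing X f"

definition topologically_hyperbolic :: "'a::metric_space set \<Rightarrow> ('a \<Rightarrow> 'a) \<Rightarrow> bool" where
  "topologically_hyperbolic X f \<longleftrightarrow>
    homeo_on X f \<and> infinite X \<and> expansive X f \<and> shadowing X f"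

text \<open>
  The exponent ranges over the nonnegative integers, the iterates that exist for every continuous
  map. Allowing negative exponents for homeomorphisms would give a strictly weaker notion: the
  two-sided shift on the sequences over \<open>{0, 1}\<close> in which 1 is never followed by 0 would satisfy it.
\<close>

definition topologically_transitive :: "'a::metric_space set \<Rightarrow> ('a \<Rightarrow> 'a) \<Rightarrow> bool" where
  "topologically_transitive X f \<longleftrightarrow>
    (\<forall>U V. openin (top_of_set X) U \<and> U \<noteq> {} \<and> openin (top_of_set X) V \<and> V \<noteq> {} \<longrightarrow>
      (\<exists>n::nat. (f ^^ n) ` U \<inter> V \<noteq> {}))"

definition AP :: "'a::metric_space set \<Rightarrow> ('a \<Rightarrow> 'a) \<Rightarrow> 'a set" where
  "AP X f = {x \<in> X. \<forall>U. openin (top_of_set X) U \<and> x \<in> U \<longrightarrow>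
    (\<exists>N::nat. \<forall>n::nat. \<exists>k\<in>{n..n + N}. (f ^^ k) x \<in> U)}"

definition irregular_set :: "'a set \<Rightarrow> ('a \<Rightarrow> 'a) \<Rightarrow> ('a \<Rightarrow> real) \<Rightarrow> 'a set" where
  "irregular_set X f \<phi> =
    {x \<in> X. \<not> convergent (\<lambda>n::nat. (1 / real n) * (\<Sum>i<n. \<phi> ((f ^^ i) x)))}"

text \<open>
  Equality of values of type \<open>'a measure\<close> with the same measurable sets is equality of the measures
  of these sets, so fixing \<open>sets \<mu>\<close> makes counting invariant measures meaningful.
\<close>

definition invariant_measures :: "'a::metric_space set \<Rightarrow> ('a \<Rightarrow> 'a) \<Rightarrow> 'a measure set" where
  "invariant_measures X f =
    {\<mu>. prob_space \<mu> \<and> sets \<mu> = sets (restrict_space borel X) \<and>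
        (\<forall>A\<in>sets \<mu>. emeasure \<mu> (f -` A \<inter> X) = emeasure \<mu> A)}"

definition ergodic_measure :: "'a::metric_space set \<Rightarrow> ('a \<Rightarrow> 'a) \<Rightarrow> 'a measure \<Rightarrow> bool" where
  "ergodic_measure X f \<mu> \<longleftrightarrow> \<mu> \<in> invariant_measures X f \<and>
    (\<forall>A\<in>sets \<mu>. f -` A \<inter> X = A \<longrightarrow> emeasure \<mu> A = 0 \<or> emeasure \<mu> A = 1)"

text \<open>For a closed set \<open>\<Lambda>\<close>, full measure of \<open>\<Lambda>\<close> means that \<open>\<Lambda>\<close> contains the support.\<close>

definition ergodic_measures_on ::
    "'a::metric_space set \<Rightarrow> ('a \<Rightarrow> 'a) \<Rightarrow> 'a set \<Rightarrow> 'a measure set" where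
  "ergodic_measures_on X f \<Lambda> = {\<mu>. ergodic_measure X f \<mu> \<and> emeasure \<mu> \<Lambda> = 1}"

definition omega_limit :: "('a::metric_space \<Rightarrow> 'a) \<Rightarrow> 'a \<Rightarrow> 'a set" where
  "omega_limit f x = (\<Inter>n::nat. closure {(f ^^ k) x | k. k \<ge> n})"

definition E_set :: "'a::metric_space set \<Rightarrow> ('a \<Rightarrow> 'a) \<Rightarrow> nat \<Rightarrow> 'a set" where
  "E_set X f k = {x \<in> X. finite (ergodic_measures_on X f (omega_limit f x)) \<and>
    card (ergodic_measures_on X f (omega_limit f x)) = k}"

definition Int_L :: "'a::metric_space set \<Rightarrow> ('a \<Rightarrow> 'a) \<Rightarrow> ('a \<Rightarrow> real) \<Rightarrow> real set" where
  "Int_L X f \<phi> =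
    {(INF \<mu>\<in>invariant_measures X f. integral\<^sup>L \<mu> \<phi>) <..<
     (SUP \<mu>\<in>invariant_measures X f. integral\<^sup>L \<mu> \<phi>)}"

end

theory Submission
  imports Defs
begin

text \<open>
  The required point is the trace of a two-sided Toeplitz-like concatenation of closed pseudo-orbits.

  \<^bold>\<open>Coding.\<close> Shadowing and expansivity give every two-sided pseudo-orbit \<open>p\<close> a tracing point
  \<open>\<pi> p\<close> with \<open>f (\<pi> p) = \<pi> (\<lambda>i. p (i + 1))\<close> that depends continuously on \<open>p\<close> for the product topology
  (\<open>tracing_expanding\<close>, \<open>tracing_hyperbolic\<close>). In the positively expansive case only the nonnegative
  half of \<open>p\<close> matters, so both cases are handled by the same two-sided pseudo-orbits. Two invariant
  measures with different integrals of \<open>\<phi>\<close>, transitivity and finite concatenation provide \<open>k\<close> loops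
  through one point, of a common length, along which the averages of \<open>\<phi>\<close> are pairwise far apart
  compared with the tracing error (\<open>loop_families\<close>).

  \<^bold>\<open>Blocks.\<close> Starting from the \<open>k\<close> loops, the block of type \<open>j\<close> of level \<open>n + 1\<close> consists of one block
  of every type of level \<open>n\<close> followed by very many blocks of type \<open>j\<close> of level \<open>n\<close>. The prefix makes the
  limiting system minimal, while its small relative length keeps the \<open>k\<close> types statistically
  different. The uniform measures on the periodic orbits traced by the repeated blocks of type \<open>j\<close>
  converge to an invariant measure \<open>\<mu> j\<close> (\<open>limit_of_nested_averages\<close>): a random position in a block
  of level \<open>n + 1\<close> determines one in a block of level \<open>n\<close>, and by the Borel-Cantelli lemma the points at
  these positions converge almost surely.

  \<^bold>\<open>Exactly \<open>k\<close> ergodic measures.\<close> Let \<open>avg n\<close> be the time average over the length of a block of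
  level \<open>n\<close>. Most windows of this length lie in a run of blocks of one type, and so, by choice of the
  lengths, \<open>avg n \<phi>\<close> converges almost everywhere for every invariant measure on the orbit closure,
  with limit one of the numbers \<open>\<integral>\<phi> \<partial>\<mu> j\<close>. The set of points where the limit is \<open>\<integral>\<phi> \<partial>\<mu> j\<close> is invariant, and
  an invariant measure conditioned to it is \<open>\<mu> j\<close>, since along this set the averages of any
  continuous \<open>g\<close> converge in mean to \<open>\<integral>g \<partial>\<mu> j\<close>. This identifies the ergodic measures without an
  ergodic theorem (\<open>ergodic_measures_on_eq\<close>).

  \<^bold>\<open>Irregularity.\<close> The origin of the concatenation lies in a block of type \<open>n mod 2\<close> of level \<open>n\<close>, near
  its left end. Hence the averages of \<open>\<phi>\<close> up to the right ends of these blocks accumulate at the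
  different numbers \<open>\<integral>\<phi> \<partial>\<mu> 0\<close> and \<open>\<integral>\<phi> \<partial>\<mu> 1\<close> (\<open>x0_irregular\<close>).
\<close>

section \<open>Tracing of two-sided pseudo-orbits\<close>

text \<open>
  A two-sided pseudo-orbit, indexed by the integers even if \<open>f\<close> is not invertible.
\<close>

definition pseudo_orbit :: "'a::metric_space set \<Rightarrow> ('a \<Rightarrow> 'a) \<Rightarrow> real \<Rightarrow> (int \<Rightarrow> 'a) \<Rightarrow> bool" where
  "pseudo_orbit X f \<delta> p \<longleftrightarrow> (\<forall>i. p i \<in> X \<and> dist (f (p i)) (p (i + 1)) < \<delta>)"

text \<open>
  The map \<open>\<pi>\<close> sends a two-sided pseudo-orbit to a point tracing it. It conjugates the shift to \<open>f\<close> and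
  is uniformly continuous: \<open>\<pi> p\<close> is known up to \<open>e\<close> from a finite window of \<open>p\<close> around the origin.
  Closeness is demanded at time zero only, as equivariance carries it over to all later times.
\<close>

definition tracing ::
    "'a::metric_space set \<Rightarrow> ('a \<Rightarrow> 'a) \<Rightarrow> real \<Rightarrow> real \<Rightarrow> ((int \<Rightarrow> 'a) \<Rightarrow> 'a) \<Rightarrow> bool" where
  "tracing X f \<delta> \<epsilon> \<pi> \<longleftrightarrow>
    (\<forall>p. pseudo_orbit X f \<delta> p \<longrightarrow>
       \<pi> p \<in> X \<and> dist (\<pi> p) (p 0) \<le> \<epsilon> \<and> f (\<pi> p) = \<pi> (\<lambda>i. p (i + 1))) \<and>
    (\<forall>e>0. \<exists>R::nat. \<forall>p p'. pseudo_orbit X f \<delta> p \<and> pseudo_orbit X f \<delta> p' \<and>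
       (\<forall>i. \<bar>i\<bar> \<le> int R \<longrightarrow> p i = p' i) \<longrightarrow> dist (\<pi> p) (\<pi> p') < e)"

lemma pseudo_orbit_shift:
  "pseudo_orbit X f \<delta> p \<Longrightarrow> pseudo_orbit X f \<delta> (\<lambda>i. p (i + a))"
  unfolding pseudo_orbit_def by (metis ab_semigroup_add_class.add_ac(1) add.commute)

text \<open>
  The family \<open>F i\<close> with \<open>i \<in> I\<close> stands for the iterates of \<open>f\<close>: those with \<open>i \<ge> 0\<close> in the positively
  expansive case, all of them for an expansive homeomorphism. By compactness, finitely many indices
  suffice to separate points at a given distance.
\<close>

lemma uniform_expansivity:
  fixes X :: "'a::metric_space set" and F :: "int \<Rightarrow> 'a \<Rightarrow> 'a"
  assumes X: "compact X" and cont: "\<And>i. i \<in> I \<Longrightarrow> continuous_on X (F i)"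
    and exp: "\<And>x y. \<lbrakk>x \<in> X; y \<in> X; \<And>i. i \<in> I \<Longrightarrow> dist (F i x) (F i y) \<le> c\<rbrakk> \<Longrightarrow> x = y"
    and e: "e > 0"
  shows "\<exists>R::nat. \<forall>x\<in>X. \<forall>y\<in>X.
           (\<forall>i\<in>I. \<bar>i\<bar> \<le> int R \<longrightarrow> dist (F i x) (F i y) \<le> c) \<longrightarrow> dist x y < e"
proof (rule ccontr)
  assume "\<not> ?thesis"
  then have "\<forall>R::nat. \<exists>z. z \<in> X \<times> X \<and>
      (\<forall>i\<in>I. \<bar>i\<bar> \<le> int R \<longrightarrow> dist (F i (fst z)) (F i (snd z)) \<le> c) \<and> e \<le> dist (fst z) (snd z)"
    by (force simp: not_less)
  then obtain z where z: "\<And>R::nat. z R \<in> X \<times> X"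
      "\<And>R i. \<lbrakk>i \<in> I; \<bar>i\<bar> \<le> int R\<rbrakk> \<Longrightarrow> dist (F i (fst (z R))) (F i (snd (z R))) \<le> c"
      "\<And>R. e \<le> dist (fst (z R)) (snd (z R))"
    by metis
  have "seq_compact (X \<times> X)"
    using X by (intro compact_imp_seq_compact compact_Times)
  then obtain l r where l: "l \<in> X \<times> X" and r: "strict_mono r" and lim: "(z \<circ> r) \<longlonglongrightarrow> l"
    using z(1) by (metis seq_compact_def)
  have lim1: "(\<lambda>n. fst (z (r n))) \<longlonglongrightarrow> fst l" and lim2: "(\<lambda>n. snd (z (r n))) \<longlonglongrightarrow> snd l"
    using tendsto_fst[OF lim] tendsto_snd[OF lim] by (simp_all add: o_def)
  have zX: "fst (z R) \<in> X" "snd (z R) \<in> X" for R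
    using z(1)[of R] by auto
  have lX: "fst l \<in> X" "snd l \<in> X" using l by auto
  have "fst l = snd l"
  proof (rule exp[OF lX])
    fix i assume i: "i \<in> I"
    have t: "(\<lambda>n. F i (fst (z (r n)))) \<longlonglongrightarrow> F i (fst l)"
      using continuous_on_tendsto_compose[OF cont[OF i] lim1 lX(1)] zX by simp
    have t': "(\<lambda>n. F i (snd (z (r n)))) \<longlonglongrightarrow> F i (snd l)"
      using continuous_on_tendsto_compose[OF cont[OF i] lim2 lX(2)] zX by simp
    have ev: "\<forall>\<^sub>F n in sequentially. dist (F i (fst (z (r n)))) (F i (snd (z (r n)))) \<le> c"
    proof (rule eventually_sequentiallyI[of "nat \<bar>i\<bar>"])
      fix n assume "nat \<bar>i\<bar> \<le> n"
      then have "\<bar>i\<bar> \<le> int (r n)" using seq_suble[OF r, of n] by linarith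
      then show "dist (F i (fst (z (r n)))) (F i (snd (z (r n)))) \<le> c" using z(2) i by blast
    qed
    show "dist (F i (fst l)) (F i (snd l)) \<le> c"
      by (rule tendsto_upperbound[OF tendsto_dist[OF t t'] ev]) simp
  qed
  moreover have "e \<le> dist (fst l) (snd l)"
    by (rule tendsto_lowerbound[OF tendsto_dist[OF lim1 lim2]]) (auto simp: z(3))
  ultimately show False using e by simp
qed

lemma tracing_from_shadowing:
  fixes X :: "'a::metric_space set" and F :: "int \<Rightarrow> 'a \<Rightarrow> 'a"
  assumes X: "compact X" and fX: "f ` X \<subseteq> X"
    and I: "0 \<in> I" "\<And>i. i \<in> I \<Longrightarrow> i + 1 \<in> I"
    and cont: "\<And>i. i \<in> I \<Longrightarrow> continuous_on X (F i)"
    and F0: "\<And>x. F 0 x = x" and Ff: "\<And>i x. \<lbrakk>i \<in> I; x \<in> X\<rbrakk> \<Longrightarrow> F i (f x) = F (i + 1) x"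
    and c: "c > 0"
    and exp: "\<And>x y. \<lbrakk>x \<in> X; y \<in> X; \<And>i. i \<in> I \<Longrightarrow> dist (F i x) (F i y) \<le> c\<rbrakk> \<Longrightarrow> x = y"
    and shad: "\<And>\<epsilon>. \<epsilon> > 0 \<Longrightarrow> \<exists>\<delta>>0. \<forall>p. pseudo_orbit X f \<delta> p \<longrightarrow>
        (\<exists>y\<in>X. \<forall>i\<in>I. dist (F i y) (p i) \<le> \<epsilon>)"
    and \<epsilon>: "\<epsilon> > 0"
  shows "\<exists>\<delta>>0. \<exists>\<pi>. tracing X f \<delta> \<epsilon> \<pi>"
proof -
  \<comment> \<open>two points tracing the same pseudo-orbit up to \<open>c / 2\<close> cannot be separated\<close>
  define \<epsilon>' where "\<epsilon>' = min \<epsilon> (c / 2)"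
  have "\<epsilon>' > 0" using \<epsilon> c by (simp add: \<epsilon>'_def)
  from shad[OF this] obtain \<delta> where \<delta>: "\<delta> > 0"
    and ex: "\<And>p. pseudo_orbit X f \<delta> p \<Longrightarrow> \<exists>y\<in>X. \<forall>i\<in>I. dist (F i y) (p i) \<le> \<epsilon>'"
    by auto
  obtain \<pi> where \<pi>X: "\<And>p. pseudo_orbit X f \<delta> p \<Longrightarrow> \<pi> p \<in> X"
    and \<pi>: "\<And>p i. \<lbrakk>pseudo_orbit X f \<delta> p; i \<in> I\<rbrakk> \<Longrightarrow> dist (F i (\<pi> p)) (p i) \<le> \<epsilon>'"
    using ex by metis
  have close: "dist (F i x) (F i y) \<le> c"
    if "dist (F i x) q \<le> \<epsilon>'" "dist (F i y) q \<le> \<epsilon>'" for i x y q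
    using that dist_triangle2[of "F i x" "F i y" q] by (simp add: \<epsilon>'_def)
  have step: "f (\<pi> p) = \<pi> (\<lambda>i. p (i + 1))" if p: "pseudo_orbit X f \<delta> p" for p
  proof (rule exp)
    note q = pseudo_orbit_shift[OF p, of 1]
    show "f (\<pi> p) \<in> X" "\<pi> (\<lambda>i. p (i + 1)) \<in> X" using \<pi>X p q fX by auto
    fix i assume i: "i \<in> I"
    show "dist (F i (f (\<pi> p))) (F i (\<pi> (\<lambda>i. p (i + 1)))) \<le> c"
      by (rule close[of _ _ "p (i + 1)"]) (use Ff[OF i \<pi>X[OF p]] \<pi>[OF p I(2)[OF i]] \<pi>[OF q i] in simp_all)
  qed
  have loc: "\<exists>R::nat. \<forall>p p'. pseudo_orbit X f \<delta> p \<and> pseudo_orbit X f \<delta> p' \<and>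
       (\<forall>i. \<bar>i\<bar> \<le> int R \<longrightarrow> p i = p' i) \<longrightarrow> dist (\<pi> p) (\<pi> p') < e" if e: "e > 0" for e
  proof -
    obtain R :: nat where R: "\<forall>x\<in>X. \<forall>y\<in>X.
        (\<forall>i\<in>I. \<bar>i\<bar> \<le> int R \<longrightarrow> dist (F i x) (F i y) \<le> c) \<longrightarrow> dist x y < e"
      using uniform_expansivity[of X I F c e, OF X cont exp e] by blast
    have "dist (\<pi> p) (\<pi> p') < e"
      if p: "pseudo_orbit X f \<delta> p" "pseudo_orbit X f \<delta> p'" "\<forall>i. \<bar>i\<bar> \<le> int R \<longrightarrow> p i = p' i" for p p'
    proof -
      have "dist (F i (\<pi> p)) (F i (\<pi> p')) \<le> c" if "i \<in> I" "\<bar>i\<bar> \<le> int R" for i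
        using close[OF \<pi>[OF p(1) that(1)], of "\<pi> p'"] \<pi>[OF p(2) that(1)] p(3) that by simp
      then show ?thesis using R \<pi>X p by blast
    qed
    then show ?thesis by blast
  qed
  have "dist (\<pi> p) (p 0) \<le> \<epsilon>" if "pseudo_orbit X f \<delta> p" for p
    using \<pi>[OF that I(1)] by (simp add: F0 \<epsilon>'_def)
  then have "tracing X f \<delta> \<epsilon> \<pi>" unfolding tracing_def using \<pi>X step loc by blast
  then show ?thesis using \<delta> by blast
qed

lemma funpow_closed: "f ` X \<subseteq> X \<Longrightarrow> x \<in> X \<Longrightarrow> (f ^^ n) x \<in> X"
  by (induction n) auto

lemma continuous_on_funpow:
  fixes f :: "'a::topological_space \<Rightarrow> 'a"
  assumes "continuous_on X f" "f ` X \<subseteq> X"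
  shows "continuous_on X (f ^^ n)"
proof (induction n)
  case (Suc n)
  have "continuous_on X (f \<circ> f ^^ n)"
    using assms funpow_closed[OF assms(2)]
    by (intro continuous_on_compose Suc) (auto intro: continuous_on_subset)
  then show ?case by simp
qed (simp add: id_def)

lemma tracing_expanding:
  assumes ds: "dynamical_system X f" and te: "topologically_expanding X f" and \<epsilon>: "\<epsilon> > 0"
  shows "\<exists>\<delta>>0. \<exists>\<pi>. tracing X f \<delta> \<epsilon> \<pi>"
proof -
  have X: "compact X" "continuous_on X f" "f ` X \<subseteq> X"
    using ds by (auto simp: dynamical_system_def)
  obtain c where c: "c > 0"
    and exp: "\<forall>x\<in>X. \<forall>y\<in>X. x \<noteq> y \<longrightarrow> (\<exists>i::nat. dist ((f ^^ i) x) ((f ^^ i) y) > c)"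
    using te by (auto simp: topologically_expanding_def positively_expansive_def)
  show ?thesis
  proof (rule tracing_from_shadowing[where F = "\<lambda>i. f ^^ nat i" and I = "{0..}", OF X(1,3) _ _ _ _ _ c _ _ \<epsilon>])
    show "(f ^^ nat i) (f x) = (f ^^ nat (i + 1)) x" if "i \<in> {0..}" "x \<in> X" for i x
      using that by (simp add: nat_add_distrib funpow_swap1)
    show "x = y" if "x \<in> X" "y \<in> X"
      "\<And>i. i \<in> {0..} \<Longrightarrow> dist ((f ^^ nat i) x) ((f ^^ nat i) y) \<le> c" for x y
      using exp that by (metis atLeast_iff linorder_not_le nat_int of_nat_0_le_iff)
    show "\<exists>\<delta>>0. \<forall>p. pseudo_orbit X f \<delta> p \<longrightarrow>
        (\<exists>y\<in>X. \<forall>i\<in>{0..}. dist ((f ^^ nat i) y) (p i) \<le> e)" if "e > 0" for e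
    proof -
      obtain \<delta> where \<delta>: "\<delta> > 0" and sh: "\<And>x :: nat \<Rightarrow> 'a.
          \<lbrakk>\<forall>n. x n \<in> X; \<forall>n. dist (f (x n)) (x (Suc n)) < \<delta>\<rbrakk> \<Longrightarrow> \<exists>y\<in>X. \<forall>n. dist ((f ^^ n) y) (x n) < e"
        using te \<open>e > 0\<close> unfolding topologically_expanding_def shadowing_def by metis
      have "\<exists>y\<in>X. \<forall>i\<in>{0..}. dist ((f ^^ nat i) y) (p i) \<le> e" if p: "pseudo_orbit X f \<delta> p" for p
      proof -
        have "\<exists>y\<in>X. \<forall>n. dist ((f ^^ n) y) (p (int n)) < e"
          using p by (intro sh) (auto simp: pseudo_orbit_def add.commute)
        then obtain y where y: "y \<in> X" "\<And>n. dist ((f ^^ n) y) (p (int n)) < e" by blast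
        have "dist ((f ^^ nat i) y) (p i) \<le> e" if "i \<in> {0..}" for i
          using y(2)[of "nat i"] that by simp
        then show ?thesis using y(1) by blast
      qed
      then show ?thesis using \<delta> by blast
    qed
  qed (use X in \<open>auto intro: continuous_on_funpow\<close>)
qed

text \<open>
  One-sided shadowing of the translates of a two-sided pseudo-orbit gives points whose images under
  the iterates of \<open>f\<close> have a limit point tracing it in both directions.
\<close>

lemma tracing_hyperbolic:
  assumes ds: "dynamical_system X f" and th: "topologically_hyperbolic X f" and \<epsilon>: "\<epsilon> > 0"
  shows "\<exists>\<delta>>0. \<exists>\<pi>. tracing X f \<delta> \<epsilon> \<pi>"
proof -
  have X: "compact X" "continuous_on X f" "f ` X \<subseteq> X"
    using ds by (auto simp: dynamical_system_def)
  obtain g where hom: "homeomorphism X X f g"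
    using th by (auto simp: topologically_hyperbolic_def homeo_on_def)
  have fX: "f ` X = X" and gX: "g ` X = X" and contg: "continuous_on X g"
    and gf: "\<And>x. x \<in> X \<Longrightarrow> g (f x) = x" and fg: "\<And>x. x \<in> X \<Longrightarrow> f (g x) = x"
    using hom by (auto simp: homeomorphism_def)
  have inj: "inj_on f X" using gf by (metis inj_onI)
  have inv: "inv_into X f x = g x" if "x \<in> X" for x
    using that fg gX inj by (metis image_eqI inv_into_f_f)
  have invn: "(inv_into X f ^^ n) x = (g ^^ n) x" if "x \<in> X" for n x
    using that inv gX by (induction n) (auto simp: funpow_closed)
  obtain c where c: "c > 0" and exp: "\<forall>x\<in>X. \<forall>y\<in>X. x \<noteq> y \<longrightarrow>
      (\<exists>i::int. dist (int_iter X f i x) (int_iter X f i y) > c)"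
    using th by (auto simp: topologically_hyperbolic_def expansive_def)
  have cont: "continuous_on X (int_iter X f i)" for i
  proof (cases "i \<ge> 0")
    case True
    then show ?thesis using X continuous_on_funpow by (simp add: int_iter_def)
  next
    case False
    have "continuous_on X (g ^^ nat (- i))" using contg gX by (intro continuous_on_funpow) auto
    then show ?thesis using False by (simp add: int_iter_def invn cong: continuous_on_cong)
  qed
  have step: "int_iter X f i (f x) = int_iter X f (i + 1) x" if x: "x \<in> X" for i x
  proof (cases "i \<ge> 0")
    case True
    then show ?thesis by (simp add: int_iter_def nat_add_distrib funpow_swap1)
  next
    case False
    then obtain m where m: "nat (- i) = Suc m" "nat (- (i + 1)) = m"
      by (intro that[of "nat (- (i + 1))"]) auto
    have "int_iter X f i (f x) = (inv_into X f ^^ m) (inv_into X f (f x))"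
      using False m by (simp add: int_iter_def funpow_swap1)
    also have "\<dots> = (inv_into X f ^^ m) x" using x inj by simp
    also have "\<dots> = int_iter X f (i + 1) x"
      using False m by (cases "i = -1") (auto simp: int_iter_def)
    finally show ?thesis .
  qed
  have shift: "int_iter X f i ((f ^^ n) x) = int_iter X f (i + int n) x" if "x \<in> X" for i n x
    using that
  proof (induction n arbitrary: i)
    case (Suc n)
    have "(f ^^ n) x \<in> X" using Suc(2) X by (simp add: funpow_closed)
    then show ?case using step[of "(f ^^ n) x" i] Suc by (simp add: ac_simps)
  qed simp
  show ?thesis
  proof (rule tracing_from_shadowing[where F = "int_iter X f" and I = UNIV, OF X(1,3) _ _ _ _ _ c _ _ \<epsilon>])
    show "x = y" if "x \<in> X" "y \<in> X"
      "\<And>i. i \<in> UNIV \<Longrightarrow> dist (int_iter X f i x) (int_iter X f i y) \<le> c" for x y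
      using exp that by (metis UNIV_I linorder_not_le)
    show "\<exists>\<delta>>0. \<forall>p. pseudo_orbit X f \<delta> p \<longrightarrow>
        (\<exists>y\<in>X. \<forall>i\<in>UNIV. dist (int_iter X f i y) (p i) \<le> e)" if "e > 0" for e
    proof -
      obtain \<delta> where \<delta>: "\<delta> > 0" and sh: "\<And>x :: nat \<Rightarrow> 'a.
          \<lbrakk>\<forall>n. x n \<in> X; \<forall>n. dist (f (x n)) (x (Suc n)) < \<delta>\<rbrakk> \<Longrightarrow> \<exists>y\<in>X. \<forall>n. dist ((f ^^ n) y) (x n) < e"
        using th \<open>e > 0\<close> unfolding topologically_hyperbolic_def shadowing_def by metis
      have "\<exists>y\<in>X. \<forall>i. dist (int_iter X f i y) (p i) \<le> e" if p: "pseudo_orbit X f \<delta> p" for p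
      proof -
        have "\<exists>y\<in>X. \<forall>n. dist ((f ^^ n) y) (p (int n - int N)) < e" for N
          using pseudo_orbit_shift[OF p, of "- int N"]
          by (intro sh) (auto simp: pseudo_orbit_def algebra_simps)
        then obtain y where y: "\<And>N. y N \<in> X" "\<And>N n. dist ((f ^^ n) (y N)) (p (int n - int N)) < e"
          by metis
        define v where "v N = (f ^^ N) (y N)" for N
        have vX: "v N \<in> X" for N using y(1) X by (simp add: v_def funpow_closed)
        have v: "dist (int_iter X f i (v N)) (p i) \<le> e" if "int N \<ge> - i" for i N
        proof -
          have "int_iter X f i (v N) = (f ^^ nat (i + int N)) (y N)"
            using shift[OF y(1)] that by (simp add: v_def int_iter_def)
          then show ?thesis using y(2)[of "nat (i + int N)" N] that by simp
        qed
        obtain l r where l: "l \<in> X" and r: "strict_mono r" and lim: "(v \<circ> r) \<longlonglongrightarrow> l"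
          using X(1) vX by (metis compact_imp_seq_compact seq_compact_def)
        have "dist (int_iter X f i l) (p i) \<le> e" for i
        proof -
          have "(\<lambda>n. int_iter X f i (v (r n))) \<longlonglongrightarrow> int_iter X f i l"
            using continuous_on_tendsto_compose[OF cont[of i] lim l] vX by simp
          then have "(\<lambda>n. dist (int_iter X f i (v (r n))) (p i)) \<longlonglongrightarrow> dist (int_iter X f i l) (p i)"
            by (intro tendsto_intros)
          moreover have "\<forall>\<^sub>F n in sequentially. dist (int_iter X f i (v (r n))) (p i) \<le> e"
          proof (rule eventually_sequentiallyI[of "nat (- i)"])
            fix n assume "nat (- i) \<le> n"
            then have "int (r n) \<ge> - i" using seq_suble[OF r, of n] by linarith
            then show "dist (int_iter X f i (v (r n))) (p i) \<le> e" by (rule v)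
          qed
          ultimately show ?thesis by (rule tendsto_upperbound) simp
        qed
        then show ?thesis using l by blast
      qed
      then show ?thesis using \<delta> by auto
    qed
  qed (use X cont step in \<open>auto simp: int_iter_def\<close>)
qed

section \<open>Chains and closed pseudo-orbits\<close>

text \<open>
  A finite pseudo-orbit.
\<close>

definition chain :: "'a::metric_space set \<Rightarrow> ('a \<Rightarrow> 'a) \<Rightarrow> real \<Rightarrow> 'a list \<Rightarrow> bool" where
  "chain X f \<delta> xs \<longleftrightarrow> set xs \<subseteq> X \<and> successively (\<lambda>a b. dist (f a) b < \<delta>) xs"

text \<open>
  A closed pseudo-orbit through \<open>z\<close>, listed without the final return to \<open>z\<close>, so that loops through the
  same point can be concatenated as lists.
\<close>

definition loop :: "'a::metric_space set \<Rightarrow> ('a \<Rightarrow> 'a) \<Rightarrow> real \<Rightarrow> 'a \<Rightarrow> 'a list \<Rightarrow> bool" where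
  "loop X f \<delta> z w \<longleftrightarrow> w \<noteq> [] \<and> hd w = z \<and> chain X f \<delta> (w @ [z])"

lemma loop_append:
  assumes "loop X f \<delta> z v" "loop X f \<delta> z w"
  shows "loop X f \<delta> z (v @ w)"
  using assms by (auto simp: loop_def chain_def successively_append_iff)

lemma loop_concat:
  "ws \<noteq> [] \<Longrightarrow> (\<And>w. w \<in> set ws \<Longrightarrow> loop X f \<delta> z w) \<Longrightarrow> loop X f \<delta> z (concat ws)"
proof (induction ws rule: list_nonempty_induct)
  case (cons w ws)
  then show ?case by (auto intro: loop_append)
qed auto

lemma loop_nonempty: "loop X f \<delta> z w \<Longrightarrow> 0 < length w"
  by (simp add: loop_def)

lemma loop_in: "loop X f \<delta> z w \<Longrightarrow> i < length w \<Longrightarrow> w ! i \<in> X"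
  by (auto simp: loop_def chain_def)

lemma loop_step:
  assumes "loop X f \<delta> z w" "i < length w"
  shows "dist (f (w ! i)) (w ! (Suc i mod length w)) < \<delta>"
proof -
  have "dist (f ((w @ [z]) ! i)) ((w @ [z]) ! Suc i) < \<delta>"
    using assms by (auto simp: loop_def chain_def successively_conv_nth)
  moreover have "(w @ [z]) ! Suc i = w ! (Suc i mod length w)"
    using assms by (cases "Suc i = length w") (auto simp: nth_append loop_def hd_conv_nth)
  ultimately show ?thesis using assms(2) by (simp add: nth_append)
qed

text \<open>
  The two-sided repetition of a list.
\<close>

definition periodic :: "'a list \<Rightarrow> int \<Rightarrow> 'a" where
  "periodic w i = w ! nat (i mod int (length w))"

lemma pseudo_orbit_periodic:
  assumes "loop X f \<delta> z w"
  shows "pseudo_orbit X f \<delta> (periodic w)"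
  unfolding pseudo_orbit_def
proof (intro allI conjI)
  fix i :: int
  let ?n = "length w"
  note n = loop_nonempty[OF assms]
  have lt: "nat (i mod int ?n) < ?n" using n by (simp add: nat_less_iff)
  show "periodic w i \<in> X" using loop_in[OF assms lt] by (simp add: periodic_def)
  have "(i + 1) mod int ?n = (i mod int ?n + 1) mod int ?n" by (simp add: mod_simps)
  also have "\<dots> = int (Suc (nat (i mod int ?n)) mod ?n)"
    using n by (simp add: zmod_int add.commute)
  finally have "nat ((i + 1) mod int ?n) = Suc (nat (i mod int ?n)) mod ?n" by simp
  then show "dist (f (periodic w i)) (periodic w (i + 1)) < \<delta>"
    using loop_step[OF assms lt] by (simp add: periodic_def)
qed

text \<open>
  Transitivity connects any two points by a chain, and by compactness the length is bounded. The list
  \<open>w\<close> contains the intermediate points only and may be empty.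
\<close>

lemma chain_connecting:
  fixes X :: "'a::metric_space set"
  assumes ds: "dynamical_system X f" and tr: "topologically_transitive X f" and \<delta>: "\<delta> > 0"
  shows "\<exists>M. \<forall>u\<in>X. \<forall>v\<in>X. \<exists>w. length w \<le> M \<and> chain X f \<delta> (u # w @ [v])"
proof -
  have X: "compact X" "continuous_on X f" "f ` X \<subseteq> X"
    using ds by (auto simp: dynamical_system_def)
  obtain D where D: "finite D" "D \<subseteq> X" "X \<subseteq> (\<Union>d\<in>D. ball d (\<delta> / 4))"
    using seq_compact_imp_totally_bounded[OF compact_imp_seq_compact[OF X(1)], rule_format, of "\<delta> / 4"] \<delta>
    by auto
  have "\<exists>n x. x \<in> X \<and> dist d x < \<delta> / 4 \<and> dist d' ((f ^^ n) x) < \<delta> / 4" if "d \<in> D" "d' \<in> D" for d d'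
  proof -
    have ne: "X \<inter> ball d (\<delta> / 4) \<noteq> {}" "X \<inter> ball d' (\<delta> / 4) \<noteq> {}"
      using that D(2) \<delta> by (auto intro!: exI[of _ d] exI[of _ d'])
    have op: "openin (top_of_set X) (X \<inter> ball e (\<delta> / 4))" for e :: 'a
      by (simp add: openin_open_Int)
    have "\<exists>n. (f ^^ n) ` (X \<inter> ball d (\<delta> / 4)) \<inter> (X \<inter> ball d' (\<delta> / 4)) \<noteq> {}"
      using tr ne op unfolding topologically_transitive_def by blast
    then obtain n x where "x \<in> X" "x \<in> ball d (\<delta> / 4)" "(f ^^ n) x \<in> ball d' (\<delta> / 4)"
      by blast
    then show ?thesis unfolding mem_ball by blast
  qed
  then obtain n x where nx: "\<And>d d'. \<lbrakk>d \<in> D; d' \<in> D\<rbrakk> \<Longrightarrow> x d d' \<in> X \<and> dist d (x d d') < \<delta> / 4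
      \<and> dist d' ((f ^^ n d d') (x d d')) < \<delta> / 4"
    by metis
  define M where "M = Max (case_prod n ` (D \<times> D))"
  have "\<exists>w. length w \<le> M \<and> chain X f \<delta> (u # w @ [v])" if uv: "u \<in> X" "v \<in> X" for u v
  proof -
    have "f u \<in> X" using uv X by auto
    then obtain d where "d \<in> D" "f u \<in> ball d (\<delta> / 4)" using D(3) by blast
    moreover obtain d' where "d' \<in> D" "v \<in> ball d' (\<delta> / 4)" using D(3) uv(2) by blast
    ultimately have d: "d \<in> D" "dist d (f u) < \<delta> / 4" "d' \<in> D" "dist d' v < \<delta> / 4" by simp_all
    define y where "y i = (f ^^ i) (x d d')" for i
    let ?n = "n d d'"
    define w where "w = map y [0..<?n]"
    have "?n \<le> M"
      unfolding M_def using D(1) imageI[of "(d, d')" "D \<times> D" "case_prod n"] d by (intro Max_ge) simp_all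
    then have len: "length w \<le> M" by (simp add: w_def)
    have yX: "y i \<in> X" for i using nx[OF d(1,3)] X(3) by (simp add: y_def funpow_closed)
    have y0: "dist (f u) (y 0) < \<delta> / 2"
      using nx[OF d(1,3)] d(2) dist_triangle3[of "f u" "y 0" d] by (simp add: y_def)
    have yn: "dist (y ?n) v < \<delta> / 2"
      using nx[OF d(1,3)] d(4) dist_triangle3[of "y ?n" v d'] by (simp add: y_def)
    have fy: "f (y i) = y (Suc i)" for i by (simp add: y_def)
    have "successively (\<lambda>a b. dist (f a) b < \<delta>) w"
      using \<delta> by (auto simp: successively_conv_nth w_def fy)
    moreover have "dist (f u) v < \<delta>" if "?n = 0"
      using y0 yn that dist_triangle[of "f u" v "y 0"] by simp
    moreover have "dist (f (last w)) v < \<delta>" if "?n > 0"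
    proof -
      have "f (last w) = y ?n" using that by (simp add: w_def last_map fy)
      then show ?thesis using yn \<delta> by simp
    qed
    moreover have "dist (f u) (hd w) < \<delta>" if "?n > 0"
      using that y0 \<delta> by (simp add: w_def hd_map)
    moreover have "w = [] \<longleftrightarrow> ?n = 0" by (simp add: w_def)
    ultimately have "successively (\<lambda>a b. dist (f a) b < \<delta>) (u # w @ [v])"
      by (cases "w = []") (auto simp: successively_append_iff successively_Cons)
    moreover have "set (u # w @ [v]) \<subseteq> X" using uv yX by (auto simp: w_def)
    ultimately show ?thesis using len by (auto simp: chain_def)
  qed
  then show ?thesis by blast
qed

text \<open>
  A long orbit segment with small average is closed up to a loop by two chains of bounded length,
  which hardly change the average.
\<close>

lemma loop_with_small_average:
  fixes X :: "'a::metric_space set" and \<phi> :: "'a \<Rightarrow> real"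
  assumes ds: "dynamical_system X f" and tr: "topologically_transitive X f" and \<delta>: "\<delta> > 0"
    and bd: "\<And>x. x \<in> X \<Longrightarrow> \<bar>\<phi> x\<bar> \<le> C" and z: "z \<in> X" and \<zeta>: "\<zeta> > 0"
    and seg: "\<And>n. \<exists>x\<in>X. (\<Sum>i<n. \<phi> ((f ^^ i) x)) \<le> real n * c"
  shows "\<exists>w. loop X f \<delta> z w \<and> sum_list (map \<phi> w) \<le> (c + \<zeta>) * real (length w)"
proof -
  have fX: "f ` X \<subseteq> X" using ds by (auto simp: dynamical_system_def)
  obtain M where M: "\<And>u v. \<lbrakk>u \<in> X; v \<in> X\<rbrakk> \<Longrightarrow> \<exists>w. length w \<le> M \<and> chain X f \<delta> (u # w @ [v])"
    using chain_connecting[OF ds tr \<delta>] by blast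
  obtain m\<^sub>0 :: nat where m\<^sub>0: "real m\<^sub>0 > (C + \<bar>c\<bar>) * (2 * real M + 1) / \<zeta>"
    using reals_Archimedean2 by blast
  define n where "n = Suc m\<^sub>0"
  have n: "real n > (C + \<bar>c\<bar>) * (2 * real M + 1) / \<zeta>" "n > 0" using m\<^sub>0 by (simp_all add: n_def)
  obtain x where x: "x \<in> X" and sx: "(\<Sum>i<n. \<phi> ((f ^^ i) x)) \<le> real n * c" using seg by blast
  define y where "y i = (f ^^ i) x" for i
  have yX: "y i \<in> X" for i using x fX by (simp add: y_def funpow_closed)
  obtain w1 where w1: "length w1 \<le> M" "chain X f \<delta> (z # w1 @ [y 0])" using M z yX by blast
  obtain w2 where w2: "length w2 \<le> M" "chain X f \<delta> (y (n - 1) # w2 @ [z])" using M z yX by blast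
  define s where "s = map y [0..<n]"
  have s: "s \<noteq> []" "hd s = y 0" "last s = y (n - 1)" "set s \<subseteq> X"
    using n(2) yX by (auto simp: s_def hd_map last_map)
  have ss: "successively (\<lambda>a b. dist (f a) b < \<delta>) s"
    using \<delta> by (auto simp: successively_conv_nth s_def y_def)
  define w where "w = (z # w1) @ s @ w2"
  have "successively (\<lambda>a b. dist (f a) b < \<delta>) ((z # w1) @ s @ w2 @ [z])"
  proof -
    have a: "successively (\<lambda>a b. dist (f a) b < \<delta>) (z # w1) \<and> dist (f (last (z # w1))) (y 0) < \<delta>"
      using w1(2) by (simp add: chain_def successively_append_iff flip: append_Cons)
    have b: "successively (\<lambda>a b. dist (f a) b < \<delta>) (w2 @ [z]) \<and> dist (f (y (n - 1))) (hd (w2 @ [z])) < \<delta>"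
      using w2(2) by (auto simp: chain_def successively_Cons)
    have c: "successively (\<lambda>a b. dist (f a) b < \<delta>) (s @ w2 @ [z])"
      using b ss s by (subst successively_append_iff) auto
    show ?thesis using a c s by (subst successively_append_iff) auto
  qed
  moreover have "set (w @ [z]) \<subseteq> X" using z s w1(2) w2(2) by (auto simp: w_def chain_def)
  ultimately have loop: "loop X f \<delta> z w" by (simp add: loop_def chain_def w_def)
  have sl: "sum_list (map \<phi> u) \<le> C * real (length u)" if "set u \<subseteq> X" for u
    using that bd by (induction u) (auto simp: algebra_simps abs_le_iff intro!: add_mono)
  define m where "m = length (z # w1) + length w2"
  have m: "real m \<le> 2 * real M + 1" using w1 w2 by (simp add: m_def)
  have C0: "C \<ge> 0" using bd[OF z] by linarith
  have sets: "set (z # w1) \<subseteq> X" "set w2 \<subseteq> X" using w1(2) w2(2) by (auto simp: chain_def)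
  have "sum_list (map \<phi> s) = (\<Sum>i<n. \<phi> ((f ^^ i) x))"
    by (simp add: s_def y_def sum_list_sum_nth atLeast0LessThan)
  then have "sum_list (map \<phi> w) \<le> C * real (length (z # w1)) + real n * c + C * real (length w2)"
    using sl[OF sets(1)] sl[OF sets(2)] sx by (simp add: w_def)
  also have "\<dots> = c * real n + C * real m" by (simp add: m_def algebra_simps)
  also have "\<dots> \<le> (c + \<zeta>) * (real n + real m)"
  proof -
    have "(C + \<bar>c\<bar>) * real m \<le> (C + \<bar>c\<bar>) * (2 * real M + 1)"
      using m C0 by (intro mult_left_mono) auto
    also have "\<dots> < real n * \<zeta>" using n(1) \<zeta> by (simp add: field_simps)
    finally have "(C + \<bar>c\<bar>) * real m < real n * \<zeta>" .
    moreover have "- (\<bar>c\<bar> * real m) \<le> c * real m"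
      using mult_right_mono[of "-\<bar>c\<bar>" c "real m"] by simp
    moreover have "0 \<le> \<zeta> * real m" using \<zeta> by simp
    ultimately show ?thesis by (simp add: algebra_simps)
  qed
  finally have "sum_list (map \<phi> w) \<le> (c + \<zeta>) * real (length w)"
    by (simp add: w_def s_def m_def algebra_simps)
  then show ?thesis using loop by blast
qed

lemma sum_list_map_replicate_concat:
  "sum_list (map \<phi> (concat (replicate n w))) = real n * sum_list (map \<phi> w)"
  by (induction n) (auto simp: algebra_simps)

lemma length_concat_replicate: "length (concat (replicate n w)) = n * length w"
  by (induction n) auto

text \<open>
  The \<open>j\<close>-th loop runs through \<open>B\<close> a number of times proportional to \<open>j\<close> and through \<open>A\<close> for the rest of
  its length.
\<close>

lemma loops_with_distinct_averages:
  fixes \<phi> :: "'a::metric_space \<Rightarrow> real"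
  assumes A: "loop X f \<delta> z A" "sum_list (map \<phi> A) \<le> a * real (length A)"
    and B: "loop X f \<delta> z B" "sum_list (map \<phi> B) \<ge> b * real (length B)"
    and ab: "a < b" and k: "k \<ge> 2"
  shows "\<exists>w L. L > 0 \<and> (\<forall>j<k. loop X f \<delta> z (w j) \<and> length (w j) = L) \<and>
     (\<forall>i<k. \<forall>j<k. i \<noteq> j \<longrightarrow>
        \<bar>sum_list (map \<phi> (w i)) - sum_list (map \<phi> (w j))\<bar> / real L \<ge> (b - a) / real k)"
proof -
  define A' where "A' = concat (replicate (length B) A)"
  define B' where "B' = concat (replicate (length A) B)"
  define w where "w j = concat (replicate (k - 1 - j) A' @ replicate j B')" for j
  define l where "l = length A * length B"
  have l: "l > 0" "length A' = l" "length B' = l"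
    using A(1) B(1) by (auto simp: l_def A'_def B'_def length_concat_replicate loop_def)
  have loops: "loop X f \<delta> z A'" "loop X f \<delta> z B'"
    using A(1) B(1) loop_nonempty[OF A(1)] loop_nonempty[OF B(1)]
    by (auto simp: A'_def B'_def intro!: loop_concat)
  have w: "loop X f \<delta> z (w j)" if "j < k" for j
    unfolding w_def using k loops by (intro loop_concat) auto
  have len: "length (w j) = (k - 1) * l" if "j < k" for j
    using that l by (simp add: w_def length_concat_replicate flip: add_mult_distrib)
  let ?a = "sum_list (map \<phi> A')" and ?b = "sum_list (map \<phi> B')"
  have sw: "sum_list (map \<phi> (w j)) = real (k - 1) * ?a + real j * (?b - ?a)" if "j < k" for j
  proof -
    have d: "real (k - 1 - j) = real (k - 1) - real j" using that by (intro of_nat_diff) simp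
    show ?thesis
      unfolding w_def concat_append map_append sum_list_append sum_list_map_replicate_concat d
      by (simp add: algebra_simps)
  qed
  have "?a \<le> real (length B) * (a * real (length A))" "?b \<ge> real (length A) * (b * real (length B))"
    unfolding A'_def B'_def sum_list_map_replicate_concat using A(2) B(2) by (auto intro!: mult_left_mono)
  then have d: "?b - ?a \<ge> (b - a) * real l"
    unfolding l_def of_nat_mult by (simp add: algebra_simps)
  have "\<bar>sum_list (map \<phi> (w i)) - sum_list (map \<phi> (w j))\<bar> / real ((k - 1) * l) \<ge> (b - a) / real k"
    if ij: "i < k" "j < k" "i \<noteq> j" for i j
  proof -
    have "sum_list (map \<phi> (w i)) - sum_list (map \<phi> (w j)) = (real i - real j) * (?b - ?a)"
      unfolding sw[OF ij(1)] sw[OF ij(2)] left_diff_distrib by simp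
    then have "\<bar>sum_list (map \<phi> (w i)) - sum_list (map \<phi> (w j))\<bar> = \<bar>real i - real j\<bar> * \<bar>?b - ?a\<bar>"
      by (simp add: abs_mult)
    also have "\<dots> \<ge> 1 * ((b - a) * real l)"
      using d ij(3) ab by (intro mult_mono) auto
    finally have "\<bar>sum_list (map \<phi> (w i)) - sum_list (map \<phi> (w j))\<bar> / real ((k - 1) * l)
        \<ge> ((b - a) * real l) / real ((k - 1) * l)"
      using k l by (intro divide_right_mono) auto
    moreover have "((b - a) * real l) / real ((k - 1) * l) = (b - a) / real (k - 1)"
      using l by simp
    moreover have "(b - a) / real (k - 1) \<ge> (b - a) / real k"
      using k ab by (intro divide_left_mono) auto
    ultimately show ?thesis by (metis order_trans)
  qed
  then show ?thesis using w len l k by (intro exI[of _ w] exI[of _ "(k - 1) * l"]) auto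
qed

section \<open>Invariant measures and time averages\<close>

lemma space_borel_on: "sets M = sets (restrict_space borel X) \<Longrightarrow> space M = X"
  using sets_eq_imp_space_eq[of M "restrict_space borel X"] by (simp add: space_restrict_space)

lemma continuous_measurable_on:
  fixes g :: "'a::metric_space \<Rightarrow> 'b::topological_space"
  assumes "sets M = sets (restrict_space borel X)" "continuous_on X g"
  shows "g \<in> borel_measurable M"
  using borel_measurable_continuous_on_restrict[OF assms(2)] measurable_cong_sets[OF assms(1) refl] by blast

lemma continuous_bounded_on:
  fixes g :: "'a::metric_space \<Rightarrow> real"
  assumes "compact X" "continuous_on X g"
  obtains C where "C > 0" "\<And>x. x \<in> X \<Longrightarrow> \<bar>g x\<bar> \<le> C"
proof -
  have "bounded (g ` X)" using assms compact_continuous_image compact_imp_bounded by blast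
  then obtain C where "C > 0" "\<forall>y\<in>g ` X. norm y \<le> C" by (auto simp: bounded_pos)
  then show ?thesis by (intro that[of C]) auto
qed

lemma continuous_integrable_on:
  fixes g :: "'a::metric_space \<Rightarrow> real"
  assumes "finite_measure M" "sets M = sets (restrict_space borel X)" "compact X" "continuous_on X g"
  shows "integrable M g"
proof -
  obtain C where "\<And>x. x \<in> X \<Longrightarrow> \<bar>g x\<bar> \<le> C" by (rule continuous_bounded_on[OF assms(3,4)]) blast
  then show ?thesis
    by (intro finite_measure.integrable_const_bound[OF assms(1), of _ C] AE_I2)
       (auto simp: space_borel_on[OF assms(2)] continuous_measurable_on[OF assms(2,4)])
qed

text \<open>
  The indicator of a closed set is the pointwise limit of bounded continuous functions of the distance
  to it, and closed sets generate the Borel sets.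
\<close>

lemma measure_eqI_continuous:
  fixes X :: "'a::metric_space set"
  assumes X: "compact X" and M: "prob_space M" and N: "prob_space N"
    and sM: "sets M = sets (restrict_space borel X)" and sN: "sets N = sets (restrict_space borel X)"
    and eq: "\<And>g :: 'a \<Rightarrow> real. continuous_on X g \<Longrightarrow> integral\<^sup>L M g = integral\<^sup>L N g"
  shows "M = N"
proof -
  interpret M: prob_space M by fact
  interpret N: prob_space N by fact
  note sp = space_borel_on[OF sM] space_borel_on[OF sN]
  let ?g = "\<lambda>F n x. max 0 (1 - real n * infdist x F)"
  have closed_eq: "emeasure M (X \<inter> F) = emeasure N (X \<inter> F)" if F: "closed F" for F :: "'a set"
  proof (cases "F = {}")
    case False
    have lim: "(\<lambda>n. ?g F n x) \<longlonglongrightarrow> indicator F x" for x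
    proof (cases "x \<in> F")
      case True
      then show ?thesis by simp
    next
      case out: False
      then have d: "infdist x F > 0"
        using F False by (metis infdist_nonneg in_closed_iff_infdist_zero order_le_less)
      obtain m :: nat where m: "real m > 1 / infdist x F" using reals_Archimedean2 by blast
      have "?g F n x = 0" if "n \<ge> m" for n
      proof -
        have "1 < real m * infdist x F" using m d by (simp add: field_simps)
        also have "\<dots> \<le> real n * infdist x F" using that d by (intro mult_right_mono) auto
        finally show ?thesis by simp
      qed
      then have "\<forall>\<^sub>F n in sequentially. ?g F n x = 0" by (auto simp: eventually_sequentially)
      then show ?thesis using out by (simp add: tendsto_eventually)
    qed
    have cont: "continuous_on X (?g F n)" for n by (intro continuous_intros)
    have *: "(\<lambda>n. integral\<^sup>L P (?g F n)) \<longlonglongrightarrow> measure P (X \<inter> F)"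
      if P: "prob_space P" "sets P = sets (restrict_space borel X)" for P
    proof -
      interpret P: prob_space P by fact
      have spP: "space P = X" by (rule space_borel_on[OF P(2)])
      have XF: "X \<inter> F \<in> sets P" using F unfolding P(2) sets_restrict_space by auto
      have "(\<lambda>n. integral\<^sup>L P (?g F n)) \<longlonglongrightarrow> integral\<^sup>L P (indicator (X \<inter> F))"
      proof (rule integral_dominated_convergence[where w = "\<lambda>_. 1"])
        show "?g F n \<in> borel_measurable P" for n by (rule continuous_measurable_on[OF P(2) cont])
        show "AE x in P. (\<lambda>n. ?g F n x) \<longlonglongrightarrow> indicator (X \<inter> F) x"
          using lim by (intro AE_I2) (auto simp: spP indicator_def)
        show "AE x in P. norm (?g F n x) \<le> 1" for n by (intro AE_I2) (auto simp: infdist_nonneg)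
      qed (use XF in auto)
      then show ?thesis using XF by simp
    qed
    have "measure M (X \<inter> F) = measure N (X \<inter> F)"
      by (rule LIMSEQ_unique[OF *[OF M sM]]) (use *[OF N sN] eq[OF cont] in simp)
    then show ?thesis by (simp add: M.emeasure_eq_measure N.emeasure_eq_measure)
  qed simp
  have gen: "sets (restrict_space borel X) = sigma_sets X ((\<inter>) X ` Collect closed)"
  proof -
    have "sets (borel :: 'a measure) = sigma_sets UNIV (Collect closed)"
      unfolding borel_eq_closed by (rule sets_measure_of) simp
    moreover have "X \<in> sets borel" using X by (intro borel_closed compact_imp_closed)
    ultimately show ?thesis
      unfolding sets_restrict_space using sigma_sets_Int[of X UNIV "Collect closed"] by simp
  qed
  show ?thesis
  proof (rule measure_eqI_generator_eq[where E = "(\<inter>) X ` Collect closed" and \<Omega> = X and A = "\<lambda>_. X"])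
    show "Int_stable ((\<inter>) X ` Collect closed)"
    proof (rule Int_stableI)
      fix a b assume "a \<in> (\<inter>) X ` Collect closed" "b \<in> (\<inter>) X ` Collect closed"
      then obtain F G where "a = X \<inter> F" "b = X \<inter> G" "closed F" "closed G" by auto
      then have "a \<inter> b = X \<inter> (F \<inter> G)" "closed (F \<inter> G)" by auto
      then show "a \<inter> b \<in> (\<inter>) X ` Collect closed" by blast
    qed
    show "range (\<lambda>_::nat. X) \<subseteq> (\<inter>) X ` Collect closed" using closed_UNIV by blast
  qed (use closed_eq sM sN gen in auto)
qed

lemma invariant_measuresI:
  fixes X :: "'a::metric_space set"
  assumes ds: "dynamical_system X f" and M: "prob_space M" and sM: "sets M = sets (restrict_space borel X)"
    and inv: "\<And>g :: 'a \<Rightarrow> real. continuous_on X g \<Longrightarrow> integral\<^sup>L M (\<lambda>x. g (f x)) = integral\<^sup>L M g"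
  shows "M \<in> invariant_measures X f"
proof -
  interpret M: prob_space M by fact
  have X: "compact X" "continuous_on X f" "f ` X \<subseteq> X" using ds by (auto simp: dynamical_system_def)
  note sp = space_borel_on[OF sM]
  have f: "f \<in> measurable M M"
  proof -
    have "f \<in> measurable M (restrict_space borel X)"
      by (rule measurable_restrict_space2)
         (use X sp continuous_measurable_on[OF sM X(2)] in auto)
    then show ?thesis by (simp add: measurable_cong_sets[OF refl sM])
  qed
  have "distr M M f = M"
  proof (rule measure_eqI_continuous[OF X(1)])
    show "prob_space (distr M M f)" by (rule M.prob_space_distr[OF f])
    fix g :: "'a \<Rightarrow> real" assume g: "continuous_on X g"
    show "integral\<^sup>L (distr M M f) g = integral\<^sup>L M g"
      using inv[OF g] by (simp add: integral_distr[OF f continuous_measurable_on[OF sM g]])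
  qed (use sM M in auto)
  then have "emeasure M (f -` A \<inter> X) = emeasure M A" if "A \<in> sets M" for A
    using emeasure_distr[OF f that] sp by simp
  then show ?thesis using M sM by (auto simp: invariant_measures_def)
qed

lemma invariant_measuresD:
  fixes X :: "'a::metric_space set"
  assumes ds: "dynamical_system X f" and M: "M \<in> invariant_measures X f"
  shows "prob_space M" "sets M = sets (restrict_space borel X)" "space M = X"
    "f \<in> measurable M M" "distr M M f = M"
proof -
  show 1: "prob_space M" "sets M = sets (restrict_space borel X)"
    using M by (auto simp: invariant_measures_def)
  then show sp: "space M = X" by (simp add: space_borel_on)
  have X: "compact X" "continuous_on X f" "f ` X \<subseteq> X" using ds by (auto simp: dynamical_system_def)
  have "f \<in> measurable M (restrict_space borel X)"
    by (rule measurable_restrict_space2) (use X sp continuous_measurable_on[OF 1(2) X(2)] in auto)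
  then show f: "f \<in> measurable M M" by (simp add: measurable_cong_sets[OF refl 1(2)])
  show "distr M M f = M"
    using M by (intro measure_eqI) (auto simp: emeasure_distr[OF f] sp invariant_measures_def)
qed

text \<open>
  The Birkhoff average of length \<open>N\<close>.
\<close>

definition time_average :: "('a \<Rightarrow> 'a) \<Rightarrow> nat \<Rightarrow> ('a \<Rightarrow> real) \<Rightarrow> 'a \<Rightarrow> real" where
  "time_average f N g x = (\<Sum>i<N. g ((f ^^ i) x)) / real N"

lemma continuous_on_time_average:
  fixes f :: "'a::metric_space \<Rightarrow> 'a"
  assumes "dynamical_system X f" "continuous_on X g"
  shows "continuous_on X (time_average f N g)"
proof -
  have X: "continuous_on X f" "f ` X \<subseteq> X" using assms by (auto simp: dynamical_system_def)
  have "continuous_on X (\<lambda>x. g ((f ^^ i) x))" for i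
    using continuous_on_compose2[OF assms(2) continuous_on_funpow[OF X]] funpow_closed[OF X(2)] by blast
  then show ?thesis unfolding time_average_def divide_inverse by (intro continuous_intros)
qed

lemma time_average_bound:
  assumes "\<And>i. i < N \<Longrightarrow> \<bar>g ((f ^^ i) x)\<bar> \<le> C" "C \<ge> 0"
  shows "\<bar>time_average f N g x\<bar> \<le> C"
proof (cases "N = 0")
  case False
  have "\<bar>\<Sum>i<N. g ((f ^^ i) x)\<bar> \<le> (\<Sum>i<N. \<bar>g ((f ^^ i) x)\<bar>)" by (rule sum_abs)
  also have "\<dots> \<le> real N * C" using sum_bounded_above[of "{..<N}" "\<lambda>i. \<bar>g ((f ^^ i) x)\<bar>" C] assms(1) by simp
  finally show ?thesis using False by (simp add: time_average_def divide_simps mult.commute)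
qed (use assms(2) in \<open>simp add: time_average_def\<close>)

lemma integral_time_average:
  fixes X :: "'a::metric_space set" and g :: "'a \<Rightarrow> real"
  assumes ds: "dynamical_system X f" and M: "M \<in> invariant_measures X f"
    and V: "V \<in> sets M" "f -` V \<inter> X = V" and g: "continuous_on X g" and N: "N > 0"
  shows "(\<integral>x. indicator V x * time_average f N g x \<partial>M) = (\<integral>x. indicator V x * g x \<partial>M)"
proof -
  note D = invariant_measuresD[OF ds M]
  interpret prob_space M by (rule D)
  have X: "compact X" "continuous_on X f" "f ` X \<subseteq> X" using ds by (auto simp: dynamical_system_def)
  have cg: "continuous_on X (\<lambda>x. g ((f ^^ i) x))" for i
    using continuous_on_compose2[OF g continuous_on_funpow[OF X(2,3)]] funpow_closed[OF X(3)] by blast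
  have int: "integrable M (\<lambda>x. indicator V x * g ((f ^^ i) x))" for i
    using integrable_real_mult_indicator[OF V(1) continuous_integrable_on[OF finite_measure_axioms D(2) X(1) cg[of i]]]
    by (simp add: mult.commute)
  have eq: "(\<integral>x. indicator V x * g ((f ^^ i) x) \<partial>M) = (\<integral>x. indicator V x * g x \<partial>M)" for i
  proof (induction i)
    case (Suc i)
    have m: "(\<lambda>x. indicator V x * g ((f ^^ i) x)) \<in> borel_measurable M"
      using int by blast
    have "(\<integral>x. indicator V x * g ((f ^^ i) x) \<partial>M)
        = (\<integral>x. indicator V x * g ((f ^^ i) x) \<partial>(distr M M f))" by (simp add: D(5))
    also have "\<dots> = (\<integral>x. indicator V (f x) * g ((f ^^ i) (f x)) \<partial>M)"
      by (rule integral_distr[OF D(4) m])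
    also have "\<dots> = (\<integral>x. indicator V x * g ((f ^^ Suc i) x) \<partial>M)"
    proof (rule Bochner_Integration.integral_cong[OF refl])
      fix x assume "x \<in> space M"
      then have "f x \<in> V \<longleftrightarrow> x \<in> V" using V(2) D(3) by blast
      then show "indicator V (f x) * g ((f ^^ i) (f x)) = indicator V x * g ((f ^^ Suc i) x)"
        by (auto simp: indicator_def funpow_swap1)
    qed
    finally show ?case using Suc by simp
  qed simp
  have "(\<integral>x. indicator V x * time_average f N g x \<partial>M)
      = (\<integral>x. (\<Sum>i<N. indicator V x * g ((f ^^ i) x)) / real N \<partial>M)"
    by (simp only: time_average_def sum_distrib_left times_divide_eq_right)
  also have "\<dots> = (\<Sum>i<N. (\<integral>x. indicator V x * g ((f ^^ i) x) \<partial>M)) / real N"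
    unfolding Bochner_Integration.integral_divide_zero
    by (subst Bochner_Integration.integral_sum) (rule int, rule refl)
  also have "\<dots> = (\<integral>x. indicator V x * g x \<partial>M)" using N by (simp add: eq)
  finally show ?thesis .
qed

lemma integral_time_average_space:
  fixes X :: "'a::metric_space set" and g :: "'a \<Rightarrow> real"
  assumes ds: "dynamical_system X f" and M: "M \<in> invariant_measures X f"
    and g: "continuous_on X g" and N: "N > 0"
  shows "(\<integral>x. time_average f N g x \<partial>M) = (\<integral>x. g x \<partial>M)"
proof -
  note D = invariant_measuresD[OF ds M]
  have X: "f ` X \<subseteq> X" using ds by (auto simp: dynamical_system_def)
  have "(\<integral>x. indicator X x * time_average f N g x \<partial>M) = (\<integral>x. indicator X x * g x \<partial>M)"
    by (rule integral_time_average[OF ds M _ _ g N]) (use X D(3) sets.top[of M] in auto)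
  moreover have "(\<integral>x. indicator X x * h x \<partial>M) = (\<integral>x. h x \<partial>M)" for h :: "'a \<Rightarrow> real"
    by (rule Bochner_Integration.integral_cong[OF refl]) (simp add: D(3))
  ultimately show ?thesis by simp
qed

section \<open>Ergodic measures counted by limits of time averages\<close>

text \<open>
  A criterion for a closed set \<open>\<Lambda>\<close> to carry exactly the ergodic measures \<open>\<mu> j\<close> with \<open>j < k\<close>, in
  terms of time averages along a sequence of lengths \<open>Q n\<close>. By \<open>summable_variation\<close> the averages of \<open>\<phi>\<close>
  converge almost everywhere. By \<open>near\<close> the averages of \<open>\<phi>\<close> and \<open>g\<close> are mostly close to the integrals
  with respect to one and the same \<open>\<mu> j\<close>. By \<open>separated\<close> no \<open>\<mu> j\<close> is a convex combination of the others.
\<close>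

locale ergodic_averages =
  fixes X :: "'a::metric_space set" and f :: "'a \<Rightarrow> 'a" and \<Lambda> :: "'a set"
    and Q :: "nat \<Rightarrow> nat" and k :: nat and \<phi> :: "'a \<Rightarrow> real" and \<mu> :: "nat \<Rightarrow> 'a measure"
  assumes ds: "dynamical_system X f"
    and \<Lambda>: "closed \<Lambda>" "\<Lambda> \<subseteq> X"
    and Q: "\<And>n. Q n > 0" "filterlim Q at_top sequentially"
    and k: "k > 0" and \<phi>: "continuous_on X \<phi>"
    and \<mu>: "\<And>j. j < k \<Longrightarrow> \<mu> j \<in> invariant_measures X f" "\<And>j. j < k \<Longrightarrow> emeasure (\<mu> j) \<Lambda> = 1"
    and distinct: "inj_on (\<lambda>j. integral\<^sup>L (\<mu> j) \<phi>) {..<k}"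
    and summable_variation: "\<And>\<nu>. \<lbrakk>\<nu> \<in> invariant_measures X f; emeasure \<nu> \<Lambda> = 1\<rbrakk> \<Longrightarrow>
        summable (\<lambda>n. \<integral>x. \<bar>time_average f (Q (Suc n)) \<phi> x - time_average f (Q n) \<phi> x\<bar> \<partial>\<nu>)"
    and near: "\<And>\<nu> g. \<lbrakk>\<nu> \<in> invariant_measures X f; emeasure \<nu> \<Lambda> = 1; continuous_on X g\<rbrakk> \<Longrightarrow>
        (\<lambda>n. \<integral>x. infdist (time_average f (Q n) \<phi> x, time_average f (Q n) g x)
               ((\<lambda>j. (integral\<^sup>L (\<mu> j) \<phi>, integral\<^sup>L (\<mu> j) g)) ` {..<k}) \<partial>\<nu>) \<longlonglongrightarrow> 0"
    and separated: "\<And>j. j < k \<Longrightarrow> \<exists>u :: 'a \<Rightarrow> real. continuous_on X u \<and>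
        (\<forall>i<k. i \<noteq> j \<longrightarrow> integral\<^sup>L (\<mu> j) u < integral\<^sup>L (\<mu> i) u)"
begin

abbreviation "avg n \<equiv> time_average f (Q n)"

lemma X: "compact X" "continuous_on X f" "f ` X \<subseteq> X"
  using ds by (auto simp: dynamical_system_def)

lemma avg_cont: "continuous_on X g \<Longrightarrow> continuous_on X (avg n g)"
  by (rule continuous_on_time_average[OF ds])

lemma avg_bounded:
  assumes "\<And>x. x \<in> X \<Longrightarrow> \<bar>g x\<bar> \<le> C" "x \<in> X"
  shows "\<bar>avg n g x\<bar> \<le> C"
  using assms funpow_closed[OF X(3)] by (intro time_average_bound) (auto intro: order_trans[OF abs_ge_zero])

text \<open>
  The points at which the averages of \<open>\<phi>\<close> single out the measure \<open>\<mu> j\<close>.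
\<close>

definition basin :: "nat \<Rightarrow> 'a set" where
  "basin j = {x \<in> X. (\<lambda>n. avg n \<phi> x) \<longlonglongrightarrow> integral\<^sup>L (\<mu> j) \<phi>}"

lemma basin_measurable:
  assumes s: "sets \<nu> = sets (restrict_space borel X)"
  shows "basin j \<in> sets \<nu>"
proof -
  let ?c = "integral\<^sup>L (\<mu> j) \<phi>"
  have [measurable]: "avg n \<phi> \<in> borel_measurable \<nu>" for n
    by (rule continuous_measurable_on[OF s avg_cont[OF \<phi>]])
  have "basin j = {x \<in> space \<nu>. \<forall>m::nat. \<exists>N. \<forall>n\<ge>N. dist (avg n \<phi> x) ?c < 1 / real (Suc m)}"
  proof -
    have "u \<longlonglongrightarrow> ?c \<longleftrightarrow> (\<forall>m::nat. \<exists>N. \<forall>n\<ge>N. dist (u n) ?c < 1 / real (Suc m))" for u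
      unfolding tendsto_iff eventually_sequentially
    proof (intro iffI allI impI)
      fix e :: real
      assume *: "\<forall>m::nat. \<exists>N. \<forall>n\<ge>N. dist (u n) ?c < 1 / real (Suc m)" and "e > 0"
      then obtain m where m: "1 / real (Suc m) < e" using nat_approx_posE by blast
      then show "\<exists>N. \<forall>n\<ge>N. dist (u n) ?c < e" using * by (meson less_trans)
    qed simp
    then show ?thesis by (auto simp: basin_def space_borel_on[OF s])
  qed
  then show ?thesis by simp
qed

lemma basin_invariant: "f -` basin j \<inter> X = basin j"
proof -
  have "(\<lambda>n. avg n \<phi> (f x)) \<longlonglongrightarrow> c \<longleftrightarrow> (\<lambda>n. avg n \<phi> x) \<longlonglongrightarrow> c" if x: "x \<in> X" for x c
  proof -
    obtain C where C: "C > 0" "\<And>x. x \<in> X \<Longrightarrow> \<bar>\<phi> x\<bar> \<le> C" by (rule continuous_bounded_on[OF X(1) \<phi>]) blast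
    have d: "\<bar>avg n \<phi> (f x) - avg n \<phi> x\<bar> \<le> 2 * C * inverse (real (Q n))" for n
    proof -
      have "(\<Sum>i<Q n. \<phi> ((f ^^ i) (f x))) = (\<Sum>i<Q n. \<phi> ((f ^^ Suc i) x))"
        by (simp add: funpow_swap1)
      also have "\<dots> = (\<Sum>i<Q n. \<phi> ((f ^^ i) x)) + \<phi> ((f ^^ Q n) x) - \<phi> x"
        using sum.lessThan_Suc_shift[of "\<lambda>i. \<phi> ((f ^^ i) x)" "Q n"] by simp
      finally have "avg n \<phi> (f x) - avg n \<phi> x = (\<phi> ((f ^^ Q n) x) - \<phi> x) / real (Q n)"
        by (simp add: time_average_def flip: diff_divide_distrib)
      moreover have "\<bar>\<phi> ((f ^^ Q n) x) - \<phi> x\<bar> \<le> 2 * C"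
        using C(2)[OF x] C(2)[OF funpow_closed[OF X(3) x, of "Q n"]] by simp
      ultimately show ?thesis using Q(1)[of n] by (simp add: divide_simps)
    qed
    have "(\<lambda>n. 2 * C * inverse (real (Q n))) \<longlonglongrightarrow> 2 * C * 0"
      using filterlim_compose[OF filterlim_real_sequentially Q(2)]
      by (intro tendsto_mult tendsto_const) (rule tendsto_inverse_0_at_top)
    then have l0: "(\<lambda>n. 2 * C * inverse (real (Q n))) \<longlonglongrightarrow> 0" by simp
    have z: "(\<lambda>n. avg n \<phi> (f x) - avg n \<phi> x) \<longlonglongrightarrow> 0"
      by (rule Lim_null_comparison[OF _ l0]) (use d in simp)
    show ?thesis using Lim_transform[OF _ z] Lim_transform2[OF _ z] by blast
  qed
  moreover have "f x \<in> X" if "x \<in> X" for x using that X by auto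
  ultimately show ?thesis by (auto simp: basin_def)
qed

lemma basin_disjoint: "i < k \<Longrightarrow> j < k \<Longrightarrow> x \<in> basin i \<Longrightarrow> x \<in> basin j \<Longrightarrow> i = j"
  using distinct LIMSEQ_unique by (fastforce simp: basin_def inj_on_def)

context
  fixes \<nu> assumes \<nu>: "\<nu> \<in> invariant_measures X f" "emeasure \<nu> \<Lambda> = 1"
begin

lemmas \<nu>D = invariant_measuresD[OF ds \<nu>(1)]

interpretation \<nu>: prob_space \<nu> by (rule \<nu>D(1))

lemma cont_integrable: "continuous_on X (g :: 'a \<Rightarrow> real) \<Longrightarrow> integrable \<nu> g"
  using continuous_integrable_on \<nu>D(2) X(1) \<nu>.finite_measure_axioms by blast

lemma AE_convergent: "AE x in \<nu>. convergent (\<lambda>n. avg n \<phi> x)"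
proof -
  let ?d = "\<lambda>n x. \<bar>avg (Suc n) \<phi> x - avg n \<phi> x\<bar>"
  have int: "integrable \<nu> (?d n)" for n
    by (intro cont_integrable continuous_intros avg_cont \<phi>)
  have [measurable]: "?d n \<in> borel_measurable \<nu>" for n using int by blast
  have "(\<integral>\<^sup>+x. (\<Sum>n. ennreal (?d n x)) \<partial>\<nu>) = (\<Sum>n. \<integral>\<^sup>+x. ennreal (?d n x) \<partial>\<nu>)"
    by (intro nn_integral_suminf) simp
  also have "\<dots> = (\<Sum>n. ennreal (\<integral>x. ?d n x \<partial>\<nu>))"
    using int by (intro suminf_cong nn_integral_eq_integral) auto
  also have "\<dots> = ennreal (\<Sum>n. \<integral>x. ?d n x \<partial>\<nu>)"
    using summable_variation[OF \<nu>] by (intro suminf_ennreal_eq) (auto simp: summable_sums)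
  finally have "(\<integral>\<^sup>+x. (\<Sum>n. ennreal (?d n x)) \<partial>\<nu>) \<noteq> \<infinity>" by simp
  then have "AE x in \<nu>. (\<Sum>n. ennreal (?d n x)) \<noteq> \<infinity>" by (intro nn_integral_PInf_AE) auto
  then show ?thesis
  proof eventually_elim
    fix x assume "(\<Sum>n. ennreal (?d n x)) \<noteq> \<infinity>"
    then have "summable (\<lambda>n. ?d n x)" by (intro summable_suminf_not_top) auto
    then have "summable (\<lambda>n. avg (Suc n) \<phi> x - avg n \<phi> x)" by (rule summable_rabs_cancel)
    then show "convergent (\<lambda>n. avg n \<phi> x)" by (simp add: summable_iff_convergent sum_lessThan_telescope[of "\<lambda>n. avg n \<phi> x"] convergent_diff_const_right_iff)
  qed
qed

lemma AE_basin:
  fixes g :: "'a \<Rightarrow> real"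
  assumes g: "continuous_on X g"
  shows "\<exists>r. AE x in \<nu>. \<exists>j<k. x \<in> basin j \<and> (\<lambda>n. avg (r n) g x) \<longlonglongrightarrow> integral\<^sup>L (\<mu> j) g"
proof -
  let ?S = "(\<lambda>j. (integral\<^sup>L (\<mu> j) \<phi>, integral\<^sup>L (\<mu> j) g)) ` {..<k}"
  let ?d = "\<lambda>n x. infdist (avg n \<phi> x, avg n g x) ?S"
  have int: "integrable \<nu> (?d n)" for n
    by (intro cont_integrable continuous_intros avg_cont \<phi> g)
  have "(\<lambda>n. \<integral>x. norm (?d n x) \<partial>\<nu>) \<longlonglongrightarrow> 0" using near[OF \<nu> g] by (simp add: infdist_nonneg)
  from tendsto_L1_AE_subseq[of \<nu> ?d, OF int this]
  obtain r where r: "strict_mono r" and AE: "AE x in \<nu>. (\<lambda>n. ?d (r n) x) \<longlonglongrightarrow> 0" by blast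
  have "AE x in \<nu>. x \<in> X" using \<nu>D(3) by auto
  with AE AE_convergent
  have "AE x in \<nu>. \<exists>j<k. x \<in> basin j \<and> (\<lambda>n. avg (r n) g x) \<longlonglongrightarrow> integral\<^sup>L (\<mu> j) g"
  proof eventually_elim
    fix x assume d0: "(\<lambda>n. ?d (r n) x) \<longlonglongrightarrow> 0" and cv: "convergent (\<lambda>n. avg n \<phi> x)" and x: "x \<in> X"
    obtain c where c: "(\<lambda>n. avg n \<phi> x) \<longlonglongrightarrow> c" using cv by (auto simp: convergent_def)
    obtain C where C: "C > 0" "\<And>x. x \<in> X \<Longrightarrow> \<bar>g x\<bar> \<le> C" by (rule continuous_bounded_on[OF X(1) g]) blast
    have cr: "(\<lambda>n. avg (r n) \<phi> x) \<longlonglongrightarrow> c" using LIMSEQ_subseq_LIMSEQ[OF c r] by (simp add: o_def)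
    have "bounded (range (\<lambda>n. avg (r n) g x))"
      using avg_bounded[of g C x, OF C(2) x] by (auto simp: bounded_iff)
    then have sub: "\<exists>l q'. strict_mono q' \<and> (\<lambda>n. avg (r (q (q' n))) g x) \<longlonglongrightarrow> l" for q :: "nat \<Rightarrow> nat"
      using bounded_imp_convergent_subsequence[of "\<lambda>n. avg (r (q n)) g x"]
      by (auto simp: o_def bounded_iff)
    \<comment> \<open>every subsequential limit of the averages of \<open>g\<close> is paired with \<open>c\<close> in the finite set\<close>
    have *: "\<exists>j<k. x \<in> basin j \<and> e = integral\<^sup>L (\<mu> j) g"
      if q: "strict_mono q" and e: "(\<lambda>n. avg (r (q n)) g x) \<longlonglongrightarrow> e" for q e
    proof -
      have "(\<lambda>n. avg (r (q n)) \<phi> x) \<longlonglongrightarrow> c" using LIMSEQ_subseq_LIMSEQ[OF cr q] by (simp add: o_def)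
      then have "(\<lambda>n. ?d (r (q n)) x) \<longlonglongrightarrow> infdist (c, e) ?S" by (intro tendsto_infdist tendsto_Pair e)
      moreover have "(\<lambda>n. ?d (r (q n)) x) \<longlonglongrightarrow> 0" using LIMSEQ_subseq_LIMSEQ[OF d0 q] by (simp add: o_def)
      ultimately have i0: "infdist (c, e) ?S = 0" by (rule LIMSEQ_unique)
      have "(c, e) \<in> ?S" using i0 k by (subst in_closed_iff_infdist_zero) (auto intro!: finite_imp_closed)
      then show ?thesis using c x by (auto simp: basin_def)
    qed
    \<comment> \<open>the index \<open>j\<close> is determined by \<open>x\<close>, so all subsequential limits agree\<close>
    obtain e q where q: "strict_mono q" "(\<lambda>n. avg (r (q n)) g x) \<longlonglongrightarrow> e" using sub[of id] by auto
    from *[OF this] obtain j where j: "j < k" "x \<in> basin j" by blast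
    have "(\<lambda>n. avg (r n) g x) \<longlonglongrightarrow> integral\<^sup>L (\<mu> j) g"
    proof (rule ccontr)
      assume "\<not> ?thesis"
      then obtain \<epsilon> where \<epsilon>: "\<epsilon> > 0"
        "\<not> (\<forall>\<^sub>F n in sequentially. dist (avg (r n) g x) (integral\<^sup>L (\<mu> j) g) < \<epsilon>)"
        by (auto simp: tendsto_iff)
      from not_eventually_sequentiallyD[OF \<epsilon>(2)] obtain s :: "nat \<Rightarrow> nat"
        where s: "strict_mono s" "\<And>n. \<not> dist (avg (r (s n)) g x) (integral\<^sup>L (\<mu> j) g) < \<epsilon>"
        by blast
      obtain l q' where q': "strict_mono q'" and l: "(\<lambda>n. avg (r (s (q' n))) g x) \<longlonglongrightarrow> l"
        using sub[of s] by blast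
      obtain i where i: "i < k" "x \<in> basin i" "l = integral\<^sup>L (\<mu> i) g"
        using *[of "\<lambda>n. s (q' n)" l] strict_mono_o[OF s(1) q'] l by (auto simp: o_def)
      have "dist l (integral\<^sup>L (\<mu> j) g) \<ge> \<epsilon>"
        by (rule tendsto_lowerbound[OF tendsto_dist[OF l tendsto_const]]) (use s(2) in \<open>simp_all add: not_less\<close>)
      then show False using i basin_disjoint[OF i(1) j(1) i(2) j(2)] \<epsilon>(1) by simp
    qed
    with j show "\<exists>j<k. x \<in> basin j \<and> (\<lambda>n. avg (r n) g x) \<longlonglongrightarrow> integral\<^sup>L (\<mu> j) g" by blast
  qed
  then show ?thesis by blast
qed

lemma AE_basin_ex: "AE x in \<nu>. \<exists>j<k. x \<in> basin j"
proof -
  obtain r where "AE x in \<nu>. \<exists>j<k. x \<in> basin j \<and> (\<lambda>n. avg (r n) \<phi> x) \<longlonglongrightarrow> integral\<^sup>L (\<mu> j) \<phi>"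
    using AE_basin[OF \<phi>] by blast
  then show ?thesis by eventually_elim blast
qed

lemma sum_basin:
  assumes "j < k" "x \<in> basin j"
  shows "(\<Sum>i<k. indicator (basin i) x * (c::real)) = c"
proof -
  have "(\<Sum>i<k. indicator (basin i) x * c) = (\<Sum>i<k. if i = j then c else 0)"
  proof (rule sum.cong[OF refl])
    fix i assume "i \<in> {..<k}"
    then have "x \<in> basin i \<longleftrightarrow> i = j" using basin_disjoint[of i j x] assms by auto
    then show "indicator (basin i) x * c = (if i = j then c else 0)" using assms(2) by simp
  qed
  then show ?thesis using assms(1) by simp
qed

lemma sum_measure_basin: "(\<Sum>j<k. measure \<nu> (basin j)) = 1"
proof -
  have "(\<Sum>j<k. measure \<nu> (basin j)) = measure \<nu> (\<Union>j<k. basin j)"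
    using basin_measurable[OF \<nu>D(2)] basin_disjoint
    by (intro measure_finite_Union[symmetric]) (auto simp: disjoint_family_on_def)
  also have "\<dots> = 1"
    using AE_basin_ex basin_measurable[OF \<nu>D(2)] by (intro \<nu>.prob_eq_1[THEN iffD2]) auto
  finally show ?thesis .
qed

text \<open>
  Integrals over an invariant set do not change when a function is replaced by its time averages, and
  on \<open>basin j\<close> these converge to the constant \<open>integral\<^sup>L (\<mu> j) g\<close>.
\<close>

lemma integral_on_basin:
  fixes g :: "'a \<Rightarrow> real"
  assumes g: "continuous_on X g" and j: "j < k"
  shows "(\<integral>x. indicator (basin j) x * g x \<partial>\<nu>) = measure \<nu> (basin j) * integral\<^sup>L (\<mu> j) g"
proof -
  obtain r where r: "AE x in \<nu>. \<exists>j<k. x \<in> basin j \<and> (\<lambda>n. avg (r n) g x) \<longlonglongrightarrow> integral\<^sup>L (\<mu> j) g"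
    using AE_basin[OF g] by blast
  obtain C where C: "C > 0" "\<And>x. x \<in> X \<Longrightarrow> \<bar>g x\<bar> \<le> C" by (rule continuous_bounded_on[OF X(1) g]) blast
  note B = basin_measurable[OF \<nu>D(2), of j]
  have m: "avg n g \<in> borel_measurable \<nu>" for n
    by (rule continuous_measurable_on[OF \<nu>D(2) avg_cont[OF g]])
  have "(\<lambda>n. \<integral>x. indicator (basin j) x * avg (r n) g x \<partial>\<nu>)
      \<longlonglongrightarrow> (\<integral>x. indicator (basin j) x * integral\<^sup>L (\<mu> j) g \<partial>\<nu>)"
  proof (rule integral_dominated_convergence[where w = "\<lambda>_. C"])
    show "AE x in \<nu>. (\<lambda>n. indicator (basin j) x * avg (r n) g x)
        \<longlonglongrightarrow> indicator (basin j) x * integral\<^sup>L (\<mu> j) g"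
      using r
    proof eventually_elim
      fix x assume "\<exists>j<k. x \<in> basin j \<and> (\<lambda>n. avg (r n) g x) \<longlonglongrightarrow> integral\<^sup>L (\<mu> j) g"
      then obtain i where i: "i < k" "x \<in> basin i" "(\<lambda>n. avg (r n) g x) \<longlonglongrightarrow> integral\<^sup>L (\<mu> i) g" by blast
      show "(\<lambda>n. indicator (basin j) x * avg (r n) g x)
        \<longlonglongrightarrow> indicator (basin j) x * integral\<^sup>L (\<mu> j) g"
        using i basin_disjoint[OF i(1) j i(2)] by (cases "x \<in> basin j") auto
    qed
    show "AE x in \<nu>. norm (indicator (basin j) x * avg (r n) g x) \<le> C" for n
      using avg_bounded[OF C(2)] C(1) by (intro AE_I2) (auto simp: \<nu>D(3) indicator_def)
  qed (use B m in auto)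
  moreover have "(\<integral>x. indicator (basin j) x * avg (r n) g x \<partial>\<nu>) = (\<integral>x. indicator (basin j) x * g x \<partial>\<nu>)" for n
    by (rule integral_time_average[OF ds \<nu>(1) B basin_invariant g Q(1)])
  ultimately have "(\<integral>x. indicator (basin j) x * g x \<partial>\<nu>) = (\<integral>x. indicator (basin j) x * integral\<^sup>L (\<mu> j) g \<partial>\<nu>)"
    by (simp add: LIMSEQ_const_iff)
  then show ?thesis using B by simp
qed

lemma integral_decomposition:
  fixes g :: "'a \<Rightarrow> real"
  assumes g: "continuous_on X g"
  shows "integral\<^sup>L \<nu> g = (\<Sum>j<k. measure \<nu> (basin j) * integral\<^sup>L (\<mu> j) g)"
proof -
  note B = basin_measurable[OF \<nu>D(2)]
  have "integral\<^sup>L \<nu> g = (\<integral>x. (\<Sum>j<k. indicator (basin j) x * g x) \<partial>\<nu>)"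
  proof (rule integral_cong_AE)
    show "AE x in \<nu>. g x = (\<Sum>j<k. indicator (basin j) x * g x)"
      using AE_basin_ex
      by eventually_elim (use sum_basin in fastforce)
  qed (use B continuous_measurable_on[OF \<nu>D(2) g] in auto)
  also have "\<dots> = (\<Sum>j<k. \<integral>x. indicator (basin j) x * g x \<partial>\<nu>)"
    using integrable_real_mult_indicator[OF B cont_integrable[OF g]]
    by (intro Bochner_Integration.integral_sum) (simp add: mult.commute)
  also have "\<dots> = (\<Sum>j<k. measure \<nu> (basin j) * integral\<^sup>L (\<mu> j) g)"
    using integral_on_basin[OF g] by simp
  finally show ?thesis .
qed

lemma eq_if_measure_basin_1:
  assumes j: "j < k" and m: "measure \<nu> (basin j) = 1"
  shows "\<nu> = \<mu> j"
proof (rule measure_eqI_continuous[OF X(1)])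
  note D = invariant_measuresD[OF ds \<mu>(1)[OF j]]
  show "prob_space (\<mu> j)" "sets (\<mu> j) = sets (restrict_space borel X)" by (rule D)+
  fix g :: "'a \<Rightarrow> real" assume g: "continuous_on X g"
  have "AE x in \<nu>. x \<in> basin j"
    using m basin_measurable[OF \<nu>D(2)] by (subst (asm) \<nu>.prob_eq_1) auto
  then have "integral\<^sup>L \<nu> g = (\<integral>x. indicator (basin j) x * g x \<partial>\<nu>)"
    using basin_measurable[OF \<nu>D(2), of j] continuous_measurable_on[OF \<nu>D(2) g]
    by (intro integral_cong_AE) auto
  then show "integral\<^sup>L \<nu> g = integral\<^sup>L (\<mu> j) g" using integral_on_basin[OF g j] m by simp
qed (rule \<nu>D)+

end

text \<open>
  The decomposition of \<open>\<mu> j\<close> over the basins is a convex combination of the \<open>\<mu> i\<close>, which must be trivial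
  by \<open>separated\<close>.
\<close>

lemma measure_basin_self:
  assumes j: "j < k"
  shows "measure (\<mu> j) (basin j) = 1"
proof -
  note \<nu> = \<mu>[OF j]
  obtain u :: "'a \<Rightarrow> real" where u: "continuous_on X u" "\<And>i. i < k \<Longrightarrow> i \<noteq> j \<Longrightarrow> integral\<^sup>L (\<mu> j) u < integral\<^sup>L (\<mu> i) u"
    using separated[OF j] by blast
  let ?c = "\<lambda>i. measure (\<mu> j) (basin i)"
  have "integral\<^sup>L (\<mu> j) u = (\<Sum>i<k. ?c i * integral\<^sup>L (\<mu> i) u)" by (rule integral_decomposition[OF \<nu> u(1)])
  then have "(\<Sum>i<k. ?c i * (integral\<^sup>L (\<mu> i) u - integral\<^sup>L (\<mu> j) u)) = 0"
    using sum_measure_basin[OF \<nu>] by (simp add: right_diff_distrib sum_subtractf flip: sum_distrib_right)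
  moreover have nn: "?c i * (integral\<^sup>L (\<mu> i) u - integral\<^sup>L (\<mu> j) u) \<ge> 0" if "i \<in> {..<k}" for i
    using u(2)[of i] that by (cases "i = j") auto
  ultimately have "\<forall>i\<in>{..<k}. ?c i * (integral\<^sup>L (\<mu> i) u - integral\<^sup>L (\<mu> j) u) = 0"
    by (subst (asm) sum_nonneg_eq_0_iff) auto
  then have "?c i = 0" if "i \<in> {..<k} - {j}" for i using that u(2)[of i] by fastforce
  then have "(\<Sum>i<k. ?c i) = ?c j" using j by (simp add: sum.remove[of "{..<k}" j])
  then show ?thesis using sum_measure_basin[OF \<nu>] by simp
qed

lemma ergodic_\<mu>:
  assumes j: "j < k"
  shows "ergodic_measure X f (\<mu> j)"
  unfolding ergodic_measure_def
proof (intro conjI ballI impI)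
  note D = invariant_measuresD[OF ds \<mu>(1)[OF j]]
  interpret P: prob_space "\<mu> j" by (rule D)
  show "\<mu> j \<in> invariant_measures X f" by (rule \<mu>(1)[OF j])
  fix B assume B: "B \<in> sets (\<mu> j)" "f -` B \<inter> X = B"
  show "emeasure (\<mu> j) B = 0 \<or> emeasure (\<mu> j) B = 1"
  proof (cases "emeasure (\<mu> j) B = 0")
    case False
    \<comment> \<open>conditioning on an invariant set keeps the measure invariant and the basin full\<close>
    define \<nu> where "\<nu> = uniform_measure (\<mu> j) B"
    have emu: "emeasure \<nu> A = emeasure (\<mu> j) (B \<inter> A) / emeasure (\<mu> j) B" if "A \<in> sets (\<mu> j)" for A
      unfolding \<nu>_def by (rule emeasure_uniform_measure[OF B(1) that])
    have s: "sets \<nu> = sets (\<mu> j)" by (simp add: \<nu>_def)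
    have p: "prob_space \<nu>" unfolding \<nu>_def using False by (intro prob_space_uniform_measure) auto
    have inv: "\<nu> \<in> invariant_measures X f"
    proof -
      have "emeasure \<nu> (f -` A \<inter> X) = emeasure \<nu> A" if A: "A \<in> sets (\<mu> j)" for A
      proof -
        have fA: "f -` A \<inter> X \<in> sets (\<mu> j)" using measurable_sets[OF D(4) A] D(3) by simp
        have "emeasure (\<mu> j) (B \<inter> (f -` A \<inter> X)) = emeasure (\<mu> j) (f -` (B \<inter> A) \<inter> X)"
          by (rule arg_cong[where f = "emeasure (\<mu> j)"]) (use B(2) in auto)
        also have "\<dots> = emeasure (\<mu> j) (B \<inter> A)"
          using \<mu>(1)[OF j] sets.Int[OF B(1) A] unfolding invariant_measures_def by blast
        finally show ?thesis using emu[OF fA] emu[OF A] by simp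
      qed
      then show ?thesis using p s D(2) by (auto simp: invariant_measures_def)
    qed
    have full: "emeasure \<nu> A = 1" if A: "A \<in> sets (\<mu> j)" "emeasure (\<mu> j) A = 1" for A
    proof -
      have "AE x in \<mu> j. x \<in> A" by (rule P.AE_in_set_eq_1[THEN iffD2, OF A(1)]) (simp add: A(2) measure_def)
      then have "emeasure (\<mu> j) (B \<inter> A) = emeasure (\<mu> j) B"
        using A(1) B(1) by (intro emeasure_eq_AE) auto
      then show ?thesis using emu[OF A(1)] False by (simp add: P.emeasure_eq_measure divide_ennreal)
    qed
    have \<Lambda>s: "\<Lambda> \<in> sets (\<mu> j)" using \<mu>(2)[OF j] emeasure_notin_sets[of \<Lambda> "\<mu> j"] by (metis zero_neq_one)
    have "emeasure \<nu> \<Lambda> = 1" by (rule full[OF \<Lambda>s \<mu>(2)[OF j]])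
    moreover have "measure \<nu> (basin j) = 1"
    proof -
      have "emeasure (\<mu> j) (basin j) = 1" using measure_basin_self[OF j] by (simp add: P.emeasure_eq_measure)
      then show ?thesis using full[OF basin_measurable[OF D(2)], of j] by (simp add: measure_def)
    qed
    ultimately have "\<nu> = \<mu> j" by (rule eq_if_measure_basin_1[OF inv _ j])
    moreover have "emeasure \<nu> B = 1" using emu[OF B(1)] False by (simp add: P.emeasure_eq_measure divide_ennreal)
    ultimately show ?thesis by simp
  qed simp
qed

theorem ergodic_measures_on_eq: "ergodic_measures_on X f \<Lambda> = \<mu> ` {..<k}"
proof (intro equalityI subsetI)
  fix \<nu> assume "\<nu> \<in> ergodic_measures_on X f \<Lambda>"
  then have \<nu>: "\<nu> \<in> invariant_measures X f" "emeasure \<nu> \<Lambda> = 1"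
    and erg: "\<And>A. A \<in> sets \<nu> \<Longrightarrow> f -` A \<inter> X = A \<Longrightarrow> emeasure \<nu> A = 0 \<or> emeasure \<nu> A = 1"
    by (auto simp: ergodic_measures_on_def ergodic_measure_def)
  note D = invariant_measuresD[OF ds \<nu>(1)]
  have "\<exists>j<k. measure \<nu> (basin j) \<noteq> 0"
  proof (rule ccontr)
    assume "\<not> ?thesis"
    then show False using sum_measure_basin[OF \<nu>] by simp
  qed
  then obtain j where j: "j < k" "measure \<nu> (basin j) \<noteq> 0" by blast
  then have "measure \<nu> (basin j) = 1"
    using erg[OF basin_measurable[OF D(2)] basin_invariant, of j] by (auto simp: measure_def)
  then show "\<nu> \<in> \<mu> ` {..<k}" using eq_if_measure_basin_1[OF \<nu> j(1)] j(1) by blast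
next
  fix \<nu> assume "\<nu> \<in> \<mu> ` {..<k}"
  then show "\<nu> \<in> ergodic_measures_on X f \<Lambda>"
    using ergodic_\<mu> \<mu>(2) by (auto simp: ergodic_measures_on_def)
qed

lemma inj_\<mu>: "inj_on \<mu> {..<k}"
proof (rule inj_onI)
  fix i j assume "i \<in> {..<k}" "j \<in> {..<k}" "\<mu> i = \<mu> j"
  then show "i = j" using inj_onD[OF distinct, of i j] by simp
qed

end

section \<open>Limits of nested empirical measures\<close>

lemma Cauchy_if_summable_steps:
  fixes u :: "nat \<Rightarrow> 'a::metric_space" and \<epsilon> :: "nat \<Rightarrow> real"
  assumes \<epsilon>: "summable \<epsilon>" and step: "\<And>n. n \<ge> N \<Longrightarrow> dist (u (Suc n)) (u n) \<le> \<epsilon> n"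
  shows "Cauchy u"
  unfolding Cauchy_altdef
proof (intro allI impI)
  fix e :: real assume "e > 0"
  then obtain M where M: "\<And>m n. m \<ge> M \<Longrightarrow> norm (sum \<epsilon> {m..<n}) < e"
    using \<epsilon> unfolding summable_Cauchy by blast
  have "dist (u m) (u n) < e" if m: "m \<ge> max M N" and n: "n > m" for m n
  proof -
    have "dist (u n) (u m) \<le> sum \<epsilon> {m..<n}"
      using less_imp_le[OF n]
    proof (induction rule: dec_induct)
      case (step i)
      have "dist (u (Suc i)) (u m) \<le> dist (u (Suc i)) (u i) + dist (u i) (u m)" by (rule dist_triangle)
      also have "\<dots> \<le> \<epsilon> i + sum \<epsilon> {m..<i}"
        using assms(2)[of i] step m by (intro add_mono) auto
      finally show ?case using step by simp
    qed simp
    also have "\<dots> < e" using M[of m n] m by simp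
    finally show ?thesis by (simp add: dist_commute)
  qed
  then show "\<exists>M. \<forall>m\<ge>M. \<forall>n>m. dist (u m) (u n) < e" by blast
qed

text \<open>
  Let \<open>E n\<close> be a list of \<open>len n\<close> points. If for most positions \<open>s\<close> the point \<open>E (Suc n) s\<close> is close to
  \<open>E n (s mod len n)\<close>, with summable errors, then the uniform measures on the lists converge weakly. The
  limit is the law of \<open>lim (E n (pos n \<omega>))\<close>, where the positions \<open>pos n \<omega>\<close> have the independent uniform
  digits \<open>\<omega> 0, \<dots>, \<omega> n\<close> in mixed radix.
\<close>

lemma limit_of_nested_averages:
  fixes X :: "'a::metric_space set" and E :: "nat \<Rightarrow> nat \<Rightarrow> 'a" and r len :: "nat \<Rightarrow> nat"
  assumes X: "compact X" and E: "\<And>n s. E n s \<in> X"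
    and len: "len 0 > 0" "\<And>n. len (Suc n) = r n * len n" and r: "\<And>n. r n > 0"
    and \<epsilon>: "summable \<epsilon>" and \<beta>: "summable \<beta>"
    and close: "\<And>n. real (card {s. s < len (Suc n) \<and> dist (E (Suc n) s) (E n (s mod len n)) > \<epsilon> n})
                 \<le> \<beta> n * real (len (Suc n))"
  shows "\<exists>\<mu>. prob_space \<mu> \<and> sets \<mu> = sets (restrict_space borel X) \<and>
    (\<forall>g :: 'a \<Rightarrow> real. continuous_on X g \<longrightarrow>
      (\<lambda>n. (\<Sum>s<len n. g (E n s)) / real (len n)) \<longlonglongrightarrow> integral\<^sup>L \<mu> g)"
proof -
  have len0: "len n > 0" for n by (induction n) (use len r in auto)
  define \<rho> where "\<rho> i = (case i of 0 \<Rightarrow> len 0 | Suc m \<Rightarrow> r m)" for i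
  have \<rho>0: "\<rho> i > 0" for i using len r by (simp add: \<rho>_def split: nat.split)
  define D where "D i = measure_pmf (pmf_of_set {..<\<rho> i})" for i
  interpret D: product_prob_space D UNIV
    unfolding D_def by unfold_locales
  let ?P = "PiM UNIV D"
  have D_sets: "sets (D i) = UNIV" and D_space: "space (D i) = UNIV" for i by (simp_all add: D_def)
  have P_space: "space ?P = UNIV" by (auto simp: space_PiM D_space PiE_def)
  \<comment> \<open>the position inside the block of level \<open>n\<close>, read off from the digits \<open>\<omega> 0, \<dots>, \<omega> n\<close>\<close>
  define pos where "pos n \<omega> = \<omega> 0 + (\<Sum>i<n. len i * \<omega> (Suc i))" for n and \<omega> :: "nat \<Rightarrow> nat"
  have coord: "(\<lambda>\<omega>. \<omega> i) \<in> measurable ?P (count_space UNIV)" for i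
  proof -
    have "(\<lambda>\<omega>. \<omega> i) \<in> measurable ?P (D i)" by (rule measurable_component_singleton) simp
    moreover have "measurable ?P (D i) = measurable ?P (count_space UNIV)"
      by (rule measurable_cong_sets) (simp_all add: D_sets)
    ultimately show ?thesis by simp
  qed
  have pos_meas: "pos n \<in> measurable ?P (count_space UNIV)" for n
  proof (induction n)
    case (Suc n)
    have "(\<lambda>\<omega>. pos n \<omega> + len n * i) \<in> measurable ?P (count_space UNIV)" for i
      by (rule measurable_compose[OF Suc]) simp
    from measurable_compose_countable[OF this coord[of "Suc n"]] show ?case
      by (simp add: pos_def add.assoc)
  qed (simp add: pos_def coord)
  have card_block: "len n = (\<Prod>i\<le>n. \<rho> i)" for n
  proof (induction n)
    case (Suc n)
    then show ?case using len(2)[of n] by (simp add: \<rho>_def)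
  qed (simp add: \<rho>_def)
  define digit where "digit s i = (case i of 0 \<Rightarrow> s mod len 0 | Suc m \<Rightarrow> s div len m mod r m)" for s i
  have digit_lt: "digit s i < \<rho> i" for s i
    using r len(1) by (simp add: digit_def \<rho>_def split: nat.split)
  have pos_digit: "pos n (digit s) = s mod len n" for n s
  proof (induction n)
    case (Suc n)
    have "pos (Suc n) (digit s) = s mod len n + len n * (s div len n mod r n)"
      using Suc by (simp add: pos_def digit_def)
    also have "\<dots> = s mod len (Suc n)"
      unfolding len(2)[of n] by (subst mult.commute[of "r n"]) (simp add: mod_mult2_eq)
    finally show ?case .
  qed (simp add: pos_def digit_def)
  have pos_cong: "pos n \<omega> = pos n \<omega>'" if "\<And>i. i \<le> n \<Longrightarrow> \<omega> i = \<omega>' i" for n \<omega> \<omega>'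
    using that by (auto simp: pos_def intro!: sum.cong)
  \<comment> \<open>the cylinder of the digits of \<open>s\<close> has probability \<open>1 / len n\<close>; equality in the bound follows by summation\<close>
  have ge: "measure ?P (pos n -` {s}) \<ge> 1 / real (len n)" if s: "s < len n" for n s
  proof -
    let ?C = "D.emb UNIV {..n} (Pi\<^sub>E {..n} (\<lambda>i. {digit s i}))"
    have "emeasure ?P ?C = (\<Prod>i\<le>n. emeasure (D i) {digit s i})"
      by (rule D.emeasure_PiM_emb) (auto simp: D_sets)
    also have "\<dots> = (\<Prod>i\<le>n. ennreal (1 / real (\<rho> i)))"
    proof (rule prod.cong[OF refl])
      fix i assume "i \<in> {..n}"
      show "emeasure (D i) {digit s i} = ennreal (1 / real (\<rho> i))"
        using \<rho>0[of i] digit_lt[of s i] unfolding D_def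
        by (subst emeasure_pmf_single, subst pmf_of_set) (auto simp: lessThan_empty_iff)
    qed
    also have "\<dots> = ennreal (1 / real (len n))"
      by (subst prod_ennreal) (simp_all add: card_block prod_dividef)
    finally have C: "measure ?P ?C = 1 / real (len n)" by (simp add: measure_def)
    have "?C \<subseteq> pos n -` {s}"
    proof
      fix \<omega> assume "\<omega> \<in> ?C"
      then have "\<omega> i = digit s i" if "i \<le> n" for i using that by (auto simp: prod_emb_def PiE_iff)
      then have "pos n \<omega> = pos n (digit s)" by (rule pos_cong)
      then show "\<omega> \<in> pos n -` {s}" using s pos_digit by simp
    qed
    moreover have "pos n -` {s} \<in> sets ?P"
      using measurable_sets[OF pos_meas, of "{s}" n] by (simp add: P_space)
    ultimately have "measure ?P ?C \<le> measure ?P (pos n -` {s})" by (rule D.finite_measure_mono)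
    then show ?thesis using C by simp
  qed
  \<comment> \<open>hence the position is uniformly distributed\<close>
  have law: "distr ?P (count_space UNIV) (pos n) = measure_pmf (pmf_of_set {..<len n})" for n
  proof -
    let ?Q = "distr ?P (count_space UNIV) (pos n)" and ?U = "pmf_of_set {..<len n}"
    have ne: "{..<len n} \<noteq> {}" using len0[of n] by (auto simp: lessThan_empty_iff)
    interpret Q: prob_space ?Q by (rule D.prob_space_distr[OF pos_meas])
    have m: "measure ?Q {s} = measure ?P (pos n -` {s})" for s
      by (simp add: measure_distr[OF pos_meas] P_space)
    have total: "(\<Sum>s<len n. measure ?Q {s}) = measure ?Q {..<len n}"
      by (subst Q.finite_measure_eq_sum_singleton) auto
    have eq: "measure ?Q {s} = 1 / real (len n)" if s: "s < len n" for s
    proof (rule ccontr)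
      assume "measure ?Q {s} \<noteq> 1 / real (len n)"
      then have "measure ?Q {s} > 1 / real (len n)" using ge[OF s] m by simp
      then have "(\<Sum>s<len n. 1 / real (len n)) < (\<Sum>s<len n. measure ?Q {s})"
        using s ge m by (intro sum_strict_mono_ex1) auto
      then have "1 < measure ?Q {..<len n}" using total len0[of n] by simp
      then show False using Q.prob_le_1[of "{..<len n}"] by linarith
    qed
    have one: "measure ?Q {..<len n} = 1" using total eq len0[of n] by simp
    have zero: "measure ?Q {s} = 0" if "\<not> s < len n" for s
    proof -
      have "measure ?Q ({..<len n} \<union> {s}) = measure ?Q {..<len n} + measure ?Q {s}"
        using that by (intro Q.finite_measure_Union) auto
      then show ?thesis using one Q.prob_le_1[of "{..<len n} \<union> {s}"] measure_nonneg[of ?Q "{s}"] by linarith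
    qed
    show ?thesis
    proof (rule measure_eqI_countable[where A = UNIV])
      fix s :: nat assume "s \<in> UNIV"
      have "pmf ?U s = measure ?Q {s}"
        using eq[of s] zero[of s] by (subst pmf_of_set[OF ne]) (auto simp: indicator_def)
      then show "emeasure ?Q {s} = emeasure (measure_pmf ?U) {s}"
        by (simp add: emeasure_pmf_single Q.emeasure_eq_measure)
    qed auto
  qed
  have prob_pos: "measure ?P (pos n -` S) = real (card (S \<inter> {..<len n})) / real (len n)" for n S
  proof -
    have "measure ?P (pos n -` S) = measure (measure_pmf (pmf_of_set {..<len n})) S"
      using measure_distr[OF pos_meas, of S n] by (simp add: P_space law)
    then show ?thesis using len0[of n] by (subst (asm) measure_pmf_of_set) (auto simp: Int_commute lessThan_empty_iff)
  qed
  have int_pos: "(\<integral>\<omega>. g (E n (pos n \<omega>)) \<partial>?P) = (\<Sum>s<len n. g (E n s)) / real (len n)" for n and g :: "'a \<Rightarrow> real"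
  proof -
    have "(\<integral>\<omega>. g (E n (pos n \<omega>)) \<partial>?P) = (\<integral>s. g (E n s) \<partial>(distr ?P (count_space UNIV) (pos n)))"
      by (rule integral_distr[OF pos_meas, symmetric]) simp
    then show ?thesis using len0[of n] unfolding law by (subst (asm) integral_pmf_of_set) (auto simp: lessThan_empty_iff)
  qed
  define y where "y n \<omega> = E n (pos n \<omega>)" for n \<omega>
  have y_meas: "y n \<in> borel_measurable ?P" for n
    unfolding y_def by (rule measurable_compose[OF pos_meas]) simp
  have AE_lt: "AE \<omega> in ?P. \<forall>n. pos n \<omega> < len n"
  proof (subst AE_all_countable, rule allI)
    fix n
    have "measure ?P (pos n -` {..<len n}) = 1" using prob_pos[of n "{..<len n}"] len0[of n] by simp
    moreover have "pos n -` {..<len n} \<in> sets ?P"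
      using measurable_sets[OF pos_meas, of "{..<len n}" n] by (simp add: P_space)
    ultimately have "AE \<omega> in ?P. \<omega> \<in> pos n -` {..<len n}" by (subst D.AE_in_set_eq_1) auto
    then show "AE \<omega> in ?P. pos n \<omega> < len n" by simp
  qed
  define B where "B n = pos (Suc n) -` {s. s < len (Suc n) \<and> dist (E (Suc n) s) (E n (s mod len n)) > \<epsilon> n}" for n
  have B_sets: "B n \<in> sets ?P" for n
  proof -
    have "pos (Suc n) -` S \<inter> space ?P \<in> sets ?P" for S by (rule measurable_sets[OF pos_meas]) simp
    then show ?thesis unfolding B_def P_space Int_UNIV_right by blast
  qed
  have B_le: "measure ?P (B n) \<le> \<beta> n" for n
    using close[of n] len0[of "Suc n"] unfolding B_def prob_pos
    by (simp add: divide_simps Collect_conj_eq Int_ac lessThan_def)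
  have "AE \<omega> in ?P. \<forall>\<^sub>F n in sequentially. \<omega> \<in> space ?P - B n"
  proof (rule borel_cantelli_AE1[OF B_sets])
    show "summable (\<lambda>n. measure ?P (B n))"
      by (rule summable_comparison_test'[OF \<beta>, of 0]) (use B_le in auto)
    show "emeasure ?P (B n) < \<infinity>" for n by (simp add: D.emeasure_eq_measure)
  qed
  with AE_lt have "AE \<omega> in ?P. \<exists>l\<in>X. (\<lambda>n. y n \<omega>) \<longlonglongrightarrow> l"
  proof eventually_elim
    fix \<omega> assume lt: "\<forall>n. pos n \<omega> < len n" and ev: "\<forall>\<^sub>F n in sequentially. \<omega> \<in> space ?P - B n"
    have step: "dist (y (Suc n) \<omega>) (y n \<omega>) \<le> \<epsilon> n" if "\<omega> \<notin> B n" for n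
    proof -
      have "pos (Suc n) \<omega> = pos n \<omega> + len n * \<omega> (Suc n)" by (simp add: pos_def)
      then have "pos (Suc n) \<omega> mod len n = pos n \<omega>" using lt by simp
      then show ?thesis using that lt by (auto simp: B_def y_def not_less)
    qed
    from ev obtain N where N: "\<And>n. n \<ge> N \<Longrightarrow> dist (y (Suc n) \<omega>) (y n \<omega>) \<le> \<epsilon> n"
      using step by (auto simp: eventually_sequentially)
    have "Cauchy (\<lambda>n. y n \<omega>)" by (rule Cauchy_if_summable_steps[OF \<epsilon> N])
    then show "\<exists>l\<in>X. (\<lambda>n. y n \<omega>) \<longlonglongrightarrow> l"
      using X E by (metis compact_imp_complete complete_def y_def)
  qed
  then obtain Z where Z: "Z \<in> sets ?P" "emeasure ?P Z = 0"
    "{\<omega> \<in> space ?P. \<not> (\<exists>l\<in>X. (\<lambda>n. y n \<omega>) \<longlonglongrightarrow> l)} \<subseteq> Z"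
    by (rule AE_E) blast
  have conv: "\<exists>l\<in>X. (\<lambda>n. y n \<omega>) \<longlonglongrightarrow> l" if "\<omega> \<notin> Z" for \<omega>
    using that Z(3) P_space by blast
  define Y where "Y \<omega> = (if \<omega> \<in> Z then E 0 0 else lim (\<lambda>n. y n \<omega>))" for \<omega>
  have Y_lim: "(\<lambda>n. y n \<omega>) \<longlonglongrightarrow> Y \<omega> \<and> Y \<omega> \<in> X" if "\<omega> \<notin> Z" for \<omega>
    using conv[OF that] that by (auto simp: Y_def limI)
  have YX: "Y \<omega> \<in> X" for \<omega> using Y_lim[of \<omega>] E by (cases "\<omega> \<in> Z") (auto simp: Y_def)
  have Yb: "Y \<in> borel_measurable ?P"
  proof (rule borel_measurable_LIMSEQ_metric)
    show "(\<lambda>\<omega>. if \<omega> \<in> Z then E 0 0 else y n \<omega>) \<in> borel_measurable ?P" for n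
      using y_meas Z(1) by (intro measurable_If_set) (auto simp: P_space)
    show "(\<lambda>n. if \<omega> \<in> Z then E 0 0 else y n \<omega>) \<longlonglongrightarrow> Y \<omega>" for \<omega>
      using Y_lim[of \<omega>] by (cases "\<omega> \<in> Z") (auto simp: Y_def)
  qed
  have Y: "Y \<in> measurable ?P (restrict_space borel X)"
    by (rule measurable_restrict_space2[OF _ Yb]) (use YX in auto)
  define \<mu> where "\<mu> = distr ?P (restrict_space borel X) Y"
  have "(\<lambda>n. (\<Sum>s<len n. g (E n s)) / real (len n)) \<longlonglongrightarrow> integral\<^sup>L \<mu> g"
    if g: "continuous_on X g" for g :: "'a \<Rightarrow> real"
  proof -
    obtain C where C: "C > 0" "\<And>x. x \<in> X \<Longrightarrow> \<bar>g x\<bar> \<le> C" by (rule continuous_bounded_on[OF X g]) blast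
    have gm: "g \<in> borel_measurable (restrict_space borel X)" by (rule continuous_measurable_on[OF refl g])
    have "(\<lambda>n. \<integral>\<omega>. g (y n \<omega>) \<partial>?P) \<longlonglongrightarrow> (\<integral>\<omega>. g (Y \<omega>) \<partial>?P)"
    proof (rule integral_dominated_convergence[where w = "\<lambda>_. C"])
      show "(\<lambda>\<omega>. g (Y \<omega>)) \<in> borel_measurable ?P" by (rule measurable_compose[OF Y gm])
      show "(\<lambda>\<omega>. g (y n \<omega>)) \<in> borel_measurable ?P" for n
        unfolding y_def by (rule measurable_compose[OF pos_meas]) simp
      have "AE \<omega> in ?P. \<omega> \<notin> Z" using Z by (intro AE_not_in) (auto simp: null_sets_def)
      then show "AE \<omega> in ?P. (\<lambda>n. g (y n \<omega>)) \<longlonglongrightarrow> g (Y \<omega>)"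
      proof eventually_elim
        fix \<omega> assume "\<omega> \<notin> Z"
        from Y_lim[OF this] show "(\<lambda>n. g (y n \<omega>)) \<longlonglongrightarrow> g (Y \<omega>)"
          using E by (intro continuous_on_tendsto_compose[OF g]) (auto simp: y_def)
      qed
      show "AE \<omega> in ?P. norm (g (y n \<omega>)) \<le> C" for n using C(2) E by (simp add: y_def)
    qed simp
    moreover have "integral\<^sup>L \<mu> g = (\<integral>\<omega>. g (Y \<omega>) \<partial>?P)"
      unfolding \<mu>_def by (rule integral_distr[OF Y gm])
    ultimately show ?thesis by (simp add: y_def int_pos)
  qed
  moreover have "prob_space \<mu>" unfolding \<mu>_def by (rule D.prob_space_distr[OF Y])
  moreover have "sets \<mu> = sets (restrict_space borel X)" by (simp add: \<mu>_def)
  ultimately show ?thesis by blast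
qed

section \<open>Hierarchical concatenation of loops\<close>

lemma nth_concat_equal_length:
  assumes "\<And>x. x \<in> set xs \<Longrightarrow> length x = m" "i < length xs" "s < m"
  shows "concat xs ! (i * m + s) = xs ! i ! s"
  using assms
proof (induction xs arbitrary: i)
  case (Cons x xs)
  have x: "length x = m" using Cons.prems(1) by simp
  show ?case
  proof (cases i)
    case 0
    then show ?thesis using x Cons.prems(3) by (simp add: nth_append)
  next
    case (Suc i')
    have "concat xs ! (i' * m + s) = xs ! i' ! s" using Cons Suc by simp
    then show ?thesis using x Suc by (simp add: nth_append)
  qed
qed simp

lemma length_concat_equal_length:
  "(\<And>x. x \<in> set xs \<Longrightarrow> length x = m) \<Longrightarrow> length (concat xs) = length xs * m"
proof (induction xs)
  case (Cons x xs)
  have "length x = m" "length (concat xs) = length xs * m" using Cons.prems Cons.IH by simp_all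
  then show ?case by simp
qed simp

lemma sum_window:
  fixes F :: "nat \<Rightarrow> real"
  shows "(\<Sum>u<l. F (s + u)) = (\<Sum>u\<in>{s..<s + l}. F u)"
  using sum.shift_bounds_nat_ivl[of F 0 s l] by (simp add: atLeast0LessThan add.commute)

lemma sum_split_blocks:
  fixes F :: "nat \<Rightarrow> real"
  shows "(\<Sum>s<m * n. F s) = (\<Sum>i<m. \<Sum>s<n. F (i * n + s))"
  unfolding sum.nat_group[symmetric]
proof (rule sum.cong[OF refl])
  fix i
  show "sum F {i * n..<i * n + n} = (\<Sum>s<n. F (i * n + s))"
    using sum.shift_bounds_nat_ivl[of F 0 "i * n" n] by (simp add: atLeast0LessThan add.commute)
qed

lemma sum_periodic_window:
  fixes F :: "nat \<Rightarrow> real"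
  assumes "\<And>s. F (s + n) = F s"
  shows "(\<Sum>s<n. F (m + s)) = (\<Sum>s<n. F s)"
proof (induction m)
  case (Suc m)
  have "(\<Sum>s<n. F (Suc m + s)) + F m = (\<Sum>s<Suc n. F (m + s))"
    by (subst sum.lessThan_Suc_shift) simp
  also have "\<dots> = (\<Sum>s<n. F (m + s)) + F m" using assms[of m] by simp
  finally show ?case using Suc by simp
qed simp

text \<open>
  The data of the concatenation: a tracing map, \<open>k\<close> loops \<open>w j\<close> of length \<open>L\<close> through \<open>z\<close>, and the number
  \<open>r n\<close> of blocks of level \<open>n\<close> in a block of level \<open>n + 1\<close>.
\<close>

locale block_construction =
  fixes X :: "'a::metric_space set" and f :: "'a \<Rightarrow> 'a" and \<delta> \<epsilon> :: real
    and \<pi> :: "(int \<Rightarrow> 'a) \<Rightarrow> 'a" and z :: 'a and w :: "nat \<Rightarrow> 'a list"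
    and k L :: nat and r :: "nat \<Rightarrow> nat"
  assumes ds: "dynamical_system X f"
    and tracing: "tracing X f \<delta> \<epsilon> \<pi>"
    and k: "k \<ge> 2"
    and loops: "\<And>j. j < k \<Longrightarrow> loop X f \<delta> z (w j) \<and> length (w j) = L"
    and r: "\<And>n. r n \<ge> k + 2"
begin

lemma X: "compact X" "continuous_on X f" "f ` X \<subseteq> X"
  using ds by (auto simp: dynamical_system_def)

text \<open>
  The types of the blocks of level \<open>n\<close> that make up a block of type \<open>j\<close> of level \<open>n + 1\<close>.
\<close>

definition types :: "nat \<Rightarrow> nat \<Rightarrow> nat list" where
  "types n j = [0..<k] @ replicate (r n - k) j"

text \<open>
  The block of type \<open>j\<close> of level \<open>n\<close>. It is again a loop through \<open>z\<close>, as a concatenation of loops.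
\<close>

primrec block :: "nat \<Rightarrow> nat \<Rightarrow> 'a list" where
  "block 0 j = w j"
| "block (Suc n) j = concat (map (block n) (types n j))"

text \<open>
  The length of the blocks of level \<open>n\<close>.
\<close>

definition len :: "nat \<Rightarrow> nat" where
  "len n = L * (\<Prod>i<n. r i)"

lemma len_Suc: "len (Suc n) = r n * len n"
  by (simp add: len_def)

lemma r_pos: "r n > 0"
  using r[of n] by linarith

lemma len_pos: "len n > 0"
proof -
  have "L > 0" using loops[of 0] k loop_nonempty by fastforce
  then show ?thesis using r_pos by (simp add: len_def)
qed

lemma two_len_le: "2 * len n \<le> len (Suc n)"
proof -
  have "2 \<le> r n" using r[of n] by linarith
  then show ?thesis unfolding len_Suc by (rule mult_le_mono1)
qed

lemma len_ge: "n < len n"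
proof (induction n)
  case (Suc n)
  then show ?case using two_len_le[of n] len_pos[of n] by linarith
qed (rule len_pos)

lemma filterlim_len: "filterlim len at_top sequentially"
  by (rule filterlim_at_top_mono[OF filterlim_ident]) (use len_ge in \<open>auto intro!: always_eventually less_imp_le\<close>)

lemma length_types: "length (types n j) = r n"
  using r[of n] by (simp add: types_def)

lemma types_lt: "j < k \<Longrightarrow> i \<in> set (types n j) \<Longrightarrow> i < k"
  by (auto simp: types_def)

lemma types_nth: "i < k \<Longrightarrow> types n j ! i = i" "k \<le> i \<Longrightarrow> i < r n \<Longrightarrow> types n j ! i = j"
  by (auto simp: types_def nth_append)

lemma types_nth_lt: "j < k \<Longrightarrow> i < r n \<Longrightarrow> types n j ! i < k"
  using types_lt length_types nth_mem by metis

lemma block_props: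
  "j < k \<Longrightarrow> loop X f \<delta> z (block n j) \<and> length (block n j) = len n"
proof (induction n arbitrary: j)
  case 0
  then show ?case using loops by (simp add: len_def)
next
  case (Suc n)
  have "types n j \<noteq> []" using length_types[of n j] r_pos[of n] by auto
  then have "loop X f \<delta> z (block (Suc n) j)"
    using Suc types_lt[OF Suc.prems] by (auto intro!: loop_concat)
  moreover have "length (block (Suc n) j) = r n * len n"
    using Suc types_lt[OF Suc.prems]
    by (auto simp: length_types intro!: length_concat_equal_length[where xs = "map (block n) (types n j)", THEN trans])
  ultimately show ?case by (simp add: len_Suc)
qed

lemmas loop_block = block_props[THEN conjunct1]
lemmas length_block = block_props[THEN conjunct2]

lemma block_Suc_nth:
  assumes "j < k" "i < r n" "s < len n"
  shows "block (Suc n) j ! (i * len n + s) = block n (types n j ! i) ! s"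
proof -
  have "concat (map (block n) (types n j)) ! (i * len n + s) = map (block n) (types n j) ! i ! s"
    using assms types_lt[OF assms(1)] length_block
    by (intro nth_concat_equal_length) (auto simp: length_types)
  then show ?thesis using assms by (simp add: length_types)
qed

text \<open>
  The block of type \<open>j\<close> of level \<open>n\<close> occurs in \<open>p\<close> at the place \<open>a\<close>.
\<close>

definition occurs :: "(int \<Rightarrow> 'a) \<Rightarrow> nat \<Rightarrow> nat \<Rightarrow> int \<Rightarrow> bool" where
  "occurs p n j a \<longleftrightarrow> (\<forall>s<len n. p (a + int s) = block n j ! s)"

lemma occurs_sub:
  assumes "occurs p (Suc n) j a" "j < k" "i < r n"
  shows "occurs p n (types n j ! i) (a + int (i * len n))"
  unfolding occurs_def
proof (intro allI impI)
  fix s assume s: "s < len n"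
  have "i * len n + s < Suc i * len n" using s by simp
  also have "\<dots> \<le> len (Suc n)" unfolding len_Suc using assms(3) by (intro mult_le_mono1) simp
  finally have lt: "i * len n + s < len (Suc n)" .
  have "p (a + int (i * len n) + int s) = p (a + int (i * len n + s))" by (simp add: add.assoc)
  also have "\<dots> = block (Suc n) j ! (i * len n + s)"
    using assms(1) lt unfolding occurs_def by blast
  also have "\<dots> = block n (types n j ! i) ! s" by (rule block_Suc_nth[OF assms(2,3) s])
  finally show "p (a + int (i * len n) + int s) = block n (types n j ! i) ! s" .
qed

text \<open>
  The pseudo-orbit that repeats a block periodically.
\<close>

definition per :: "nat \<Rightarrow> nat \<Rightarrow> int \<Rightarrow> 'a" where
  "per n j = periodic (block n j)"

lemma pseudo_per: "j < k \<Longrightarrow> pseudo_orbit X f \<delta> (per n j)"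
  unfolding per_def by (rule pseudo_orbit_periodic[OF loop_block])

lemma per_shift: "j < k \<Longrightarrow> per n j (i + int (m * len n)) = per n j i"
  unfolding per_def periodic_def by (simp add: length_block)

lemma occurs_per: "j < k \<Longrightarrow> occurs (per n j) n j (int (m * len n))"
  unfolding occurs_def
proof (intro allI impI)
  fix s assume j: "j < k" and s: "s < len n"
  have "per n j (int (m * len n) + int s) = per n j (int s)"
    using per_shift[OF j, of n "int s" m] by (simp only: add.commute)
  also have "\<dots> = block n j ! s" using s by (simp add: per_def periodic_def length_block[OF j])
  finally show "per n j (int (m * len n) + int s) = block n j ! s" .
qed

abbreviation pseudo :: "(int \<Rightarrow> 'a) \<Rightarrow> bool" where "pseudo \<equiv> pseudo_orbit X f \<delta>"

text \<open>
  The orbit traced by a pseudo-orbit, at time \<open>t\<close>. Negative times are allowed, and \<open>f\<close> maps each point of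
  it to the next one.
\<close>

definition orb :: "(int \<Rightarrow> 'a) \<Rightarrow> int \<Rightarrow> 'a" where
  "orb p t = \<pi> (\<lambda>i. p (i + t))"

lemma orb_in:
  assumes "pseudo p"
  shows "orb p t \<in> X"
  using tracing pseudo_orbit_shift[OF assms, of t] unfolding tracing_def orb_def by blast

lemma f_orb:
  assumes "pseudo p"
  shows "f (orb p t) = orb p (t + 1)"
proof -
  have "f (orb p t) = \<pi> (\<lambda>i. p (i + 1 + t))"
    using tracing pseudo_orbit_shift[OF assms, of t] unfolding tracing_def orb_def by blast
  then show ?thesis by (simp add: orb_def ac_simps)
qed

lemma funpow_orb: "pseudo p \<Longrightarrow> (f ^^ n) (orb p t) = orb p (t + int n)"
proof (induction n)
  case (Suc n)
  then show ?case using f_orb[of p "t + int n"] by (simp add: algebra_simps)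
qed simp

lemma orb_close: "pseudo p \<Longrightarrow> dist (orb p t) (p t) \<le> \<epsilon>"
proof -
  assume "pseudo p"
  from pseudo_orbit_shift[OF this, of t] tracing have "dist (orb p t) (p (0 + t)) \<le> \<epsilon>"
    unfolding tracing_def orb_def by blast
  then show ?thesis by simp
qed

lemma orb_per_shift: "j < k \<Longrightarrow> orb (per n j) (t + int (m * len n)) = orb (per n j) t"
  unfolding orb_def add.assoc[symmetric] by (simp only: per_shift)

text \<open>
  Time averages over the length of a block of level \<open>n\<close>.
\<close>

definition avg :: "nat \<Rightarrow> ('a \<Rightarrow> real) \<Rightarrow> 'a \<Rightarrow> real" where
  "avg n = time_average f (len n)"

lemma avg_orb: "pseudo p \<Longrightarrow> avg n g (orb p t) = (\<Sum>s<len n. g (orb p (t + int s))) / real (len n)"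
  by (simp add: avg_def time_average_def funpow_orb)

text \<open>
  The average over the periodic orbit traced by the repeated block of type \<open>j\<close> of level \<open>n\<close>.
\<close>

definition ref :: "nat \<Rightarrow> nat \<Rightarrow> ('a \<Rightarrow> real) \<Rightarrow> real" where
  "ref n j g = (\<Sum>s<len n. g (orb (per n j) (int s))) / real (len n)"

text \<open>
  Along any occurrence of a block of level \<open>n\<close>, the values of \<open>g\<close> on the traced orbit differ from those on
  the periodic orbit of the block by at most \<open>e\<close> in the mean.
\<close>

definition approx :: "('a \<Rightarrow> real) \<Rightarrow> nat \<Rightarrow> real \<Rightarrow> bool" where
  "approx g n e \<longleftrightarrow> (\<forall>p j a. pseudo p \<longrightarrow> j < k \<longrightarrow> occurs p n j a \<longrightarrow>
     (\<Sum>s<len n. \<bar>g (orb p (a + int s)) - g (orb (per n j) (int s))\<bar>) \<le> e * real (len n))"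

lemma ref_bounded:
  assumes "\<And>x. x \<in> X \<Longrightarrow> \<bar>g x\<bar> \<le> C" "j < k"
  shows "\<bar>ref n j g\<bar> \<le> C"
proof -
  have "ref n j g = avg n g (orb (per n j) 0)" using pseudo_per[OF assms(2)] by (simp add: avg_orb ref_def)
  moreover have "C \<ge> 0" using assms orb_in[OF pseudo_per[OF assms(2)]] order_trans[OF abs_ge_zero] by blast
  ultimately show ?thesis
    unfolding avg_def using assms funpow_orb orb_in pseudo_per
    by (simp add: time_average_bound)
qed

lemma avg_bounded:
  assumes "\<And>x. x \<in> X \<Longrightarrow> \<bar>g x\<bar> \<le> C" "x \<in> X"
  shows "\<bar>avg n g x\<bar> \<le> C"
  unfolding avg_def
proof (rule time_average_bound)
  show "\<bar>g ((f ^^ i) x)\<bar> \<le> C" for i by (rule assms(1)[OF funpow_closed[OF X(3) assms(2)]])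
  show "C \<ge> 0" using order_trans[OF abs_ge_zero assms(1)[OF assms(2)]] .
qed

lemma avg_ref_le:
  assumes "\<And>x. x \<in> X \<Longrightarrow> \<bar>g x\<bar> \<le> C" "x \<in> X" "j < k"
  shows "\<bar>avg n g x - ref m j g\<bar> \<le> 2 * C"
proof -
  have "\<bar>avg n g x\<bar> \<le> C" by (rule avg_bounded[OF assms(1,2)])
  moreover have "\<bar>ref m j g\<bar> \<le> C" by (rule ref_bounded[OF assms(1,3)])
  ultimately show ?thesis by linarith
qed

text \<open>
  Over a window inside two consecutive blocks of the same type, \<open>g\<close> is nearly summed over a full period
  of the corresponding periodic orbit.
\<close>

lemma avg_on_run:
  assumes ap: "approx g n e" and p: "pseudo p" and j: "j < k"
    and occ: "occurs p n j a" "occurs p n j (a + int (len n))" and s: "s \<le> len n"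
  shows "\<bar>avg n g (orb p (a + int s)) - ref n j g\<bar> \<le> 2 * e"
proof -
  let ?q = "per n j" and ?l = "len n"
  let ?D = "\<lambda>u. g (orb p (a + int u)) - g (orb ?q (int u))"
  have per: "(\<Sum>u<?l. g (orb ?q (int (s + u)))) = (\<Sum>u<?l. g (orb ?q (int u)))"
    using orb_per_shift[OF j, of n _ 1] by (intro sum_periodic_window) (simp add: add.commute)
  have b1: "(\<Sum>u<?l. \<bar>?D u\<bar>) \<le> e * real ?l"
    using ap p j occ(1) unfolding approx_def by blast
  have "(\<Sum>u<?l. \<bar>?D (?l + u)\<bar>)
      = (\<Sum>u<?l. \<bar>g (orb p (a + int ?l + int u)) - g (orb ?q (int u))\<bar>)"
  proof (rule sum.cong[OF refl])
    fix u
    have "int (?l + u) = int u + int (1 * ?l)" by simp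
    then have "orb ?q (int (?l + u)) = orb ?q (int u)" by (simp only: orb_per_shift[OF j])
    then show "\<bar>?D (?l + u)\<bar> = \<bar>g (orb p (a + int ?l + int u)) - g (orb ?q (int u))\<bar>"
      by (simp add: add.assoc)
  qed
  also have "\<dots> \<le> e * real ?l"
    using ap p j occ(2) unfolding approx_def by blast
  finally have b2: "(\<Sum>u<?l. \<bar>?D (?l + u)\<bar>) \<le> e * real ?l" .
  have "(\<Sum>u<?l. \<bar>?D (s + u)\<bar>) = (\<Sum>u\<in>{s..<s + ?l}. \<bar>?D u\<bar>)"
    by (rule sum_window)
  also have "\<dots> \<le> (\<Sum>u<2 * ?l. \<bar>?D u\<bar>)" using s by (intro sum_mono2) auto
  also have "\<dots> = (\<Sum>u<?l. \<bar>?D u\<bar>) + (\<Sum>u<?l. \<bar>?D (?l + u)\<bar>)"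
    by (subst sum_split_blocks) (simp add: numeral_2_eq_2)
  also have "\<dots> \<le> 2 * e * real ?l" using b1 b2 by linarith
  finally have b: "(\<Sum>u<?l. \<bar>?D (s + u)\<bar>) \<le> 2 * e * real ?l" .
  have "avg n g (orb p (a + int s)) - ref n j g
      = (\<Sum>u<?l. ?D (s + u)) / real ?l"
    unfolding avg_orb[OF p] ref_def per[symmetric]
    by (simp add: sum_subtractf diff_divide_distrib add.assoc)
  then have "\<bar>avg n g (orb p (a + int s)) - ref n j g\<bar> = \<bar>\<Sum>u<?l. ?D (s + u)\<bar> / real ?l" by simp
  also have "\<dots> \<le> 2 * e * real ?l / real ?l"
    using sum_abs[of "\<lambda>u. ?D (s + u)" "{..<?l}"] b by (intro divide_right_mono) linarith+
  finally show ?thesis using len_pos[of n] by simp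
qed

text \<open>
  Within a block of type \<open>j\<close> of level \<open>n + 1\<close>, all windows of length \<open>len n\<close> lie in two consecutive blocks of
  type \<open>j\<close>, except for those starting in the prefix or in the last block.
\<close>

lemma local_averages:
  assumes ap: "approx g n e" "e \<ge> 0" and C: "\<And>x. x \<in> X \<Longrightarrow> \<bar>g x\<bar> \<le> C"
    and p: "pseudo p" and j: "j < k" and occ: "occurs p (Suc n) j a"
  shows "(\<Sum>s<len (Suc n). \<bar>avg n g (orb p (a + int s)) - ref n j g\<bar>)
       \<le> (2 * e + 2 * C * real (k + 1) / real (r n)) * real (len (Suc n))"
proof -
  let ?F = "\<lambda>t. \<bar>avg n g (orb p t) - ref n j g\<bar>" and ?l = "len n"
  have C0: "C \<ge> 0" using C[OF orb_in[OF p]] order_trans[OF abs_ge_zero] by blast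
  have F2C: "?F t \<le> 2 * C" for t by (rule avg_ref_le[OF C orb_in[OF p] j])
  define I where "I = insert (r n - 1) {..<k}"
  have I: "finite I" "card I \<le> k + 1" "I \<subseteq> {..<r n}"
    using card_insert_le_m1[of "k + 1" "{..<k}"] r[of n] by (auto simp: I_def card_insert_if)
  have row: "(\<Sum>s<?l. ?F (a + int (i * ?l + s))) \<le> real ?l * (2 * e + (if i \<in> I then 2 * C else 0))"
    if i: "i < r n" for i
  proof -
    have "?F (a + int (i * ?l + s)) \<le> 2 * e + (if i \<in> I then 2 * C else 0)" if s: "s < ?l" for s
    proof (cases "i \<in> I")
      case True
      then show ?thesis using F2C[of "a + int (i * ?l + s)"] ap(2) by simp
    next
      case False
      then have i': "k \<le> i" "Suc i < r n" using i by (auto simp: I_def)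
      have o1: "occurs p n j (a + int (i * ?l))"
        using occurs_sub[OF occ j, of i] i' i types_nth(2)[of i n j] by simp
      have o2: "occurs p n j (a + int (i * ?l) + int ?l)"
        using occurs_sub[OF occ j, of "Suc i"] i' types_nth(2)[of "Suc i" n j] by (simp add: ac_simps)
      show ?thesis
        using avg_on_run[OF ap(1) p j o1 o2, of s] s False by (simp add: add.assoc)
    qed
    then show ?thesis using sum_bounded_above[of "{..<?l}" "\<lambda>s. ?F (a + int (i * ?l + s))"] by simp
  qed
  have "(\<Sum>s<len (Suc n). ?F (a + int s)) = (\<Sum>i<r n. \<Sum>s<?l. ?F (a + int (i * ?l + s)))"
    unfolding len_Suc by (rule sum_split_blocks)
  also have "\<dots> \<le> (\<Sum>i<r n. real ?l * (2 * e + (if i \<in> I then 2 * C else 0)))"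
    by (intro sum_mono row) simp
  also have "\<dots> = real ?l * (real (r n) * (2 * e) + real (card I) * (2 * C))"
    using I by (simp add: sum.distrib distrib_left Int_absorb1 flip: sum_distrib_left sum.inter_restrict)
  also have "\<dots> \<le> real ?l * (real (r n) * (2 * e) + real (k + 1) * (2 * C))"
    using I(2) C0 by (intro mult_left_mono add_left_mono mult_right_mono) auto
  also have "\<dots> = (2 * e + 2 * C * real (k + 1) / real (r n)) * real (len (Suc n))"
    using r_pos[of n] by (simp add: len_Suc field_simps)
  finally show ?thesis .
qed

text \<open>
  Passing from level \<open>n\<close> to level \<open>n + 1\<close> costs the \<open>k\<close> blocks of the prefix.
\<close>

lemma sum_over_block:
  fixes F :: "int \<Rightarrow> real"
  assumes M: "\<And>t. F t \<le> M" "M \<ge> 0" and b: "b \<ge> 0" and j: "j < k" and occ: "occurs p (Suc n) j a"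
    and sub: "\<And>a'. occurs p n j a' \<Longrightarrow> (\<Sum>s<len n. F (a' + int s)) \<le> b * real (len n)"
  shows "(\<Sum>s<len (Suc n). F (a + int s)) \<le> (b + M * real k / real (r n)) * real (len (Suc n))"
proof -
  let ?l = "len n"
  have row: "(\<Sum>s<?l. F (a + int (i * ?l + s))) \<le> real ?l * (b + (if i \<in> {..<k} then M else 0))"
    if i: "i < r n" for i
  proof (cases "i < k")
    case True
    have "(\<Sum>s<?l. F (a + int (i * ?l + s))) \<le> real ?l * M"
      using sum_bounded_above[of "{..<?l}" "\<lambda>s. F (a + int (i * ?l + s))" M] M(1) by simp
    also have "\<dots> \<le> real ?l * (b + M)" using b by (intro mult_left_mono) auto
    finally show ?thesis using True by simp
  next
    case False
    then have "occurs p n j (a + int (i * ?l))"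
      using occurs_sub[OF occ j, of i] i types_nth(2)[of i n j] by simp
    from sub[OF this] show ?thesis using False by (simp add: add.assoc mult.commute)
  qed
  have kr: "{..<r n} \<inter> {..<k} = {..<k}" using r[of n] by auto
  have "(\<Sum>s<len (Suc n). F (a + int s)) = (\<Sum>i<r n. \<Sum>s<?l. F (a + int (i * ?l + s)))"
    unfolding len_Suc by (rule sum_split_blocks)
  also have "\<dots> \<le> (\<Sum>i<r n. real ?l * (b + (if i \<in> {..<k} then M else 0)))"
    by (intro sum_mono row) simp
  also have "\<dots> = real ?l * (\<Sum>i<r n. b + (if i \<in> {..<k} then M else 0))"
    by (rule sum_distrib_left[symmetric])
  also have "(\<Sum>i<r n. b + (if i \<in> {..<k} then M else 0)) = real (r n) * b + real k * M"
    by (subst sum.distrib, subst sum.inter_restrict[symmetric]) (simp_all add: kr)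
  also have "real ?l * (real (r n) * b + real k * M) = (b + M * real k / real (r n)) * real (len (Suc n))"
    using r_pos[of n] by (simp add: len_Suc field_simps)
  finally show ?thesis .
qed

lemma sum_avg_per:
  assumes j: "j < k"
  shows "(\<Sum>s<len n. avg m g (orb (per n j) (int s))) = ref n j g * real (len n)"
proof -
  have p: "pseudo (per n j)" by (rule pseudo_per[OF j])
  have "(\<Sum>s<len n. avg m g (orb (per n j) (int s)))
      = (\<Sum>s<len n. \<Sum>u<len m. g (orb (per n j) (int (u + s)))) / real (len m)"
    by (simp add: avg_orb[OF p] sum_divide_distrib add.commute)
  also have "\<dots> = (\<Sum>u<len m. \<Sum>s<len n. g (orb (per n j) (int (u + s)))) / real (len m)"
    by (subst sum.swap) simp
  also have "\<dots> = (\<Sum>u<len m. \<Sum>s<len n. g (orb (per n j) (int s))) / real (len m)"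
  proof -
    have "(\<Sum>s<len n. g (orb (per n j) (int (u + s)))) = (\<Sum>s<len n. g (orb (per n j) (int s)))" for u
      using orb_per_shift[OF j, of n _ 1] by (intro sum_periodic_window) (simp add: add.commute)
    then show ?thesis by simp
  qed
  also have "\<dots> = ref n j g * real (len n)" using len_pos[of m] len_pos[of n] by (simp add: ref_def)
  finally show ?thesis .
qed

lemma ref_Suc_close:
  assumes ap: "approx g n e" "e \<ge> 0" and C: "\<And>x. x \<in> X \<Longrightarrow> \<bar>g x\<bar> \<le> C" and j: "j < k"
  shows "\<bar>ref (Suc n) j g - ref n j g\<bar> \<le> 2 * e + 2 * C * real (k + 1) / real (r n)"
proof -
  let ?l = "len (Suc n)" and ?p = "per (Suc n) j"
  have p: "pseudo ?p" by (rule pseudo_per[OF j])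
  have "(ref (Suc n) j g - ref n j g) * real ?l = (\<Sum>s<?l. avg n g (orb ?p (0 + int s)) - ref n j g)"
    by (simp add: sum_subtractf sum_avg_per[OF j] algebra_simps)
  moreover have "\<bar>(ref (Suc n) j g - ref n j g) * real ?l\<bar> = \<bar>ref (Suc n) j g - ref n j g\<bar> * real ?l"
    by (simp add: abs_mult)
  ultimately have "\<bar>ref (Suc n) j g - ref n j g\<bar> * real ?l
      = \<bar>\<Sum>s<?l. avg n g (orb ?p (0 + int s)) - ref n j g\<bar>" by simp
  also have "\<dots> \<le> (\<Sum>s<?l. \<bar>avg n g (orb ?p (0 + int s)) - ref n j g\<bar>)" by (rule sum_abs)
  also have "\<dots> \<le> (2 * e + 2 * C * real (k + 1) / real (r n)) * real ?l"
    using local_averages[OF ap C p j, of 0] occurs_per[OF j, of "Suc n" 0] by simp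
  finally show ?thesis using len_pos[of "Suc n"] by (simp add: mult_le_cancel_right)
qed

end

section \<open>The measures generated by the blocks\<close>

context block_construction
begin

lemma occurs_agree:
  assumes occ: "occurs p n j a" "occurs p' n j a'" and s: "R \<le> s" "s + R < len n" and i: "\<bar>i\<bar> \<le> int R"
  shows "p (i + (a + int s)) = p' (i + (a' + int s))"
proof -
  define u where "u = nat (int s + i)"
  have u: "u < len n" "int u = int s + i" using s i by (auto simp: u_def)
  have "p (a + int u) = p' (a' + int u)" using occ u(1) by (simp add: occurs_def)
  then show ?thesis unfolding u(2) by (simp only: ac_simps)
qed

text \<open>
  Away from the ends of an occurrence, the traced points agree on the window \<open>R\<close> with those of the
  periodic orbit.
\<close>

lemma approx_of_window:
  assumes C: "\<And>x. x \<in> X \<Longrightarrow> \<bar>g x\<bar> \<le> C" and e: "e \<ge> 0"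
    and win: "\<And>p p'. \<lbrakk>pseudo p; pseudo p'; \<And>i. \<bar>i\<bar> \<le> int R \<Longrightarrow> p i = p' i\<rbrakk> \<Longrightarrow> \<bar>g (\<pi> p) - g (\<pi> p')\<bar> \<le> e"
  shows "approx g n (e + 4 * C * real R / real (len n))"
  unfolding approx_def
proof (intro allI impI)
  fix p j a assume p: "pseudo p" and j: "j < k" and occ: "occurs p n j a"
  let ?q = "per n j" and ?l = "len n"
  have q: "pseudo ?q" by (rule pseudo_per[OF j])
  have occ': "occurs ?q n j 0" using occurs_per[OF j, of n 0] by simp
  have C0: "C \<ge> 0" using order_trans[OF abs_ge_zero C[OF orb_in[OF p]]] .
  define I where "I = {..<R} \<union> {?l - R..<?l}"
  have I: "finite I" "card I \<le> 2 * R"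
    using card_Un_le[of "{..<R}" "{?l - R..<?l}"] by (auto simp: I_def)
  have tm: "\<bar>g (orb p (a + int s)) - g (orb ?q (int s))\<bar> \<le> e + (if s \<in> I then 2 * C else 0)"
    if s: "s \<in> {..<?l}" for s
  proof (cases "s \<in> I")
    case True
    have "\<bar>g (orb p (a + int s))\<bar> \<le> C" "\<bar>g (orb ?q (int s))\<bar> \<le> C"
      using C[OF orb_in[OF p]] C[OF orb_in[OF q]] by blast+
    then show ?thesis using True e by auto
  next
    case False
    then have s': "R \<le> s" "s + R < ?l" using s by (auto simp: I_def)
    have "\<bar>g (\<pi> (\<lambda>i. p (i + (a + int s)))) - g (\<pi> (\<lambda>i. ?q (i + (0 + int s))))\<bar> \<le> e"
      by (intro win pseudo_orbit_shift p q occurs_agree[OF occ occ' s'])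
    then show ?thesis using False by (simp add: orb_def)
  qed
  have "(\<Sum>s<?l. \<bar>g (orb p (a + int s)) - g (orb ?q (int s))\<bar>)
      \<le> (\<Sum>s<?l. e + (if s \<in> I then 2 * C else 0))" by (rule sum_mono[OF tm])
  also have "\<dots> = real ?l * e + real (card ({..<?l} \<inter> I)) * (2 * C)"
    by (subst sum.distrib, subst sum.inter_restrict[symmetric]) simp_all
  also have "\<dots> \<le> real ?l * e + real (2 * R) * (2 * C)"
    using I C0 card_mono[of I "{..<?l} \<inter> I"] by (intro add_left_mono mult_right_mono) auto
  also have "\<dots> = (e + 4 * C * real R / real ?l) * real ?l"
    using len_pos[of n] by (simp add: field_simps)
  finally show "(\<Sum>s<?l. \<bar>g (orb p (a + int s)) - g (orb ?q (int s))\<bar>)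
      \<le> (e + 4 * C * real R / real ?l) * real ?l" .
qed

lemma approx_mono: "approx g n e \<Longrightarrow> e \<le> e' \<Longrightarrow> approx g n e'"
  unfolding approx_def by (meson mult_right_mono of_nat_0_le_iff order_trans)

lemma eventually_approx:
  assumes g: "continuous_on X g" and e: "e > 0"
  shows "\<forall>\<^sub>F n in sequentially. approx g n e"
proof -
  obtain C where C: "C > 0" "\<And>x. x \<in> X \<Longrightarrow> \<bar>g x\<bar> \<le> C" by (rule continuous_bounded_on[OF X(1) g]) blast
  have "uniformly_continuous_on X g" by (rule compact_uniformly_continuous[OF g X(1)])
  then obtain d where d: "d > 0" "\<And>x y. \<lbrakk>x \<in> X; y \<in> X; dist y x < d\<rbrakk> \<Longrightarrow> dist (g y) (g x) < e / 2"
    using e unfolding uniformly_continuous_on_def by (metis half_gt_zero)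
  obtain R :: nat where R: "\<And>p p'. \<lbrakk>pseudo p; pseudo p'; \<And>i. \<bar>i\<bar> \<le> int R \<Longrightarrow> p i = p' i\<rbrakk> \<Longrightarrow> dist (\<pi> p) (\<pi> p') < d"
    using tracing d(1) unfolding tracing_def by metis
  have win: "\<bar>g (\<pi> p) - g (\<pi> p')\<bar> \<le> e / 2"
    if "pseudo p" "pseudo p'" "\<And>i. \<bar>i\<bar> \<le> int R \<Longrightarrow> p i = p' i" for p p'
  proof -
    have "\<pi> p \<in> X" "\<pi> p' \<in> X" using that tracing unfolding tracing_def by blast+
    then have "dist (g (\<pi> p)) (g (\<pi> p')) < e / 2" using d(2) R[OF that] by blast
    then show ?thesis by (simp add: dist_real_def)
  qed
  have ap: "approx g n (e / 2 + 4 * C * real R / real (len n))" for n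
  proof (rule approx_of_window)
    show "\<bar>g x\<bar> \<le> C" if "x \<in> X" for x using C(2)[OF that] .
    show "\<bar>g (\<pi> p) - g (\<pi> p')\<bar> \<le> e / 2"
      if "pseudo p" "pseudo p'" "\<And>i. \<bar>i\<bar> \<le> int R \<Longrightarrow> p i = p' i" for p p'
      by (rule win[OF that])
  qed (use e in simp)
  obtain N :: nat where N: "real N > 8 * C * real R / e" using reals_Archimedean2 by blast
  have "approx g n e" if n: "n \<ge> N" for n
  proof (rule approx_mono[OF ap])
    have "real N < real (len n)" using n len_ge[of n] by linarith
    then have "8 * C * real R / e < real (len n)" using N by linarith
    then have "4 * C * real R / real (len n) \<le> e / 2" using e len_pos[of n] by (simp add: field_simps)
    then show "e / 2 + 4 * C * real R / real (len n) \<le> e" by simp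
  qed
  then show ?thesis by (auto simp: eventually_sequentially)
qed

lemma ref_f:
  assumes j: "j < k"
  shows "ref n j (\<lambda>x. g (f x)) = ref n j g"
proof -
  have p: "pseudo (per n j)" by (rule pseudo_per[OF j])
  have "(\<Sum>s<len n. g (orb (per n j) (int (1 + s)))) = (\<Sum>s<len n. g (orb (per n j) (int s)))"
    using orb_per_shift[OF j, of n _ 1] by (intro sum_periodic_window) (simp add: add.commute)
  then show ?thesis by (simp add: ref_def f_orb[OF p] add.commute)
qed

end

text \<open>
  The window \<open>R n\<close> determines traced points, and the values of \<open>\<phi>\<close> at them, up to \<open>(1 / 2) ^ n\<close>. The
  repetition numbers are so large that the ends of the blocks, of size \<open>R n\<close>, and the prefixes have
  summable relative lengths.
\<close>

locale block_measures = block_construction X f \<delta> \<epsilon> \<pi> z w k L r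
  for X :: "'a::metric_space set" and f \<delta> \<epsilon> \<pi> z w k L r +
  fixes \<phi> :: "'a \<Rightarrow> real" and R :: "nat \<Rightarrow> nat" and \<kappa> :: real
  assumes \<phi>: "continuous_on X \<phi>"
    and window: "\<And>n p p'. \<lbrakk>pseudo_orbit X f \<delta> p; pseudo_orbit X f \<delta> p'; \<And>i. \<bar>i\<bar> \<le> int (R n) \<Longrightarrow> p i = p' i\<rbrakk> \<Longrightarrow>
        dist (\<pi> p) (\<pi> p') < (1 / 2) ^ n \<and> \<bar>\<phi> (\<pi> p) - \<phi> (\<pi> p')\<bar> < (1 / 2) ^ n"
    and r_window: "\<And>n. real (R (Suc n)) \<le> (1 / 2) ^ n * real (r n)"
    and r_growth: "\<And>n. real (k + 1) \<le> \<kappa> * (1 / 2) ^ Suc n * real (r n)"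
begin

lemma \<kappa>: "\<kappa> > 0"
proof (rule ccontr)
  assume "\<not> \<kappa> > 0"
  then have "\<kappa> * (1 / 2) ^ Suc 0 * real (r 0) \<le> 0" by (simp add: mult_nonpos_nonneg)
  then show False using r_growth[of 0] by simp
qed

lemma k_over_r: "real (k + 1) / real (r n) \<le> \<kappa> * (1 / 2) ^ Suc n" "real k / real (r n) \<le> \<kappa> * (1 / 2) ^ Suc n"
proof -
  show 1: "real (k + 1) / real (r n) \<le> \<kappa> * (1 / 2) ^ Suc n"
    using r_growth[of n] r_pos[of n] by (simp add: pos_divide_le_eq)
  have "real k / real (r n) \<le> real (k + 1) / real (r n)" by (intro divide_right_mono) auto
  then show "real k / real (r n) \<le> \<kappa> * (1 / 2) ^ Suc n" using 1 by linarith
qed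

lemma summable_half: "summable (\<lambda>n. c * (1 / 2) ^ n :: real)" "summable (\<lambda>n. c * (1 / 2) ^ Suc n :: real)"
  by (intro summable_mult summable_geometric, simp)
     (subst summable_Suc_iff[of "\<lambda>n. c * (1 / 2) ^ n"], intro summable_mult summable_geometric, simp)

lemma summable_inverse_r: "summable (\<lambda>n. real (k + 1) / real (r n))" "summable (\<lambda>n. real k / real (r n))"
  by (rule summable_comparison_test'[OF summable_half(2)[of \<kappa>], of 0], use k_over_r in simp)+

lemma summable_R: "summable (\<lambda>n. real (R n) / real (len n))"
proof -
  have "real (R (Suc n)) / real (len (Suc n)) \<le> 1 * (1 / 2) ^ n" for n
  proof -
    have "r n * 1 \<le> r n * len n" using len_pos[of n] by (intro mult_le_mono2) simp
    then have "real (r n) \<le> real (len (Suc n))" unfolding len_Suc by linarith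
    then have "(1 / 2) ^ n * real (r n) \<le> (1 / 2) ^ n * real (len (Suc n))" by (intro mult_left_mono) auto
    then have "real (R (Suc n)) \<le> (1 / 2) ^ n * real (len (Suc n))" using r_window[of n] by linarith
    then show ?thesis using len_pos[of "Suc n"] by (simp add: pos_divide_le_eq)
  qed
  then have "summable (\<lambda>n. real (R (Suc n)) / real (len (Suc n)))"
    by (intro summable_comparison_test'[OF summable_half(1)[of 1], of 0]) simp
  then show ?thesis by (subst (asm) summable_Suc_iff)
qed

lemma nested_close:
  assumes j: "j < k"
  shows "real (card {s. s < len (Suc n) \<and>
           dist (orb (per (Suc n) j) (int s)) (orb (per n j) (int (s mod len n))) > (1 / 2) ^ n})
       \<le> (real k / real (r n) + 2 * (real (R n) / real (len n))) * real (len (Suc n))"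
proof -
  let ?l = "len n" and ?p = "per (Suc n) j" and ?q = "per n j"
  define I where "I = {..<R n} \<union> {?l - R n..<?l}"
  have I: "finite I" "card I \<le> 2 * R n"
    using card_Un_le[of "{..<R n}" "{?l - R n..<?l}"] by (auto simp: I_def)
  define B where "B = {..<k * ?l} \<union> (\<lambda>(i, u). i * ?l + u) ` ({..<r n} \<times> I)"
  have "{s. s < len (Suc n) \<and> dist (orb ?p (int s)) (orb ?q (int (s mod ?l))) > (1 / 2) ^ n} \<subseteq> B"
  proof (rule subsetI, rule ccontr)
    fix s assume s: "s \<in> {s. s < len (Suc n) \<and> dist (orb ?p (int s)) (orb ?q (int (s mod ?l))) > (1 / 2) ^ n}"
      and nB: "s \<notin> B"
    define i u where "i = s div ?l" and "u = s mod ?l"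
    have su: "s = i * ?l + u" "u < ?l" using len_pos[of n] by (simp_all add: i_def u_def)
    have ir: "i < r n" using s by (simp add: i_def len_Suc less_mult_imp_div_less)
    have "i \<ge> k"
    proof (rule ccontr)
      assume "\<not> i \<ge> k"
      then have "s < Suc i * ?l" "Suc i * ?l \<le> k * ?l" using su mult_le_mono1[of "Suc i" k ?l] by simp_all
      then show False using nB by (simp add: B_def)
    qed
    then have occ: "occurs ?p n j (int (i * ?l))"
      using occurs_sub[OF _ j ir, of ?p 0] occurs_per[OF j, of "Suc n" 0] ir types_nth(2) by simp
    have "u \<notin> I"
    proof
      assume "u \<in> I"
      then have "(\<lambda>(i, u). i * ?l + u) (i, u) \<in> B" unfolding B_def using ir by blast
      then show False using nB su(1) by simp
    qed
    then have u: "R n \<le> u" "u + R n < ?l" using su(2) by (auto simp: I_def)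
    have occ': "occurs ?q n j 0" using occurs_per[OF j, of n 0] by simp
    have "dist (\<pi> (\<lambda>t. ?p (t + (int (i * ?l) + int u)))) (\<pi> (\<lambda>t. ?q (t + (0 + int u)))) < (1 / 2) ^ n"
      by (rule window[THEN conjunct1])
         (intro pseudo_orbit_shift pseudo_per j occurs_agree[OF occ occ' u] | assumption)+
    then have "dist (orb ?p (int s)) (orb ?q (int u)) < (1 / 2) ^ n" by (simp add: orb_def su(1))
    then show False using s by (simp add: u_def)
  qed
  then have "card {s. s < len (Suc n) \<and> dist (orb ?p (int s)) (orb ?q (int (s mod ?l))) > (1 / 2) ^ n} \<le> card B"
    using I(1) by (intro card_mono) (auto simp: B_def)
  also have "\<dots> \<le> k * ?l + r n * (2 * R n)"
  proof -
    have "card ((\<lambda>(i, u). i * ?l + u) ` ({..<r n} \<times> I)) \<le> card ({..<r n} \<times> I)"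
      using I(1) by (intro card_image_le) simp
    also have "\<dots> \<le> r n * (2 * R n)" using I(2) by (simp add: card_cartesian_product)
    finally have "card ((\<lambda>(i, u). i * ?l + u) ` ({..<r n} \<times> I)) \<le> r n * (2 * R n)" .
    moreover have "card B \<le> card {..<k * ?l} + card ((\<lambda>(i, u). i * ?l + u) ` ({..<r n} \<times> I))"
      unfolding B_def by (rule card_Un_le)
    ultimately show ?thesis by simp
  qed
  finally have "real (card {s. s < len (Suc n) \<and> dist (orb ?p (int s)) (orb ?q (int (s mod ?l))) > (1 / 2) ^ n})
      \<le> real (k * ?l + r n * (2 * R n))" by (rule of_nat_mono)
  also have "\<dots> = (real k / real (r n) + 2 * (real (R n) / real ?l)) * real (len (Suc n))"
    using r_pos[of n] len_pos[of n] by (simp add: len_Suc field_simps)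
  finally show ?thesis .
qed

lemma block_measure_exists:
  assumes j: "j < k"
  shows "\<exists>\<mu>. prob_space \<mu> \<and> sets \<mu> = sets (restrict_space borel X) \<and>
    (\<forall>g :: 'a \<Rightarrow> real. continuous_on X g \<longrightarrow> (\<lambda>n. ref n j g) \<longlonglongrightarrow> integral\<^sup>L \<mu> g)"
  unfolding ref_def
proof (rule limit_of_nested_averages[OF X(1), where r = r])
  show "orb (per n j) (int s) \<in> X" for n s by (rule orb_in[OF pseudo_per[OF j]])
  show "summable (\<lambda>n. (1 / 2) ^ n :: real)" using summable_half(1)[of 1] by simp
  show "summable (\<lambda>n. real k / real (r n) + 2 * (real (R n) / real (len n)))"
    by (intro summable_add summable_inverse_r summable_mult summable_R)
qed (rule len_pos len_Suc r_pos nested_close[OF j])+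

text \<open>
  The limit of the uniform measures on the periodic orbits traced by the repeated blocks of type \<open>j\<close>.
\<close>

definition \<mu> :: "nat \<Rightarrow> 'a measure" where
  "\<mu> j = (SOME \<mu>. prob_space \<mu> \<and> sets \<mu> = sets (restrict_space borel X) \<and>
    (\<forall>g :: 'a \<Rightarrow> real. continuous_on X g \<longrightarrow> (\<lambda>n. ref n j g) \<longlonglongrightarrow> integral\<^sup>L \<mu> g))"

lemma \<mu>:
  assumes "j < k"
  shows "prob_space (\<mu> j)" "sets (\<mu> j) = sets (restrict_space borel X)"
    "\<And>g :: 'a \<Rightarrow> real. continuous_on X g \<Longrightarrow> (\<lambda>n. ref n j g) \<longlonglongrightarrow> integral\<^sup>L (\<mu> j) g"
  using someI_ex[OF block_measure_exists[OF assms]] unfolding \<mu>_def[symmetric] by blast+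

lemma \<mu>_invariant:
  assumes j: "j < k"
  shows "\<mu> j \<in> invariant_measures X f"
proof (rule invariant_measuresI[OF ds \<mu>(1,2)[OF j]])
  fix g :: "'a \<Rightarrow> real" assume g: "continuous_on X g"
  have "continuous_on X (\<lambda>x. g (f x))" using continuous_on_compose2[OF g X(2,3)] .
  from \<mu>(3)[OF j this] have "(\<lambda>n. ref n j g) \<longlonglongrightarrow> (\<integral>x. g (f x) \<partial>\<mu> j)" by (simp add: ref_f[OF j])
  then show "(\<integral>x. g (f x) \<partial>\<mu> j) = integral\<^sup>L (\<mu> j) g" using \<mu>(3)[OF j g] LIMSEQ_unique by blast
qed

lemma avg_cont: "continuous_on X g \<Longrightarrow> continuous_on X (avg n g)"
  unfolding avg_def by (rule continuous_on_time_average[OF ds])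

text \<open>
  For \<open>\<mu> j\<close> the averages over the length of a loop are mostly close to the average over the loop of type
  \<open>j\<close>, because the prefixes of all levels together have relative length at most \<open>\<kappa>\<close>.
\<close>

lemma level0_deviation:
  assumes ap: "approx \<phi> 0 e" "e \<ge> 0" and C: "\<And>x. x \<in> X \<Longrightarrow> \<bar>\<phi> x\<bar> \<le> C" and j: "j < k"
  shows "(\<integral>x. \<bar>avg 0 \<phi> x - ref 0 j \<phi>\<bar> \<partial>\<mu> j) \<le> 2 * e + 2 * C * \<kappa>"
proof -
  let ?u = "\<lambda>x. \<bar>avg 0 \<phi> x - ref 0 j \<phi>\<bar>"
  let ?b = "\<lambda>N. 2 * e + 2 * C * (\<kappa> * (1 - (1 / 2) ^ N))"
  have C0: "C \<ge> 0" using order_trans[OF abs_ge_zero C[OF orb_in[OF pseudo_per[OF j]]]] .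
  have u2C: "?u x \<le> 2 * C" if "x \<in> X" for x by (rule avg_ref_le[OF C that j])
  have main: "(\<Sum>s<len (Suc N). ?u (orb p (a + int s))) \<le> ?b (Suc N) * real (len (Suc N))"
    if "pseudo p" "occurs p (Suc N) j a" for N p a
    using that(2)
  proof (induction N arbitrary: a)
    case 0
    have "2 * e + 2 * C * (real (k + 1) / real (r 0)) \<le> ?b (Suc 0)"
      using k_over_r(1)[of 0] C0 by (intro add_left_mono mult_left_mono) auto
    then have "(2 * e + 2 * C * real (k + 1) / real (r 0)) * real (len (Suc 0)) \<le> ?b (Suc 0) * real (len (Suc 0))"
      by (intro mult_right_mono) auto
    then show ?case using local_averages[OF ap C that(1) j 0] by linarith
  next
    case (Suc N)
    have "(\<Sum>s<len (Suc (Suc N)). ?u (orb p (a + int s)))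
        \<le> (?b (Suc N) + 2 * C * real k / real (r (Suc N))) * real (len (Suc (Suc N)))"
    proof (rule sum_over_block[where F = "\<lambda>t. ?u (orb p t)", OF _ _ _ j Suc.prems])
      show "?u (orb p t) \<le> 2 * C" for t by (rule u2C[OF orb_in[OF that(1)]])
      have "(1 / 2) ^ Suc N \<le> (1 :: real)" by (rule power_le_one) auto
      then show "?b (Suc N) \<ge> 0" using C0 \<kappa> ap(2) by (intro add_nonneg_nonneg mult_nonneg_nonneg) auto
    qed (use C0 Suc.IH in auto)
    also have "\<dots> \<le> ?b (Suc (Suc N)) * real (len (Suc (Suc N)))"
    proof (rule mult_right_mono)
      have "2 * C * (real k / real (r (Suc N))) \<le> 2 * C * (\<kappa> * (1 / 2) ^ Suc (Suc N))"
        using k_over_r(2)[of "Suc N"] C0 by (intro mult_left_mono) auto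
      then show "?b (Suc N) + 2 * C * real k / real (r (Suc N)) \<le> ?b (Suc (Suc N))"
        by (simp add: algebra_simps)
    qed simp
    finally show ?case .
  qed
  have cont: "continuous_on X ?u" by (intro continuous_intros avg_cont \<phi>)
  have "ref (Suc N) j ?u \<le> 2 * e + 2 * C * \<kappa>" for N
  proof -
    have "(\<Sum>s<len (Suc N). ?u (orb (per (Suc N) j) (int s))) \<le> ?b (Suc N) * real (len (Suc N))"
      using main[OF pseudo_per[OF j] occurs_per[OF j, of "Suc N" 0]] by simp
    then have "ref (Suc N) j ?u \<le> ?b (Suc N)"
      unfolding ref_def using len_pos[of "Suc N"] by (simp add: pos_divide_le_eq)
    also have "\<dots> \<le> 2 * e + 2 * C * \<kappa>"
    proof -
      have "\<kappa> * (1 - (1 / 2) ^ Suc N) \<le> \<kappa> * 1" using \<kappa> by (intro mult_left_mono) auto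
      then have "2 * C * (\<kappa> * (1 - (1 / 2) ^ Suc N)) \<le> 2 * C * \<kappa>" using C0 by (intro mult_left_mono) auto
      then show ?thesis by linarith
    qed
    finally show ?thesis .
  qed
  then show ?thesis
    by (intro LIMSEQ_le_const2[OF LIMSEQ_Suc[OF \<mu>(3)[OF j cont]]]) auto
qed

end

section \<open>A recurrent concatenation of blocks\<close>

context block_construction
begin

text \<open>
  The distance of the origin of the concatenation from the left end of the block of level \<open>n\<close> that
  contains it. This block has type \<open>n mod 2\<close> and is the block with index \<open>n mod 2\<close> in the next one. The
  odd levels make the concatenation extend to the left, the prefixes being followed by long runs make
  it extend to the right.
\<close>

primrec off :: "nat \<Rightarrow> nat" where
  "off 0 = 0"
| "off (Suc n) = off n + (n mod 2) * len n"

lemma mod2_lt: "n mod 2 < k" "n mod 2 < r m"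
  using k r[of m] mod_less_divisor[of 2 n] by linarith+

lemma off_Suc_le: "off n < len n \<Longrightarrow> off (Suc n) < 2 * len n"
proof -
  assume "off n < len n"
  moreover have "(n mod 2) * len n \<le> 1 * len n" by (rule mult_le_mono1) simp
  ultimately show ?thesis unfolding off.simps by linarith
qed

lemma off_lt: "off n < len n"
proof (induction n)
  case (Suc n)
  then show ?case using off_Suc_le[of n] two_len_le[of n] by linarith
qed (simp add: len_pos)

lemma four_len_le: "4 * len n \<le> len (Suc n)"
  unfolding len_Suc using r[of n] k by (intro mult_le_mono1) linarith

lemma off_cover: "\<exists>N\<ge>n. m \<le> off N \<and> off N + m < len N"
proof -
  define M where "M = 2 * (m + n) + 1"
  have M: "M mod 2 = 1" unfolding M_def by presburger
  have m: "m < len M" "n \<le> M" using len_ge[of M] by (auto simp: M_def)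
  have "len M \<le> off (Suc M)" using M by simp
  moreover have "off (Suc M) + m < len (Suc M)"
    using off_Suc_le[OF off_lt, of M] four_len_le[of M] m by linarith
  ultimately show ?thesis using m by (intro exI[of _ "Suc M"]) simp
qed

lemma off_mono: "n \<le> N \<Longrightarrow> off n \<le> off N"
  by (induction rule: dec_induct) auto

lemma block_nested:
  assumes "n \<le> N" "s < len n"
  shows "off N - off n + s < len N \<and> block N (N mod 2) ! (off N - off n + s) = block n (n mod 2) ! s"
  using assms(1)
proof (induction rule: dec_induct)
  case (step N)
  let ?s = "off N - off n + s"
  have eq: "off (Suc N) - off n + s = (N mod 2) * len N + ?s" using off_mono[OF step(1)] by simp
  have "block (Suc N) (Suc N mod 2) ! ((N mod 2) * len N + ?s) = block N (types N (Suc N mod 2) ! (N mod 2)) ! ?s"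
    by (rule block_Suc_nth[OF mod2_lt]) (use step in simp)
  moreover have "(N mod 2) * len N + ?s < 2 * len N"
  proof -
    have "(N mod 2) * len N \<le> 1 * len N" by (rule mult_le_mono1) simp
    then show ?thesis using step.IH by linarith
  qed
  ultimately show ?case
    unfolding eq using types_nth(1)[OF mod2_lt(1)] step two_len_le[of N] by simp
qed (use assms in simp)

text \<open>
  The two-sided concatenation, read off from any block around the origin that contains the place \<open>i\<close>.
\<close>

definition centre :: "int \<Rightarrow> 'a" where
  "centre i = (let N = (SOME N. 0 \<le> int (off N) + i \<and> int (off N) + i < int (len N))
     in block N (N mod 2) ! nat (int (off N) + i))"

lemma centre_eq:
  assumes N: "0 \<le> int (off N) + i" "int (off N) + i < int (len N)"
  shows "centre i = block N (N mod 2) ! nat (int (off N) + i)"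
proof -
  have le: "block M (M mod 2) ! nat (int (off M) + i) = block M' (M' mod 2) ! nat (int (off M') + i)"
    if M: "0 \<le> int (off M) + i" "int (off M) + i < int (len M)" and "M \<le> M'" for M M'
  proof -
    have "off M' - off M + nat (int (off M) + i) = nat (int (off M') + i)"
      using off_mono[OF \<open>M \<le> M'\<close>] M by linarith
    then show ?thesis using block_nested[OF \<open>M \<le> M'\<close>, of "nat (int (off M) + i)"] M by simp
  qed
  define M where "M = (SOME N. 0 \<le> int (off N) + i \<and> int (off N) + i < int (len N))"
  have M: "0 \<le> int (off M) + i \<and> int (off M) + i < int (len M)"
    unfolding M_def by (rule someI[of _ N]) (use N in blast)
  have "centre i = block M (M mod 2) ! nat (int (off M) + i)" by (simp add: centre_def M_def Let_def)
  also have "\<dots> = block N (N mod 2) ! nat (int (off N) + i)"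
  proof (cases "M \<le> N")
    case True
    then show ?thesis using le[of M N] M by blast
  next
    case False
    then have "N \<le> M" by simp
    from le[OF N this] show ?thesis by (rule sym)
  qed
  finally show ?thesis .
qed

lemma occurs_centre: "occurs centre N (N mod 2) (- int (off N))"
  unfolding occurs_def using centre_eq[of N] by simp

lemma pseudo_centre: "pseudo centre"
  unfolding pseudo_orbit_def
proof (intro allI)
  fix i :: int
  obtain N where N: "nat \<bar>i\<bar> + 1 \<le> off N" "off N + (nat \<bar>i\<bar> + 1) < len N" using off_cover by blast
  let ?b = "block N (N mod 2)"
  define s where "s = nat (int (off N) + i)"
  have l: "loop X f \<delta> z ?b" "length ?b = len N"
    by (rule loop_block[OF mod2_lt(1)], rule length_block[OF mod2_lt(1)])
  have s: "Suc s < len N" "int s = int (off N) + i" using N by (auto simp: s_def)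
  have "centre i = ?b ! s" using centre_eq[of N i] s by (simp add: s_def)
  moreover have "centre (i + 1) = ?b ! Suc s"
  proof -
    have "nat (int (off N) + (i + 1)) = Suc s" using s(2) by linarith
    then show ?thesis using centre_eq[of N "i + 1"] s by simp
  qed
  ultimately show "centre i \<in> X \<and> dist (f (centre i)) (centre (i + 1)) < \<delta>"
    using loop_in[OF l(1), of s] loop_step[OF l(1), of s] s(1) l(2) by simp
qed

lemma len_dvd: "n \<le> N \<Longrightarrow> len n dvd len N"
  by (induction rule: dec_induct) (auto simp: len_Suc)

lemma off_dvd: "n \<le> N \<Longrightarrow> len n dvd off N - off n"
proof (induction rule: dec_induct)
  case (step N)
  have "off (Suc N) - off n = (off N - off n) + (N mod 2) * len N" using off_mono[OF step(1)] by simp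
  then show ?case using step len_dvd[OF step(1)] by (metis dvd_add dvd_mult)
qed simp

lemma occurs_sub_all:
  "\<lbrakk>occurs p (n + m) j a; j < k; q < len (n + m); len n dvd q\<rbrakk> \<Longrightarrow> \<exists>j'<k. occurs p n j' (a + int q)"
proof (induction m arbitrary: j a q)
  case 0
  then have "q = 0" by (metis add.right_neutral nat_dvd_not_less neq0_conv)
  then show ?case using 0 by auto
next
  case (Suc m)
  let ?M = "len (n + m)"
  define i q' where "i = q div ?M" and "q' = q mod ?M"
  have q: "int q = int (i * ?M) + int q'"
    unfolding i_def q'_def of_nat_add[symmetric] by simp
  have i: "i < r (n + m)" using Suc.prems(3) by (simp add: i_def len_Suc less_mult_imp_div_less)
  have q': "q' < ?M" "len n dvd q'"
    using Suc.prems(4) len_pos[of "n + m"] len_dvd[of n "n + m"] by (auto simp: q'_def dvd_mod)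
  have "occurs p (n + m) (types (n + m) j ! i) (a + int (i * ?M))"
    using occurs_sub[OF _ Suc.prems(2) i] Suc.prems(1) by simp
  from Suc.IH[OF this types_nth_lt[OF Suc.prems(2) i] q'] show ?case by (simp add: q add.assoc)
qed

lemma occurs_centre_all: "\<exists>j<k. occurs centre n j (- int (off n) + i * int (len n))"
proof -
  define c where "c = nat \<bar>i\<bar> * len n"
  obtain N where N: "N \<ge> n" "off n + c + 1 \<le> off N" "off N + (off n + c + 1) < len N"
    using off_cover[of n "off n + c + 1"] by blast
  define q where "q = nat (int (off N) - int (off n) + i * int (len n))"
  have ai: "\<bar>i * int (len n)\<bar> = int c" by (simp add: c_def abs_mult)
  have q: "int q = int (off N) - int (off n) + i * int (len n)" and lt: "q < len N"
    using N ai unfolding q_def by linarith+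
  have "int (len n) dvd int (off N - off n)" using off_dvd[OF N(1)] by simp
  then have "int (len n) dvd int q" unfolding q using off_mono[OF N(1)] by (simp add: of_nat_diff)
  then have "len n dvd q" by simp
  from occurs_sub_all[of centre n "N - n" "N mod 2" "- int (off N)" q] this lt N(1) occurs_centre[of N] mod2_lt(1)
  have "\<exists>j'<k. occurs centre n j' (- int (off N) + int q)" by simp
  then show ?thesis by (simp add: q)
qed

lemma find_block:
  assumes j: "j < k"
  shows "\<exists>a::nat. n \<le> a \<and> a \<le> n + 2 * len (Suc N) \<and> occurs centre N j (int a)"
proof -
  let ?M = "len (Suc N)" and ?c = "off (Suc N)"
  define i where "i = (n + ?c) div ?M + 1"
  have lo: "n + ?c < i * ?M" and hi: "i * ?M \<le> n + ?c + ?M"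
    using len_pos[of "Suc N"] dividend_less_div_times[of ?M "n + ?c"] by (auto simp: i_def algebra_simps)
  obtain j' where j': "j' < k" "occurs centre (Suc N) j' (- int ?c + int i * int ?M)"
    using occurs_centre_all by blast
  have jr: "j < r N" using j r[of N] by simp
  define a where "a = i * ?M - ?c + j * len N"
  have "int a = - int ?c + int i * int ?M + int (j * len N)" using lo by (simp add: a_def)
  then have occ: "occurs centre N j (int a)"
    using occurs_sub[OF j'(2,1) jr] by (simp only: types_nth(1)[OF j])
  have "j * len N \<le> ?M" unfolding len_Suc using jr by (intro mult_le_mono1) simp
  then have "n \<le> a \<and> a \<le> n + 2 * ?M" using lo hi unfolding a_def by linarith
  then show ?thesis using occ by blast
qed

lemma recurrence:
  assumes e: "e > 0"
  shows "\<exists>M. \<forall>n. \<exists>l\<in>{n..n + M}. dist (orb centre (int l + int t)) (orb centre (int t)) < e"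
proof -
  obtain R :: nat where R: "\<And>p p'. \<lbrakk>pseudo p; pseudo p'; \<And>i. \<bar>i\<bar> \<le> int R \<Longrightarrow> p i = p' i\<rbrakk> \<Longrightarrow> dist (\<pi> p) (\<pi> p') < e"
    using tracing e unfolding tracing_def by metis
  obtain N where N: "R + t \<le> off N" "off N + (R + t) < len N" using off_cover by blast
  have "\<exists>l\<in>{n..n + 3 * len (Suc N)}. dist (orb centre (int l + int t)) (orb centre (int t)) < e" for n
  proof -
    obtain a where a: "n \<le> a" "a \<le> n + 2 * len (Suc N)" "occurs centre N (N mod 2) (int a)"
      using find_block[OF mod2_lt(1)] by blast
    have s: "R \<le> off N + t" "off N + t + R < len N" using N by auto
    have "dist (\<pi> (\<lambda>i. centre (i + (int a + int (off N + t)))))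
        (\<pi> (\<lambda>i. centre (i + (- int (off N) + int (off N + t))))) < e"
      by (intro R pseudo_orbit_shift pseudo_centre occurs_agree[OF a(3) occurs_centre s])
    then have "dist (orb centre (int (a + off N) + int t)) (orb centre (int t)) < e"
      by (simp add: orb_def add.assoc)
    moreover have "a + off N \<in> {n..n + 3 * len (Suc N)}"
      using a off_lt[of N] two_len_le[of N] by auto
    ultimately show ?thesis by blast
  qed
  then show ?thesis by blast
qed

text \<open>
  The point that will be shown to have the required properties, and its limit set.
\<close>

abbreviation x\<^sub>0 :: 'a where "x\<^sub>0 \<equiv> orb centre 0"
abbreviation \<omega> :: "'a set" where "\<omega> \<equiv> omega_limit f x\<^sub>0"

lemma orbit_x0: "(f ^^ n) x\<^sub>0 = orb centre (int n)"
  using funpow_orb[OF pseudo_centre, of n 0] by simp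

lemma x0_AP: "x\<^sub>0 \<in> AP X f"
  unfolding AP_def
proof (intro CollectI conjI allI impI)
  show "x\<^sub>0 \<in> X" by (rule orb_in[OF pseudo_centre])
  fix U assume "openin (top_of_set X) U \<and> x\<^sub>0 \<in> U"
  then obtain e where e: "e > 0" "ball x\<^sub>0 e \<inter> X \<subseteq> U" unfolding openin_contains_ball by blast
  obtain M where M: "\<And>n. \<exists>l\<in>{n..n + M}. dist (orb centre (int l + int 0)) (orb centre (int 0)) < e"
    using recurrence[OF e(1), of 0] by blast
  have "\<exists>l\<in>{n..n + M}. (f ^^ l) x\<^sub>0 \<in> U" for n
  proof -
    obtain l where l: "l \<in> {n..n + M}" "dist (orb centre (int l)) x\<^sub>0 < e" using M[of n] by auto
    then have "orb centre (int l) \<in> U" using e(2) orb_in[OF pseudo_centre] by (auto simp: dist_commute)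
    then show ?thesis using l(1) orbit_x0 by auto
  qed
  then show "\<exists>M. \<forall>n. \<exists>l\<in>{n..n + M}. (f ^^ l) x\<^sub>0 \<in> U" by blast
qed

lemma orbit_in_\<omega>: "orb centre (int t) \<in> \<omega>"
  unfolding omega_limit_def
proof (intro INT_I)
  fix n :: nat
  show "orb centre (int t) \<in> closure {(f ^^ l) x\<^sub>0 |l. l \<ge> n}"
    unfolding closure_approachable
  proof (intro allI impI)
    fix e :: real assume "e > 0"
    then obtain M where "\<exists>l\<in>{n..n + M}. dist (orb centre (int l + int t)) (orb centre (int t)) < e"
      using recurrence by meson
    then obtain l where l: "l \<ge> n" "dist (orb centre (int (l + t))) (orb centre (int t)) < e" by auto
    then show "\<exists>y\<in>{(f ^^ l) x\<^sub>0 |l. l \<ge> n}. dist y (orb centre (int t)) < e"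
      using orbit_x0[of "l + t"] by (intro bexI[of _ "orb centre (int (l + t))"]) (auto intro!: exI[of _ "l + t"])
  qed
qed

lemma \<omega>_subset: "\<omega> \<subseteq> closure (range (\<lambda>t::nat. orb centre (int t)))"
proof -
  have "{(f ^^ l) x\<^sub>0 |l. l \<ge> 0} = range (\<lambda>t::nat. orb centre (int t))" by (auto simp: orbit_x0)
  then show ?thesis
    unfolding omega_limit_def using INT_lower[of 0 UNIV "\<lambda>n. closure {(f ^^ l) x\<^sub>0 |l. l \<ge> n}"] by simp
qed

lemma \<omega>_closed: "closed \<omega>" "\<omega> \<subseteq> X"
proof -
  show "closed \<omega>" unfolding omega_limit_def by (intro closed_INT) simp
  have "closure (range (\<lambda>t::nat. orb centre (int t))) \<subseteq> X"
    using orb_in[OF pseudo_centre] compact_imp_closed[OF X(1)] by (intro closure_minimal) auto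
  then show "\<omega> \<subseteq> X" using \<omega>_subset by blast
qed

text \<open>
  A window of length \<open>len n\<close> is covered by two consecutive blocks of level \<open>n\<close>.
\<close>

lemma window_sum_le:
  fixes F :: "int \<Rightarrow> real"
  assumes F: "\<And>t. F t \<ge> 0" and b: "\<And>j a. j < k \<Longrightarrow> occurs centre n j a \<Longrightarrow> (\<Sum>s<len n. F (a + int s)) \<le> b"
  shows "(\<Sum>s<len n. F (t + int s)) \<le> 2 * b"
proof -
  let ?l = "len n"
  define i where "i = (t + int (off n)) div int ?l"
  define q where "q = nat ((t + int (off n)) mod int ?l)"
  define a where "a = - int (off n) + i * int ?l"
  have l: "int ?l > 0" using len_pos[of n] by simp
  have q: "q < ?l" using l pos_mod_bound[OF l] by (simp add: q_def nat_less_iff)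
  have t: "t = a + int q"
  proof -
    have "int q = (t + int (off n)) mod int ?l" using pos_mod_sign[OF l] by (simp add: q_def)
    then show ?thesis
      using div_mult_mod_eq[of "t + int (off n)" "int ?l"] unfolding a_def i_def by linarith
  qed
  have b1: "(\<Sum>s<?l. F (a + int s)) \<le> b" using occurs_centre_all[of n i] b by (auto simp: a_def)
  have b2: "(\<Sum>s<?l. F (a + int (?l + s))) \<le> b"
  proof -
    obtain j where j: "j < k" "occurs centre n j (- int (off n) + (i + 1) * int ?l)"
      using occurs_centre_all by blast
    have "a + int (?l + s) = (- int (off n) + (i + 1) * int ?l) + int s" for s
      by (simp add: a_def distrib_right)
    then show ?thesis using b[OF j] by (simp only:)
  qed
  have "(\<Sum>s<?l. F (t + int s)) = (\<Sum>s<?l. F (a + int (q + s)))" by (simp add: t add.assoc)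
  also have "\<dots> = (\<Sum>s\<in>{q..<q + ?l}. F (a + int s))" by (rule sum_window)
  also have "\<dots> \<le> (\<Sum>s<2 * ?l. F (a + int s))" using q F by (intro sum_mono2) auto
  also have "\<dots> = (\<Sum>s<?l. F (a + int s)) + (\<Sum>s<?l. F (a + int (?l + s)))"
    by (subst sum_split_blocks) (simp add: numeral_2_eq_2)
  finally show ?thesis using b1 b2 by linarith
qed

text \<open>
  Bounds for sums over the blocks of the concatenation carry over to integrals with respect to every
  invariant measure on the limit set, because the bound for \<open>avg n v\<close> passes to the closure of the orbit.
\<close>

lemma transfer_integral:
  assumes \<nu>: "\<nu> \<in> invariant_measures X f" "emeasure \<nu> \<omega> = 1"
    and v: "continuous_on X v" "\<And>x. x \<in> X \<Longrightarrow> v x \<ge> 0"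
    and b: "\<And>j a. j < k \<Longrightarrow> occurs centre n j a \<Longrightarrow> (\<Sum>s<len n. v (orb centre (a + int s))) \<le> b * real (len n)"
  shows "integral\<^sup>L \<nu> v \<le> 2 * b"
proof -
  note D = invariant_measuresD[OF ds \<nu>(1)]
  interpret prob_space \<nu> by (rule D)
  have c: "continuous_on X (avg n v)" unfolding avg_def by (rule continuous_on_time_average[OF ds v(1)])
  have orbit: "avg n v (orb centre t) \<le> 2 * b" for t
  proof -
    have "(\<Sum>s<len n. v (orb centre (t + int s))) \<le> 2 * (b * real (len n))"
      by (rule window_sum_le[where F = "\<lambda>t. v (orb centre t)"]) (use v(2) orb_in[OF pseudo_centre] b in auto)
    then show ?thesis using len_pos[of n] by (simp add: avg_orb[OF pseudo_centre] pos_divide_le_eq)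
  qed
  have le: "avg n v y \<le> 2 * b" if y: "y \<in> \<omega>" for y
  proof -
    have "y \<in> closure (range (\<lambda>t::nat. orb centre (int t)))" using y \<omega>_subset by blast
    then obtain u where u: "\<And>m. u m \<in> range (\<lambda>t::nat. orb centre (int t))" "u \<longlonglongrightarrow> y"
      unfolding closure_sequential by blast
    have uX: "u m \<in> X" for m using u(1)[of m] orb_in[OF pseudo_centre] by auto
    have "(\<lambda>m. avg n v (u m)) \<longlonglongrightarrow> avg n v y"
      using continuous_on_tendsto_compose[OF c u(2)] y \<omega>_closed(2) uX by auto
    moreover have "avg n v (u m) \<le> 2 * b" for m using u(1)[of m] orbit by auto
    ultimately show ?thesis by (intro LIMSEQ_le_const2) auto
  qed
  have "\<omega> \<in> sets \<nu>" using \<nu>(2) emeasure_notin_sets[of \<omega> \<nu>] by (metis zero_neq_one)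
  then have "AE y in \<nu>. y \<in> \<omega>" using \<nu>(2) by (subst AE_in_set_eq_1) (auto simp: measure_def)
  then have AE: "AE y in \<nu>. avg n v y \<le> 2 * b" by eventually_elim (rule le)
  have "integral\<^sup>L \<nu> v = (\<integral>y. avg n v y \<partial>\<nu>)"
    unfolding avg_def by (rule integral_time_average_space[OF ds \<nu>(1) v(1) len_pos, symmetric])
  also have "\<dots> \<le> 2 * b"
    by (rule integral_le_const[OF continuous_integrable_on[OF finite_measure_axioms D(2) X(1) c] AE])
  finally show ?thesis .
qed

lemma sum_occurrence:
  assumes ap: "approx g n e" and p: "pseudo p" and j: "j < k" and occ: "occurs p n j a"
  shows "\<bar>(\<Sum>s<len n. g (orb p (a + int s))) - ref n j g * real (len n)\<bar> \<le> e * real (len n)"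
proof -
  have eq: "(\<Sum>s<len n. g (orb p (a + int s))) - ref n j g * real (len n)
      = (\<Sum>s<len n. g (orb p (a + int s)) - g (orb (per n j) (int s)))"
    using len_pos[of n] by (simp add: ref_def sum_subtractf)
  have "\<bar>\<Sum>s<len n. g (orb p (a + int s)) - g (orb (per n j) (int s))\<bar>
      \<le> (\<Sum>s<len n. \<bar>g (orb p (a + int s)) - g (orb (per n j) (int s))\<bar>)" by (rule sum_abs)
  also have "\<dots> \<le> e * real (len n)" using ap p j occ unfolding approx_def by blast
  finally show ?thesis unfolding eq .
qed

end

context block_measures
begin

lemma \<mu>_\<omega>:
  assumes j: "j < k"
  shows "emeasure (\<mu> j) \<omega> = 1"
proof -
  interpret P: prob_space "\<mu> j" by (rule \<mu>(1)[OF j])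
  let ?v = "\<lambda>x. infdist x \<omega>"
  have v: "continuous_on X ?v" by (intro continuous_intros)
  have ne: "\<omega> \<noteq> {}" using orbit_in_\<omega> by blast
  have "(\<lambda>n. ref n j ?v) \<longlonglongrightarrow> 0"
  proof (rule tendstoI)
    fix e :: real assume "e > 0"
    then have "e / 2 > 0" by simp
    from eventually_approx[OF v this]
    show "\<forall>\<^sub>F n in sequentially. dist (ref n j ?v) 0 < e"
    proof eventually_elim
      fix n assume ap: "approx ?v n (e / 2)"
      obtain a :: nat where a: "occurs centre n j (int a)" using find_block[OF j] by blast
      have "?v (orb centre (int a + int s)) = 0" for s using orbit_in_\<omega>[of "a + s"] by simp
      then have "\<bar>ref n j ?v * real (len n)\<bar> \<le> e / 2 * real (len n)"
        using sum_occurrence[OF ap pseudo_centre j a] by simp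
      then have "\<bar>ref n j ?v\<bar> \<le> e / 2" using len_pos[of n] by (simp add: abs_mult)
      then show "dist (ref n j ?v) 0 < e" using \<open>e > 0\<close> by simp
    qed
  qed
  then have "integral\<^sup>L (\<mu> j) ?v = 0" using \<mu>(3)[OF j v] LIMSEQ_unique by blast
  moreover have "integrable (\<mu> j) ?v"
    by (rule continuous_integrable_on[OF P.finite_measure_axioms \<mu>(2)[OF j] X(1) v])
  ultimately have "AE x in \<mu> j. ?v x = 0"
    using integral_nonneg_eq_0_iff_AE[of "\<mu> j" ?v] by (simp add: infdist_nonneg)
  then have AE: "AE x in \<mu> j. x \<in> \<omega>"
    by eventually_elim (simp add: in_closed_iff_infdist_zero[OF \<omega>_closed(1) ne])
  have "\<omega> \<in> sets (\<mu> j)"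
    unfolding \<mu>(2)[OF j] sets_restrict_space using \<omega>_closed by (intro image_eqI[of _ _ \<omega>]) auto
  then have "measure (\<mu> j) \<omega> = 1" using AE P.AE_in_set_eq_1 by blast
  then show ?thesis by (simp add: P.emeasure_eq_measure)
qed

end

section \<open>Convergence almost everywhere and irregularity\<close>

lemma sum_lessThan_plus:
  fixes F :: "nat \<Rightarrow> real"
  shows "(\<Sum>s<m + n. F s) = (\<Sum>s<m. F s) + (\<Sum>s<n. F (m + s))"
  by (induction n) simp_all

lemma infdist_pair_le:
  assumes "(c, d) \<in> S"
  shows "infdist (a, b) S \<le> \<bar>a - c\<bar> + \<bar>b - d :: real\<bar>"
proof -
  have "infdist (a, b) S \<le> dist (a, b) (c, d)" by (rule infdist_le[OF assms])
  also have "\<dots> \<le> dist a c + dist b d"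
    unfolding dist_Pair_Pair by (rule sqrt_sum_squares_le_sum) simp_all
  finally show ?thesis by (simp add: dist_real_def)
qed

context block_measures
begin

context
  fixes C :: real assumes C: "\<And>x. x \<in> X \<Longrightarrow> \<bar>\<phi> x\<bar> \<le> C"
begin

lemma C_nonneg: "C \<ge> 0"
  using order_trans[OF abs_ge_zero C[OF orb_in[OF pseudo_centre]]] .

text \<open>
  A bound for the mean error of the values of \<open>\<phi>\<close> along occurrences of blocks of level \<open>n\<close>.
\<close>

definition err :: "nat \<Rightarrow> real" where
  "err n = (1 / 2) ^ n + 4 * C * real (R n) / real (len n)"

lemma approx_err: "approx \<phi> n (err n)"
  unfolding err_def
proof (rule approx_of_window[OF C])
  show "\<bar>\<phi> (\<pi> p) - \<phi> (\<pi> p')\<bar> \<le> (1 / 2) ^ n"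
    if "pseudo p" "pseudo p'" "\<And>i. \<bar>i\<bar> \<le> int (R n) \<Longrightarrow> p i = p' i" for p p'
    using window[of p p' n, OF that] by simp
qed simp_all

lemma err_nonneg: "err n \<ge> 0"
  unfolding err_def using C_nonneg by simp

lemma summable_err: "summable err"
proof -
  have "summable (\<lambda>n. 1 * (1 / 2) ^ n + 4 * C * (real (R n) / real (len n)))"
    by (intro summable_add summable_half summable_mult summable_R)
  then show ?thesis by (simp add: err_def[abs_def])
qed

text \<open>
  A bound for the mean deviation of \<open>avg n \<phi>\<close> from \<open>ref n j \<phi>\<close> within blocks of type \<open>j\<close> of level \<open>n + 1\<close>.
\<close>

definition dev :: "nat \<Rightarrow> real" where
  "dev n = 2 * err n + 2 * C * real (k + 1) / real (r n)"

lemma dev_nonneg: "dev n \<ge> 0"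
  unfolding dev_def using C_nonneg err_nonneg by simp

lemma summable_dev: "summable dev"
proof -
  have "summable (\<lambda>n. 2 * err n + 2 * C * (real (k + 1) / real (r n)))"
    by (intro summable_add summable_mult summable_err summable_inverse_r)
  then show ?thesis by (simp add: dev_def[abs_def])
qed

text \<open>
  In a block of type \<open>j\<close> of level \<open>n + 2\<close>, most windows of length \<open>len n\<close> and of length \<open>len (Suc n)\<close> starting at
  the same time see blocks of type \<open>j\<close> only. The resulting bound is summable over \<open>n\<close>.
\<close>

lemma variation_block:
  assumes p: "pseudo p" and j: "j < k" and occ: "occurs p (Suc (Suc n)) j a"
  shows "(\<Sum>s<len (Suc (Suc n)). \<bar>avg (Suc n) \<phi> (orb p (a + int s)) - avg n \<phi> (orb p (a + int s))\<bar>)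
       \<le> (dev (Suc n) + (dev n + 2 * C * real k / real (r (Suc n))) + dev n) * real (len (Suc (Suc n)))"
proof -
  let ?l = "len (Suc (Suc n))" and ?o = "\<lambda>s. orb p (a + int s)"
  have F: "\<bar>avg n \<phi> (orb p t) - ref n j \<phi>\<bar> \<le> 2 * C" for t
    by (rule avg_ref_le[OF C orb_in[OF p] j])
  have s1: "(\<Sum>s<?l. \<bar>avg (Suc n) \<phi> (?o s) - ref (Suc n) j \<phi>\<bar>) \<le> dev (Suc n) * real ?l"
    unfolding dev_def by (rule local_averages[OF approx_err err_nonneg C p j occ])
  have s2: "(\<Sum>s<?l. \<bar>avg n \<phi> (?o s) - ref n j \<phi>\<bar>) \<le> (dev n + 2 * C * real k / real (r (Suc n))) * real ?l"
  proof (rule sum_over_block[where F = "\<lambda>t. \<bar>avg n \<phi> (orb p t) - ref n j \<phi>\<bar>", OF F _ dev_nonneg j occ])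
    show "(\<Sum>s<len (Suc n). \<bar>avg n \<phi> (orb p (a' + int s)) - ref n j \<phi>\<bar>) \<le> dev n * real (len (Suc n))"
      if "occurs p (Suc n) j a'" for a'
      unfolding dev_def by (rule local_averages[OF approx_err err_nonneg C p j that])
  qed (use C_nonneg in simp)
  have s3: "\<bar>ref (Suc n) j \<phi> - ref n j \<phi>\<bar> \<le> dev n"
    unfolding dev_def by (rule ref_Suc_close[OF approx_err err_nonneg C j])
  have "(\<Sum>s<?l. \<bar>avg (Suc n) \<phi> (?o s) - avg n \<phi> (?o s)\<bar>)
      \<le> (\<Sum>s<?l. \<bar>avg (Suc n) \<phi> (?o s) - ref (Suc n) j \<phi>\<bar> + \<bar>avg n \<phi> (?o s) - ref n j \<phi>\<bar> + dev n)"
    by (rule sum_mono) (use s3 in linarith)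
  also have "\<dots> = (\<Sum>s<?l. \<bar>avg (Suc n) \<phi> (?o s) - ref (Suc n) j \<phi>\<bar>)
      + (\<Sum>s<?l. \<bar>avg n \<phi> (?o s) - ref n j \<phi>\<bar>) + real ?l * dev n"
    by (simp add: sum.distrib)
  also have "\<dots> \<le> dev (Suc n) * real ?l + (dev n + 2 * C * real k / real (r (Suc n))) * real ?l + real ?l * dev n"
    using s1 s2 by linarith
  also have "\<dots> = (dev (Suc n) + (dev n + 2 * C * real k / real (r (Suc n))) + dev n) * real ?l"
    by (simp add: distrib_right)
  finally show ?thesis .
qed

lemma summable_variation:
  assumes \<nu>: "\<nu> \<in> invariant_measures X f" "emeasure \<nu> \<omega> = 1"
  shows "summable (\<lambda>n. \<integral>x. \<bar>avg (Suc n) \<phi> x - avg n \<phi> x\<bar> \<partial>\<nu>)"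
proof (rule summable_comparison_test'[where N = 0])
  show "summable (\<lambda>n. 2 * (dev (Suc n) + (dev n + 2 * C * (real k / real (r (Suc n)))) + dev n))"
    using summable_dev summable_inverse_r(2) summable_Suc_iff[of dev]
      summable_Suc_iff[of "\<lambda>n. real k / real (r n)"]
    by (intro summable_mult summable_add) auto
  fix n
  have "(\<integral>x. \<bar>avg (Suc n) \<phi> x - avg n \<phi> x\<bar> \<partial>\<nu>)
      \<le> 2 * (dev (Suc n) + (dev n + 2 * C * real k / real (r (Suc n))) + dev n)"
  proof (rule transfer_integral[OF \<nu>])
    show "continuous_on X (\<lambda>x. \<bar>avg (Suc n) \<phi> x - avg n \<phi> x\<bar>)"
      by (intro continuous_intros avg_cont \<phi>)
  qed (simp, rule variation_block[OF pseudo_centre])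
  then show "norm (\<integral>x. \<bar>avg (Suc n) \<phi> x - avg n \<phi> x\<bar> \<partial>\<nu>)
      \<le> 2 * (dev (Suc n) + (dev n + 2 * C * (real k / real (r (Suc n)))) + dev n)"
    by simp
qed

lemma tendsto_inverse_r: "(\<lambda>n. c * real (k + 1) / real (r n)) \<longlonglongrightarrow> 0"
  using tendsto_mult_right_zero[OF summable_LIMSEQ_zero[OF summable_inverse_r(1)], of c] by simp

lemma near:
  assumes \<nu>: "\<nu> \<in> invariant_measures X f" "emeasure \<nu> \<omega> = 1" and g: "continuous_on X (g :: 'a \<Rightarrow> real)"
  shows "(\<lambda>n. \<integral>x. infdist (avg n \<phi> x, avg n g x)
           ((\<lambda>j. (integral\<^sup>L (\<mu> j) \<phi>, integral\<^sup>L (\<mu> j) g)) ` {..<k}) \<partial>\<nu>) \<longlonglongrightarrow> 0"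
proof (rule tendstoI)
  let ?S = "(\<lambda>j. (integral\<^sup>L (\<mu> j) \<phi>, integral\<^sup>L (\<mu> j) g)) ` {..<k}"
  fix e :: real assume e: "e > 0"
  define d where "d = e / 17"
  have d: "d > 0" using e by (simp add: d_def)
  obtain D where D: "D > 0" "\<And>x. x \<in> X \<Longrightarrow> \<bar>g x\<bar> \<le> D" by (rule continuous_bounded_on[OF X(1) g]) blast
  have ev: "\<forall>\<^sub>F n in sequentially. 2 * c * real (k + 1) / real (r n) < d" for c
    using order_tendstoD(2)[OF tendsto_inverse_r d] .
  have ev_ref: "\<forall>\<^sub>F n in sequentially. \<forall>j\<in>{..<k}. \<bar>ref n j h - integral\<^sup>L (\<mu> j) h\<bar> < d"
    if "continuous_on X h" for h :: "'a \<Rightarrow> real"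
  proof (rule eventually_ball_finite)
    show "\<forall>j\<in>{..<k}. \<forall>\<^sub>F n in sequentially. \<bar>ref n j h - integral\<^sup>L (\<mu> j) h\<bar> < d"
      using \<mu>(3)[OF _ that] d by (auto simp: tendsto_iff dist_real_def)
  qed simp
  show "\<forall>\<^sub>F n in sequentially. dist (\<integral>x. infdist (avg n \<phi> x, avg n g x) ?S \<partial>\<nu>) 0 < e"
    using eventually_approx[OF \<phi> d] eventually_approx[OF g d] ev[of C] ev[of D] ev_ref[OF \<phi>] ev_ref[OF g]
  proof eventually_elim
    fix n
    let ?v = "\<lambda>x. infdist (avg n \<phi> x, avg n g x) ?S" and ?l = "len (Suc n)"
    assume ap: "approx \<phi> n d" "approx g n d"
      and rn: "2 * C * real (k + 1) / real (r n) < d" "2 * D * real (k + 1) / real (r n) < d"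
      and rf: "\<forall>j\<in>{..<k}. \<bar>ref n j \<phi> - integral\<^sup>L (\<mu> j) \<phi>\<bar> < d" "\<forall>j\<in>{..<k}. \<bar>ref n j g - integral\<^sup>L (\<mu> j) g\<bar> < d"
    have "integral\<^sup>L \<nu> ?v \<le> 2 * (8 * d)"
    proof (rule transfer_integral[OF \<nu>])
      show "continuous_on X ?v" by (intro continuous_intros avg_cont \<phi> g)
      show "?v x \<ge> 0" for x by (rule infdist_nonneg)
      fix j a assume j: "j < k" and occ: "occurs centre (Suc n) j a"
      let ?o = "\<lambda>s. orb centre (a + int s)"
      have s1: "(\<Sum>s<?l. \<bar>avg n \<phi> (?o s) - ref n j \<phi>\<bar>) \<le> 3 * d * real ?l"
        using local_averages[OF ap(1) less_imp_le[OF d] C pseudo_centre j occ] rn(1)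
          mult_right_mono[of "2 * d + 2 * C * real (k + 1) / real (r n)" "3 * d" "real ?l"] by linarith
      have s2: "(\<Sum>s<?l. \<bar>avg n g (?o s) - ref n j g\<bar>) \<le> 3 * d * real ?l"
        using local_averages[OF ap(2) less_imp_le[OF d] D(2) pseudo_centre j occ] rn(2)
          mult_right_mono[of "2 * d + 2 * D * real (k + 1) / real (r n)" "3 * d" "real ?l"] by linarith
      have "?v (?o s) \<le> \<bar>avg n \<phi> (?o s) - ref n j \<phi>\<bar> + \<bar>avg n g (?o s) - ref n j g\<bar> + 2 * d" for s
      proof -
        have "?v (?o s) \<le> \<bar>avg n \<phi> (?o s) - integral\<^sup>L (\<mu> j) \<phi>\<bar> + \<bar>avg n g (?o s) - integral\<^sup>L (\<mu> j) g\<bar>"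
          by (rule infdist_pair_le) (use j in auto)
        moreover have "\<bar>ref n j \<phi> - integral\<^sup>L (\<mu> j) \<phi>\<bar> < d" "\<bar>ref n j g - integral\<^sup>L (\<mu> j) g\<bar> < d"
          using rf j by auto
        ultimately show ?thesis by linarith
      qed
      then have "(\<Sum>s<?l. ?v (?o s)) \<le> (\<Sum>s<?l. \<bar>avg n \<phi> (?o s) - ref n j \<phi>\<bar> + \<bar>avg n g (?o s) - ref n j g\<bar> + 2 * d)"
        by (rule sum_mono)
      also have "\<dots> = (\<Sum>s<?l. \<bar>avg n \<phi> (?o s) - ref n j \<phi>\<bar>) + (\<Sum>s<?l. \<bar>avg n g (?o s) - ref n j g\<bar>) + real ?l * (2 * d)"
        by (simp add: sum.distrib)
      also have "\<dots> \<le> 3 * d * real ?l + 3 * d * real ?l + real ?l * (2 * d)" using s1 s2 by linarith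
      also have "\<dots> = 8 * d * real ?l" by simp
      finally show "(\<Sum>s<?l. ?v (?o s)) \<le> 8 * d * real ?l" .
    qed
    moreover have "integral\<^sup>L \<nu> ?v \<ge> 0" by (intro integral_nonneg_AE AE_I2 infdist_nonneg)
    ultimately show "dist (integral\<^sup>L \<nu> ?v) 0 < e" using e by (simp add: d_def)
  qed
qed

lemma two_off_le: "2 * off n \<le> len n"
proof (cases n)
  case (Suc m)
  show ?thesis unfolding Suc using off_Suc_le[OF off_lt, of m] four_len_le[of m] by linarith
qed simp

lemma tendsto_off: "(\<lambda>n. 4 * C * real (off n) / real (len n)) \<longlonglongrightarrow> 0"
proof (rule LIMSEQ_imp_Suc, rule Lim_null_comparison[OF _ tendsto_inverse_r[of "8 * C"]])
  show "\<forall>\<^sub>F n in sequentially. norm (4 * C * real (off (Suc n)) / real (len (Suc n))) \<le> 8 * C * real (k + 1) / real (r n)"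
  proof (rule always_eventually, rule allI)
    fix n
    have "real (off (Suc n)) \<le> 2 * real (len n)" using off_Suc_le[OF off_lt, of n] by linarith
    then have "real (off (Suc n)) / real (len (Suc n)) \<le> 2 * real (len n) / real (len (Suc n))"
      by (intro divide_right_mono) auto
    also have "\<dots> = 2 * 1 / real (r n)" using len_pos[of n] by (simp add: len_Suc)
    also have "\<dots> \<le> 2 * real (k + 1) / real (r n)" by (intro divide_right_mono) auto
    finally have le: "4 * C * (real (off (Suc n)) / real (len (Suc n))) \<le> 4 * C * (2 * real (k + 1) / real (r n))"
      using C_nonneg by (intro mult_left_mono) auto
    have "norm (4 * C * real (off (Suc n)) / real (len (Suc n))) = 4 * C * (real (off (Suc n)) / real (len (Suc n)))"
      using C_nonneg by (simp del: off.simps)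
    also note le
    also have "4 * C * (2 * real (k + 1) / real (r n)) = 8 * C * real (k + 1) / real (r n)"
      by (simp only: times_divide_eq_right mult.assoc[symmetric])
    finally show "norm (4 * C * real (off (Suc n)) / real (len (Suc n))) \<le> 8 * C * real (k + 1) / real (r n)" .
  qed
qed

text \<open>
  The time left until the right end of the block of level \<open>n\<close> around the origin.
\<close>

definition till :: "nat \<Rightarrow> nat" where "till n = len n - off n"

lemma till_ge: "n \<le> till n"
proof (cases n)
  case (Suc m)
  show ?thesis
    unfolding Suc till_def using off_Suc_le[OF off_lt, of m] four_len_le[of m] len_ge[of m] by linarith
qed simp

lemma average_till:
  "\<bar>(1 / real (till n)) * (\<Sum>i<till n. \<phi> ((f ^^ i) x\<^sub>0)) - ref n (n mod 2) \<phi>\<bar>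
     \<le> 2 * err n + 4 * C * real (off n) / real (len n)"
proof -
  let ?l = "len n" and ?o = "off n" and ?N = "till n" and ?r = "ref n (n mod 2) \<phi>"
  let ?S = "\<Sum>i<?N. \<phi> ((f ^^ i) x\<^sub>0)" and ?T = "\<Sum>s<?o. \<phi> (orb centre (- int ?o + int s))"
  have l: "?l = ?o + ?N" using off_lt[of n] by (simp add: till_def)
  have "(\<Sum>s<?l. \<phi> (orb centre (- int ?o + int s))) = ?T + ?S"
    unfolding l sum_lessThan_plus by (simp add: orbit_x0)
  then have 1: "\<bar>?T + ?S - ?r * real ?l\<bar> \<le> err n * real ?l"
    using sum_occurrence[OF approx_err pseudo_centre mod2_lt(1) occurs_centre, of n] by simp
  have "\<bar>?T\<bar> \<le> (\<Sum>s<?o. \<bar>\<phi> (orb centre (- int ?o + int s))\<bar>)" by (rule sum_abs)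
  also have "\<dots> \<le> real ?o * C"
    using sum_bounded_above[of "{..<?o}" "\<lambda>s. \<bar>\<phi> (orb centre (- int ?o + int s))\<bar>" C] C[OF orb_in[OF pseudo_centre]]
    by simp
  finally have 2: "\<bar>?T\<bar> \<le> real ?o * C" .
  have 3: "\<bar>?r * real ?o\<bar> \<le> real ?o * C"
  proof -
    have "\<bar>?r\<bar> \<le> C" by (rule ref_bounded[OF C mod2_lt(1)])
    then have "real ?o * \<bar>?r\<bar> \<le> real ?o * C" by (intro mult_left_mono) simp_all
    then show ?thesis by (simp add: abs_mult mult.commute)
  qed
  have "?S - ?r * real ?N = (?T + ?S - ?r * real ?l) - ?T + ?r * real ?o"
    unfolding l by (simp add: algebra_simps)
  then have 4: "\<bar>?S - ?r * real ?N\<bar> \<le> err n * real ?l + 2 * (real ?o * C)" using 1 2 3 by linarith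
  have N: "real ?l \<le> 2 * real ?N" "real ?N > 0" using two_off_le[of n] len_pos[of n] l by linarith+
  have "\<bar>(1 / real ?N) * ?S - ?r\<bar> = \<bar>?S - ?r * real ?N\<bar> / real ?N"
  proof -
    have "(1 / real ?N) * ?S - ?r = (?S - ?r * real ?N) / real ?N" using N by (simp add: field_simps)
    then show ?thesis by simp
  qed
  also have "\<dots> \<le> (err n * real ?l + 2 * (real ?o * C)) / real ?N"
    using 4 by (intro divide_right_mono) auto
  also have "\<dots> \<le> (err n * real ?l + 2 * (real ?o * C)) / (real ?l / 2)"
    using N len_pos[of n] err_nonneg[of n] C_nonneg by (intro divide_left_mono) auto
  also have "\<dots> = 2 * err n + 4 * C * real ?o / real ?l"
    using len_pos[of n] by (simp add: field_simps)
  finally show ?thesis .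
qed

lemma x0_irregular:
  assumes ne: "integral\<^sup>L (\<mu> 0) \<phi> \<noteq> integral\<^sup>L (\<mu> 1) \<phi>"
  shows "x\<^sub>0 \<in> irregular_set X f \<phi>"
  unfolding irregular_set_def
proof (intro CollectI conjI notI)
  let ?A = "\<lambda>n::nat. (1 / real n) * (\<Sum>i<n. \<phi> ((f ^^ i) x\<^sub>0))"
  show "x\<^sub>0 \<in> X" by (rule orb_in[OF pseudo_centre])
  assume "convergent ?A"
  then obtain l where l: "?A \<longlonglongrightarrow> l" by (auto simp: convergent_def)
  have till: "filterlim till at_top sequentially"
    by (rule filterlim_at_top_mono[OF filterlim_ident]) (use till_ge in auto)
  have At: "(\<lambda>n. ?A (till n)) \<longlonglongrightarrow> l" by (rule filterlim_compose[OF l till])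
  have "(\<lambda>n. 2 * err n + 4 * C * real (off n) / real (len n)) \<longlonglongrightarrow> 2 * 0 + 0"
    by (intro tendsto_add tendsto_mult tendsto_const summable_LIMSEQ_zero[OF summable_err] tendsto_off)
  then have b: "(\<lambda>n. 2 * err n + 4 * C * real (off n) / real (len n)) \<longlonglongrightarrow> 0" by simp
  have "(\<lambda>n. ?A (till n) - ref n (n mod 2) \<phi>) \<longlonglongrightarrow> 0"
    by (rule Lim_null_comparison[OF _ b]) (use average_till in simp)
  from tendsto_diff[OF At this] have ref: "(\<lambda>n. ref n (n mod 2) \<phi>) \<longlonglongrightarrow> l" by simp
  have *: "l = integral\<^sup>L (\<mu> j) \<phi>" if j: "j < 2" for j
  proof -
    have sm: "strict_mono (\<lambda>m::nat. 2 * m + j)" by (rule strict_monoI) simp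
    have "(\<lambda>m. ref (2 * m + j) j \<phi>) \<longlonglongrightarrow> l"
      using LIMSEQ_subseq_LIMSEQ[OF ref sm] j by (simp add: o_def mod_simps)
    moreover have "(\<lambda>m. ref (2 * m + j) j \<phi>) \<longlonglongrightarrow> integral\<^sup>L (\<mu> j) \<phi>"
      using LIMSEQ_subseq_LIMSEQ[OF \<mu>(3)[OF _ \<phi>, of j] sm] j k by (simp add: o_def)
    ultimately show ?thesis by (rule LIMSEQ_unique)
  qed
  show False using *[of 0] *[of 1] ne by simp
qed

theorem x0_conclusion:
  assumes ap0: "approx \<phi> 0 e" "e \<ge> 0"
    and gap: "\<And>i j. \<lbrakk>i < k; j < k; i \<noteq> j\<rbrakk> \<Longrightarrow> \<bar>ref 0 i \<phi> - ref 0 j \<phi>\<bar> > 2 * (2 * e + 2 * C * \<kappa>)"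
  shows "x\<^sub>0 \<in> AP X f \<inter> irregular_set X f \<phi> \<inter> E_set X f k"
proof -
  let ?\<rho> = "2 * e + 2 * C * \<kappa>"
  let ?u = "\<lambda>j x. \<bar>avg 0 \<phi> x - ref 0 j \<phi>\<bar>"
  \<comment> \<open>the integral of \<open>?u j\<close> is small with respect to \<open>\<mu> j\<close> and large with respect to the other measures\<close>
  have u: "continuous_on X (?u j)" for j by (intro continuous_intros avg_cont \<phi>)
  have ge: "(\<integral>x. ?u j x \<partial>\<mu> i) \<ge> \<bar>integral\<^sup>L (\<mu> i) \<phi> - ref 0 j \<phi>\<bar>" if i: "i < k" for i j
  proof -
    note D = invariant_measuresD[OF ds \<mu>_invariant[OF i]]
    interpret prob_space "\<mu> i" by (rule D)
    have int: "integrable (\<mu> i) (avg 0 \<phi>)"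
      by (rule continuous_integrable_on[OF finite_measure_axioms D(2) X(1) avg_cont[OF \<phi>]])
    have "(\<integral>x. avg 0 \<phi> x - ref 0 j \<phi> \<partial>\<mu> i) = integral\<^sup>L (\<mu> i) \<phi> - ref 0 j \<phi>"
      using int integral_time_average_space[OF ds \<mu>_invariant[OF i] \<phi> len_pos[of 0]]
      by (simp add: avg_def prob_space)
    then show ?thesis using integral_abs_bound[of "\<mu> i" "\<lambda>x. avg 0 \<phi> x - ref 0 j \<phi>"] by simp
  qed
  have le: "(\<integral>x. ?u j x \<partial>\<mu> j) \<le> ?\<rho>" if "j < k" for j
    by (rule level0_deviation[OF ap0 C that])
  have mean: "\<bar>integral\<^sup>L (\<mu> j) \<phi> - ref 0 j \<phi>\<bar> \<le> ?\<rho>" if "j < k" for j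
    by (rule order_trans[OF ge[OF that] le[OF that]])
  have tri: "q < \<bar>a - y\<bar>" if "\<bar>a - x\<bar> \<le> q" "2 * q < \<bar>x - y\<bar>" for a x y q :: real
    using that by linarith
  have sep: "(\<integral>x. ?u j x \<partial>\<mu> j) < (\<integral>x. ?u j x \<partial>\<mu> i)" if ij: "i < k" "j < k" "i \<noteq> j" for i j
  proof -
    have "?\<rho> < \<bar>integral\<^sup>L (\<mu> i) \<phi> - ref 0 j \<phi>\<bar>"
      by (rule tri[OF mean[OF ij(1)] gap[OF ij]])
    also have "\<dots> \<le> (\<integral>x. ?u j x \<partial>\<mu> i)" by (rule ge[OF ij(1)])
    finally show ?thesis by (rule le_less_trans[OF le[OF ij(2)]])
  qed
  have dist: "inj_on (\<lambda>j. integral\<^sup>L (\<mu> j) \<phi>) {..<k}"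
  proof (rule inj_onI, rule ccontr)
    fix i j assume ij: "i \<in> {..<k}" "j \<in> {..<k}" "integral\<^sup>L (\<mu> i) \<phi> = integral\<^sup>L (\<mu> j) \<phi>" "i \<noteq> j"
    then have lt: "i < k" "j < k" by auto
    have "?\<rho> < \<bar>integral\<^sup>L (\<mu> i) \<phi> - ref 0 j \<phi>\<bar>"
      by (rule tri[OF mean[OF lt(1)] gap[OF lt ij(4)]])
    then show False using mean[OF lt(2)] ij(3) by simp
  qed
  interpret erg: ergodic_averages X f \<omega> len k \<phi> \<mu>
  proof unfold_locales
    show "\<exists>u :: 'a \<Rightarrow> real. continuous_on X u \<and> (\<forall>i<k. i \<noteq> j \<longrightarrow> integral\<^sup>L (\<mu> j) u < integral\<^sup>L (\<mu> i) u)"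
      if "j < k" for j
      using u[of j] sep[OF _ that] by blast
  qed (use \<omega>_closed len_pos filterlim_len k \<phi> \<mu>_invariant \<mu>_\<omega> dist ds
        summable_variation[unfolded avg_def] near[unfolded avg_def] in auto)
  have "ergodic_measures_on X f \<omega> = \<mu> ` {..<k}" by (rule erg.ergodic_measures_on_eq)
  moreover have "card (\<mu> ` {..<k}) = k" using erg.inj_\<mu> by (simp add: card_image)
  ultimately have "x\<^sub>0 \<in> E_set X f k" using orb_in[OF pseudo_centre] by (simp add: E_set_def)
  moreover have "integral\<^sup>L (\<mu> 0) \<phi> \<noteq> integral\<^sup>L (\<mu> 1) \<phi>"
    using inj_onD[OF dist, of 0 1] k by auto
  ultimately show ?thesis using x0_AP x0_irregular by blast
qed

end

end

section \<open>Loops with separated averages\<close>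

context block_construction
begin

lemma
  assumes \<eta>: "\<And>x y. \<lbrakk>x \<in> X; y \<in> X; dist x y \<le> \<epsilon>\<rbrakk> \<Longrightarrow> \<bar>g x - g y\<bar> \<le> \<eta>"
  shows approx_level0: "approx g 0 (2 * \<eta>)"
    and ref_level0: "j < k \<Longrightarrow> \<bar>ref 0 j g - sum_list (map g (w j)) / real L\<bar> \<le> \<eta>"
proof -
  have L: "len 0 = L" "L > 0" using len_pos[of 0] by (simp_all add: len_def)
  have orb: "\<bar>g (orb p t) - g (p t)\<bar> \<le> \<eta>" if "pseudo p" for p t
    using that by (intro \<eta> orb_in orb_close) (auto simp: pseudo_orbit_def)
  show "approx g 0 (2 * \<eta>)"
    unfolding approx_def
  proof (intro allI impI)
    fix p j a assume p: "pseudo p" and j: "j < k" and occ: "occurs p 0 j a"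
    note q = pseudo_per[OF j, of 0]
    have "\<bar>g (orb p (a + int s)) - g (orb (per 0 j) (int s))\<bar> \<le> 2 * \<eta>" if s: "s < len 0" for s
    proof -
      have "p (a + int s) = per 0 j (int s)"
        using occ occurs_per[OF j, of 0 0] s by (simp add: occurs_def)
      then show ?thesis using orb[OF p, of "a + int s"] orb[OF q, of "int s"] by simp
    qed
    then show "(\<Sum>s<len 0. \<bar>g (orb p (a + int s)) - g (orb (per 0 j) (int s))\<bar>) \<le> 2 * \<eta> * real (len 0)"
      using sum_bounded_above[of "{..<len 0}" "\<lambda>s. \<bar>g (orb p (a + int s)) - g (orb (per 0 j) (int s))\<bar>"]
      by (simp add: mult.commute)
  qed
  show "\<bar>ref 0 j g - sum_list (map g (w j)) / real L\<bar> \<le> \<eta>" if j: "j < k"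
  proof -
    note q = pseudo_per[OF j, of 0]
    have wj: "w j ! s = per 0 j (int s)" if "s < L" for s
      using occurs_per[OF j, of 0 0] that L(1) by (simp add: occurs_def)
    have "sum_list (map g (w j)) = (\<Sum>s<L. g (per 0 j (int s)))"
      using loops[OF j] wj by (simp add: sum_list_sum_nth atLeast0LessThan)
    then have "ref 0 j g - sum_list (map g (w j)) / real L
        = (\<Sum>s<L. g (orb (per 0 j) (int s)) - g (per 0 j (int s))) / real L"
      by (simp add: ref_def L(1) sum_subtractf diff_divide_distrib)
    then have "\<bar>ref 0 j g - sum_list (map g (w j)) / real L\<bar>
        = \<bar>\<Sum>s<L. g (orb (per 0 j) (int s)) - g (per 0 j (int s))\<bar> / real L" by simp
    also have "\<dots> \<le> (real L * \<eta>) / real L"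
    proof (rule divide_right_mono)
      have "\<bar>\<Sum>s<L. g (orb (per 0 j) (int s)) - g (per 0 j (int s))\<bar>
          \<le> (\<Sum>s<L. \<bar>g (orb (per 0 j) (int s)) - g (per 0 j (int s))\<bar>)" by (rule sum_abs)
      also have "\<dots> \<le> real L * \<eta>"
        using sum_bounded_above[of "{..<L}" "\<lambda>s. \<bar>g (orb (per 0 j) (int s)) - g (per 0 j (int s))\<bar>" \<eta>] orb[OF q]
        by simp
      finally show "\<bar>\<Sum>s<L. g (orb (per 0 j) (int s)) - g (per 0 j (int s))\<bar> \<le> real L * \<eta>" .
    qed simp
    finally show ?thesis using L(2) by simp
  qed
qed

end

text \<open>
  The uniform measure on a periodic orbit, obtained as the limit of a constant sequence.
\<close>

lemma invariant_measure_of_periodic_point: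
  fixes X :: "'a::metric_space set"
  assumes ds: "dynamical_system X f" and u: "u \<in> X" and L: "L > 0" "(f ^^ L) u = u"
  shows "invariant_measures X f \<noteq> {}"
proof -
  have X: "compact X" "continuous_on X f" "f ` X \<subseteq> X" using ds by (auto simp: dynamical_system_def)
  let ?E = "\<lambda>(n::nat) s. (f ^^ s) u"
  have "\<exists>\<mu>. prob_space \<mu> \<and> sets \<mu> = sets (restrict_space borel X) \<and>
      (\<forall>g :: 'a \<Rightarrow> real. continuous_on X g \<longrightarrow> (\<lambda>n::nat. (\<Sum>s<L. g (?E n s)) / real L) \<longlonglongrightarrow> integral\<^sup>L \<mu> g)"
  proof (rule limit_of_nested_averages[where r = "\<lambda>_. 1" and \<epsilon> = "\<lambda>_. 0" and \<beta> = "\<lambda>_. 0", OF X(1)])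
    have "{s. s < L \<and> dist ((f ^^ s) u) ((f ^^ (s mod L)) u) > 0} = {}" by auto
    then show "real (card {s. s < L \<and> dist ((f ^^ s) u) ((f ^^ (s mod L)) u) > 0}) \<le> 0 * real L"
      by (simp only: card.empty)
  qed (use X u L in \<open>auto simp: funpow_closed\<close>)
  then obtain \<mu> where \<mu>: "prob_space \<mu>" "sets \<mu> = sets (restrict_space borel X)"
    and int: "\<And>g :: 'a \<Rightarrow> real. continuous_on X g \<Longrightarrow> integral\<^sup>L \<mu> g = (\<Sum>s<L. g ((f ^^ s) u)) / real L"
    by (auto simp: LIMSEQ_const_iff)
  have "\<mu> \<in> invariant_measures X f"
  proof (rule invariant_measuresI[OF ds \<mu>])
    fix g :: "'a \<Rightarrow> real" assume g: "continuous_on X g"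
    have g': "continuous_on X (\<lambda>x. g (f x))" using continuous_on_compose2[OF g X(2,3)] .
    have "(\<Sum>s<L. g ((f ^^ (1 + s)) u)) = (\<Sum>s<L. g ((f ^^ s) u))"
      by (rule sum_periodic_window) (simp add: funpow_add L(2))
    then show "(\<integral>x. g (f x) \<partial>\<mu>) = integral\<^sup>L \<mu> g" by (simp add: int[OF g] int[OF g'])
  qed
  then show ?thesis by blast
qed

text \<open>
  A loop exists by transitivity, and its periodic repetition is traced by a periodic point.
\<close>

lemma invariant_measure_exists:
  fixes X :: "'a::metric_space set"
  assumes ds: "dynamical_system X f" and tr: "topologically_transitive X f"
    and \<delta>: "\<delta> > 0" and tc: "tracing X f \<delta> \<epsilon> \<pi>" and z: "z \<in> X"
  shows "invariant_measures X f \<noteq> {}"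
proof -
  obtain v where "chain X f \<delta> (z # v @ [z])" using chain_connecting[OF ds tr \<delta>] z by blast
  then have loop: "loop X f \<delta> z (z # v)" by (simp add: loop_def)
  let ?p = "periodic (z # v)" and ?L = "length (z # v)"
  have p: "pseudo_orbit X f \<delta> (\<lambda>i. ?p (i + a))" for a
    by (rule pseudo_orbit_shift[OF pseudo_orbit_periodic[OF loop]])
  have st: "f (\<pi> (\<lambda>i. ?p (i + a))) = \<pi> (\<lambda>i. ?p (i + (a + 1)))" for a
  proof -
    have "f (\<pi> (\<lambda>i. ?p (i + a))) = \<pi> (\<lambda>i. ?p (i + 1 + a))" using tc p[of a] unfolding tracing_def by blast
    then show ?thesis by (simp add: ac_simps)
  qed
  have fp: "(f ^^ n) (\<pi> (\<lambda>i. ?p (i + 0))) = \<pi> (\<lambda>i. ?p (i + int n))" for n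
  proof (induction n)
    case (Suc n)
    have "int (Suc n) = int n + 1" by simp
    then show ?case using Suc st[of "int n"] by (simp only: funpow.simps o_apply)
  qed simp
  have "?p (i + int ?L) = ?p (i + 0)" for i by (simp add: periodic_def)
  then have "(f ^^ ?L) (\<pi> (\<lambda>i. ?p (i + 0))) = \<pi> (\<lambda>i. ?p (i + 0))" unfolding fp by (simp only:)
  moreover have "\<pi> (\<lambda>i. ?p (i + 0)) \<in> X" using tc p[of 0] unfolding tracing_def by blast
  ultimately show ?thesis by (intro invariant_measure_of_periodic_point[OF ds, where L = ?L]) simp_all
qed

lemma orbit_segment_below_integral:
  fixes X :: "'a::metric_space set" and \<phi> :: "'a \<Rightarrow> real"
  assumes ds: "dynamical_system X f" and \<mu>: "\<mu> \<in> invariant_measures X f" and \<phi>: "continuous_on X \<phi>"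
    and c: "integral\<^sup>L \<mu> \<phi> < c"
  shows "\<exists>x\<in>X. (\<Sum>i<n. \<phi> ((f ^^ i) x)) \<le> real n * c"
proof (rule ccontr)
  note D = invariant_measuresD[OF ds \<mu>]
  interpret prob_space \<mu> by (rule D)
  have X: "compact X" using ds by (simp add: dynamical_system_def)
  assume "\<not> ?thesis"
  then have gt: "\<And>x. x \<in> X \<Longrightarrow> real n * c < (\<Sum>i<n. \<phi> ((f ^^ i) x))" by (simp add: not_le)
  have "X \<noteq> {}" using not_empty D(3) by simp
  then have n: "n > 0" using gt by (cases n) auto
  have "integrable \<mu> (time_average f n \<phi>)"
    by (rule continuous_integrable_on[OF finite_measure_axioms D(2) X continuous_on_time_average[OF ds \<phi>]])
  then have "c \<le> (\<integral>x. time_average f n \<phi> x \<partial>\<mu>)"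
  proof (rule integral_ge_const)
    show "AE x in \<mu>. c \<le> time_average f n \<phi> x"
      using gt n D(3) by (intro AE_I2) (auto simp: time_average_def pos_le_divide_eq mult.commute less_imp_le)
  qed
  then show False using integral_time_average_space[OF ds \<mu> \<phi> n] c by simp
qed

text \<open>
  The orbit segments with averages below a number exceeding \<open>integral\<^sup>L \<mu>\<^sub>1 \<phi>\<close>, and above a number less
  than \<open>integral\<^sup>L \<mu>\<^sub>2 \<phi>\<close>, exist for every length because integration of time averages gives the integral.
\<close>

lemma loop_families:
  fixes X :: "'a::metric_space set" and \<phi> :: "'a \<Rightarrow> real"
  assumes ds: "dynamical_system X f" and tr: "topologically_transitive X f" and \<delta>: "\<delta> > 0"
    and \<phi>: "continuous_on X \<phi>" and z: "z \<in> X" and k: "k \<ge> 2"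
    and \<mu>: "\<mu>\<^sub>1 \<in> invariant_measures X f" "\<mu>\<^sub>2 \<in> invariant_measures X f"
    and lt: "integral\<^sup>L \<mu>\<^sub>1 \<phi> < integral\<^sup>L \<mu>\<^sub>2 \<phi>"
  shows "\<exists>w L. L > 0 \<and> (\<forall>j<k. loop X f \<delta> z (w j) \<and> length (w j) = L) \<and>
     (\<forall>i<k. \<forall>j<k. i \<noteq> j \<longrightarrow> \<bar>sum_list (map \<phi> (w i)) - sum_list (map \<phi> (w j))\<bar> / real L
        \<ge> (integral\<^sup>L \<mu>\<^sub>2 \<phi> - integral\<^sup>L \<mu>\<^sub>1 \<phi>) / 3 / real k)"
proof -
  let ?a = "integral\<^sup>L \<mu>\<^sub>1 \<phi>" and ?b = "integral\<^sup>L \<mu>\<^sub>2 \<phi>"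
  \<comment> \<open>a third of the gap is left between the loops: each side loses \<open>\<zeta>\<close> for the segment and \<open>\<zeta>\<close> for closing it\<close>
  define \<zeta> where "\<zeta> = (?b - ?a) / 6"
  have \<zeta>: "\<zeta> > 0" using lt by (simp add: \<zeta>_def)
  have X: "compact X" using ds by (simp add: dynamical_system_def)
  obtain C where C: "C > 0" "\<And>x. x \<in> X \<Longrightarrow> \<bar>\<phi> x\<bar> \<le> C" by (rule continuous_bounded_on[OF X \<phi>]) blast
  have "\<exists>w. loop X f \<delta> z w \<and> sum_list (map \<phi> w) \<le> (?a + \<zeta> + \<zeta>) * real (length w)"
    by (rule loop_with_small_average[OF ds tr \<delta> C(2) z \<zeta>])
       (simp_all add: orbit_segment_below_integral[OF ds \<mu>(1) \<phi>] \<zeta>)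
  then obtain A where A: "loop X f \<delta> z A" "sum_list (map \<phi> A) \<le> (?a + \<zeta> + \<zeta>) * real (length A)" by blast
  have neg: "continuous_on X (\<lambda>x. - \<phi> x)" by (intro continuous_intros \<phi>)
  have "\<exists>w. loop X f \<delta> z w \<and> sum_list (map (\<lambda>x. - \<phi> x) w) \<le> (- ?b + \<zeta> + \<zeta>) * real (length w)"
  proof (rule loop_with_small_average[OF ds tr \<delta> _ z \<zeta>])
    show "\<exists>x\<in>X. (\<Sum>i<n. - \<phi> ((f ^^ i) x)) \<le> real n * (- ?b + \<zeta>)" for n
      by (rule orbit_segment_below_integral[OF ds \<mu>(2) neg]) (simp add: \<zeta>)
    show "\<bar>- \<phi> x\<bar> \<le> C" if "x \<in> X" for x using C(2)[OF that] by simp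
  qed
  then obtain B where B: "loop X f \<delta> z B"
    and B': "sum_list (map (\<lambda>x. - \<phi> x) B) \<le> (- ?b + \<zeta> + \<zeta>) * real (length B)" by blast
  have "sum_list (map (\<lambda>x. - \<phi> x) B) = - sum_list (map \<phi> B)" by (induction B) auto
  moreover have "(- ?b + \<zeta> + \<zeta>) * real (length B) = - ((?b - \<zeta> - \<zeta>) * real (length B))"
    by (simp add: algebra_simps)
  ultimately have B2: "sum_list (map \<phi> B) \<ge> (?b - \<zeta> - \<zeta>) * real (length B)" using B' by linarith
  have ab: "?a + \<zeta> + \<zeta> < ?b - \<zeta> - \<zeta>"
  proof -
    have "a + (b - a) / 6 + (b - a) / 6 < b - (b - a) / 6 - (b - a) / 6" if "a < b" for a b :: real
      using that by (simp add: field_simps)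
    from this[OF lt] show ?thesis unfolding \<zeta>_def .
  qed
  have eq: "(?b - \<zeta> - \<zeta>) - (?a + \<zeta> + \<zeta>) = (?b - ?a) / 3" unfolding \<zeta>_def by (simp add: field_simps)
  show ?thesis using loops_with_distinct_averages[OF A B B2 ab k] unfolding eq .
qed

theorem theorem5:
  fixes X :: "'a::metric_space set" and f :: "'a \<Rightarrow> 'a" and \<phi> :: "'a \<Rightarrow> real"
  assumes "dynamical_system X f"
    and "topologically_expanding X f \<or> topologically_hyperbolic X f"
    and "topologically_transitive X f"
    and "continuous_on X \<phi>"
    and "Int_L X f \<phi> \<noteq> {}"
  shows "\<forall>k::nat\<ge>2. AP X f \<inter> irregular_set X f \<phi> \<inter> E_set X f k \<noteq> {}"
proof (intro allI impI)
  fix k :: nat assume k: "k \<ge> 2"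
  note ds = assms(1) and tr = assms(3) and \<phi> = assms(4)
  have X: "compact X" using ds by (simp add: dynamical_system_def)
  have "X \<noteq> {}" using assms(2) by (auto simp: topologically_expanding_def topologically_hyperbolic_def)
  then obtain z where z: "z \<in> X" by blast
  have tracing_ex: "\<exists>\<delta>>0. \<exists>\<pi>. tracing X f \<delta> \<epsilon> \<pi>" if "\<epsilon> > 0" for \<epsilon>
    using assms(2) tracing_expanding[OF ds _ that] tracing_hyperbolic[OF ds _ that] by blast
  have ne: "invariant_measures X f \<noteq> {}"
    using tracing_ex[of 1] invariant_measure_exists[OF ds tr _ _ z] by auto
  \<comment> \<open>if all integrals were equal, the image would be a singleton, as there are invariant measures\<close>
  have "\<exists>\<mu>\<^sub>1\<in>invariant_measures X f. \<exists>\<mu>\<^sub>2\<in>invariant_measures X f. integral\<^sup>L \<mu>\<^sub>1 \<phi> < integral\<^sup>L \<mu>\<^sub>2 \<phi>"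
  proof (rule ccontr)
    assume no: "\<not> ?thesis"
    obtain \<mu> where \<mu>: "\<mu> \<in> invariant_measures X f" using ne by blast
    have "integral\<^sup>L \<nu> \<phi> = integral\<^sup>L \<mu> \<phi>" if "\<nu> \<in> invariant_measures X f" for \<nu>
    proof -
      have "\<not> integral\<^sup>L \<nu> \<phi> < integral\<^sup>L \<mu> \<phi>" "\<not> integral\<^sup>L \<mu> \<phi> < integral\<^sup>L \<nu> \<phi>"
        using no that \<mu> by blast+
      then show ?thesis by linarith
    qed
    then have "(\<lambda>\<nu>. integral\<^sup>L \<nu> \<phi>) ` invariant_measures X f = (\<lambda>\<nu>. integral\<^sup>L \<mu> \<phi>) ` invariant_measures X f"
      by (rule image_cong[OF refl])
    also have "\<dots> = {integral\<^sup>L \<mu> \<phi>}" by (rule image_constant[OF \<mu>])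
    finally have "(\<lambda>\<nu>. integral\<^sup>L \<nu> \<phi>) ` invariant_measures X f = {integral\<^sup>L \<mu> \<phi>}" .
    then show False using assms(5) by (simp add: Int_L_def)
  qed
  then obtain \<mu>\<^sub>1 \<mu>\<^sub>2 where \<mu>: "\<mu>\<^sub>1 \<in> invariant_measures X f" "\<mu>\<^sub>2 \<in> invariant_measures X f"
    and lt: "integral\<^sup>L \<mu>\<^sub>1 \<phi> < integral\<^sup>L \<mu>\<^sub>2 \<phi>" by blast
  obtain C where C: "C > 0" "\<And>x. x \<in> X \<Longrightarrow> \<bar>\<phi> x\<bar> \<le> C" by (rule continuous_bounded_on[OF X \<phi>]) blast
  \<comment> \<open>the loop averages are \<open>20 * \<eta>\<close> apart; tracing costs at most \<open>2 * \<eta>\<close> of this, and the gap needed is \<open>12 * \<eta>\<close>\<close>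
  define \<eta> where "\<eta> = (integral\<^sup>L \<mu>\<^sub>2 \<phi> - integral\<^sup>L \<mu>\<^sub>1 \<phi>) / 3 / real k / 20"
  have \<eta>: "\<eta> > 0" using lt k by (simp add: \<eta>_def)
  define \<kappa> where "\<kappa> = \<eta> / C"
  have \<kappa>: "\<kappa> > 0" using \<eta> C by (simp add: \<kappa>_def)
  have uc: "\<exists>d>0. \<forall>x\<in>X. \<forall>y\<in>X. dist x y < d \<longrightarrow> \<bar>\<phi> x - \<phi> y\<bar> < e" if "e > 0" for e
  proof -
    from compact_uniformly_continuous[OF \<phi> X] that obtain d
      where d: "d > 0" "\<forall>x\<in>X. \<forall>x'\<in>X. dist x' x < d \<longrightarrow> dist (\<phi> x') (\<phi> x) < e"
      unfolding uniformly_continuous_on_def by blast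
    then show ?thesis unfolding dist_real_def by (intro exI[of _ d]) blast
  qed
  obtain d where d: "d > 0" "\<forall>x\<in>X. \<forall>y\<in>X. dist x y < d \<longrightarrow> \<bar>\<phi> x - \<phi> y\<bar> < \<eta>" using uc[OF \<eta>] by blast
  define \<epsilon> where "\<epsilon> = d / 2"
  have \<epsilon>: "\<epsilon> > 0" using d by (simp add: \<epsilon>_def)
  have \<epsilon>\<phi>: "\<bar>\<phi> x - \<phi> y\<bar> \<le> \<eta>" if "x \<in> X" "y \<in> X" "dist x y \<le> \<epsilon>" for x y
    using d that by (auto simp: \<epsilon>_def intro!: less_imp_le)
  obtain \<delta> \<pi> where \<delta>: "\<delta> > 0" and tc: "tracing X f \<delta> \<epsilon> \<pi>" using tracing_ex[OF \<epsilon>] by blast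
  obtain w L where L: "L > 0" and w: "\<And>j. j < k \<Longrightarrow> loop X f \<delta> z (w j) \<and> length (w j) = L"
    and gap: "\<And>i j. \<lbrakk>i < k; j < k; i \<noteq> j\<rbrakk> \<Longrightarrow>
      \<bar>sum_list (map \<phi> (w i)) - sum_list (map \<phi> (w j))\<bar> / real L \<ge> 20 * \<eta>"
  proof -
    have eq: "(integral\<^sup>L \<mu>\<^sub>2 \<phi> - integral\<^sup>L \<mu>\<^sub>1 \<phi>) / 3 / real k = 20 * \<eta>"
    proof -
      have "x = 20 * (x / 20)" for x :: real by simp
      then show ?thesis unfolding \<eta>_def .
    qed
    show ?thesis using loop_families[OF ds tr \<delta> \<phi> z k \<mu> lt] that unfolding eq by blast
  qed
  have "\<exists>R::nat. \<forall>p p'. pseudo_orbit X f \<delta> p \<and> pseudo_orbit X f \<delta> p' \<and> (\<forall>i. \<bar>i\<bar> \<le> int R \<longrightarrow> p i = p' i) \<longrightarrow>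
      dist (\<pi> p) (\<pi> p') < (1 / 2) ^ n \<and> \<bar>\<phi> (\<pi> p) - \<phi> (\<pi> p')\<bar> < (1 / 2) ^ n" for n :: nat
  proof -
    obtain d where d: "d > 0" "\<forall>x\<in>X. \<forall>y\<in>X. dist x y < d \<longrightarrow> \<bar>\<phi> x - \<phi> y\<bar> < (1 / 2) ^ n"
      using uc[of "(1 / 2) ^ n"] by auto
    obtain R :: nat where R: "\<forall>p p'. pseudo_orbit X f \<delta> p \<and> pseudo_orbit X f \<delta> p' \<and>
        (\<forall>i. \<bar>i\<bar> \<le> int R \<longrightarrow> p i = p' i) \<longrightarrow> dist (\<pi> p) (\<pi> p') < min d ((1 / 2) ^ n)"
    proof -
      have "min d ((1 / 2) ^ n) > 0" using d(1) by simp
      then show ?thesis using tc that unfolding tracing_def by blast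
    qed
    have "\<forall>p. pseudo_orbit X f \<delta> p \<longrightarrow> \<pi> p \<in> X" using tc unfolding tracing_def by blast
    then show ?thesis using R d(2) by (intro exI[of _ R]) (simp add: min_less_iff_conj)
  qed
  then obtain R :: "nat \<Rightarrow> nat" where R: "\<And>n p p'. \<lbrakk>pseudo_orbit X f \<delta> p; pseudo_orbit X f \<delta> p'; \<And>i. \<bar>i\<bar> \<le> int (R n) \<Longrightarrow> p i = p' i\<rbrakk> \<Longrightarrow>
      dist (\<pi> p) (\<pi> p') < (1 / 2) ^ n \<and> \<bar>\<phi> (\<pi> p) - \<phi> (\<pi> p')\<bar> < (1 / 2) ^ n"
    by metis
  obtain m :: nat where m: "real m > 1 / \<kappa>" using reals_Archimedean2 by blast
  then have m\<kappa>: "\<kappa> * real m \<ge> 1" using \<kappa> by (simp add: field_simps)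
  have m0: "m > 0" using m \<kappa> by (cases m) (auto simp: field_simps)
  \<comment> \<open>the factors give summability, the bound by \<open>\<kappa>\<close> and room for the windows, in this order\<close>
  define r where "r n = 2 ^ Suc n * (m * (k + 2) * (R (Suc n) + 1))" for n
  have r_ge: "r n \<ge> k + 2" for n
  proof -
    have "1 * (1 * (k + 2) * 1) \<le> 2 ^ Suc n * (m * (k + 2) * (R (Suc n) + 1))"
      using m0 by (intro mult_le_mono) auto
    then show ?thesis by (simp add: r_def)
  qed
  have half: "(1 / 2) ^ Suc n * real (r n) = real m * real (k + 2) * real (R (Suc n) + 1)" for n
    unfolding r_def of_nat_mult of_nat_power by (simp add: power_divide)
  have r_window: "real (R (Suc n)) \<le> (1 / 2) ^ n * real (r n)" for n
  proof -
    have "1 * 1 * real (R (Suc n)) \<le> real m * real (k + 2) * real (R (Suc n) + 1)"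
      using m0 by (intro mult_mono) auto
    also have "\<dots> = (1 / 2) ^ Suc n * real (r n)" by (rule half[symmetric])
    also have "\<dots> \<le> (1 / 2) ^ n * real (r n)" by (intro mult_right_mono) auto
    finally show ?thesis by simp
  qed
  have r_growth: "real (k + 1) \<le> \<kappa> * (1 / 2) ^ Suc n * real (r n)" for n
  proof -
    have "1 * real (k + 1) * 1 \<le> (\<kappa> * real m) * real (k + 2) * real (R (Suc n) + 1)"
      using m\<kappa> by (intro mult_mono) auto
    also have "\<dots> = \<kappa> * ((1 / 2) ^ Suc n * real (r n))" unfolding half by (simp only: ac_simps)
    finally show ?thesis by (simp only: ac_simps) simp
  qed
  interpret block_measures X f \<delta> \<epsilon> \<pi> z w k L r \<phi> R \<kappa>
    by unfold_locales (fact ds tc k w r_ge \<phi> R r_window r_growth)+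
  have "x\<^sub>0 \<in> AP X f \<inter> irregular_set X f \<phi> \<inter> E_set X f k"
  proof (rule x0_conclusion[OF C(2) approx_level0[OF \<epsilon>\<phi>]])
    show "0 \<le> 2 * \<eta>" using \<eta> by simp
    fix i j assume ij: "i < k" "j < k" "i \<noteq> j"
    have "\<bar>sum_list (map \<phi> (w i)) / real L - sum_list (map \<phi> (w j)) / real L\<bar>
        = \<bar>sum_list (map \<phi> (w i)) - sum_list (map \<phi> (w j))\<bar> / real L"
      by (simp flip: diff_divide_distrib)
    then have "20 * \<eta> \<le> \<bar>sum_list (map \<phi> (w i)) / real L - sum_list (map \<phi> (w j)) / real L\<bar>"
      using gap[OF ij] by simp
    moreover have "\<bar>ref 0 i \<phi> - sum_list (map \<phi> (w i)) / real L\<bar> \<le> \<eta>" by (rule ref_level0[OF \<epsilon>\<phi> ij(1)])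
    moreover have "\<bar>ref 0 j \<phi> - sum_list (map \<phi> (w j)) / real L\<bar> \<le> \<eta>" by (rule ref_level0[OF \<epsilon>\<phi> ij(2)])
    moreover have "2 * (2 * (2 * \<eta>) + 2 * C * \<kappa>) = 12 * \<eta>" using C(1) by (simp add: \<kappa>_def)
    ultimately show "2 * (2 * (2 * \<eta>) + 2 * C * \<kappa>) < \<bar>ref 0 i \<phi> - ref 0 j \<phi>\<bar>" using \<eta> by linarith
  qed
  then show "AP X f \<inter> irregular_set X f \<phi> \<inter> E_set X f k \<noteq> {}" by blast
qed

end
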